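(* Fix $k \in \mathbb{N}$ (a positive integer). Then for almost all real numbers $\alpha \in (0,1)$ (in the sense of Lebesgue measure), $$\sup_{f \in \mathcal{M}_1} \frac{1}{x}\left|\sum_{n \le x} f(n)\, e(\alpha \phi_k(n))\right| \to 0 \quad\text{and}\quad \sup_{f \in \mathcal{M}_1} \frac{1}{x}\left|\sum_{n \le x} f(n)\, e(\alpha \sigma_k(n))\right| \to 0$$ as $x \to \infty$.
   Context: $e(y) = e^{2\pi i y}$. $\mathcal{M}_1$ is the set of all (complex-valued) multiplicative arithmetic functions $f$ (i.e. $f(mn)=f(m)f(n)$ whenever $\gcd(m,n)=1$) such that $|f(n)| = 1$ for all positive integers $n$. $\phi$ is Euler's totient function, $\sigma$ is the sum-of-divisors function, and $\phi_k$, $\sigma_k$ denote their $k$-th iterates (so $\sigma_k$ is $\sigma$ composed with itself $k$ times, not the sum of $k$-th powers of divisors). Sums over $n \le x$ run over positive integers. *)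

theory Defs
  imports "HOL-Analysis.Analysis" "HOL-Number_Theory.Totient"
begin

definition unit_exp :: "real \<Rightarrow> complex" where
  "unit_exp y = exp (2 * of_real pi * \<i> * of_real y)"

text \<open>
  Arithmetic functions live on the positive integers, but have type \<^typ>\<open>nat \<Rightarrow> complex\<close> here,
  so all conditions are restricted to positive arguments and the value at 0 is unconstrained.
\<close>

definition multiplicative :: "(nat \<Rightarrow> complex) \<Rightarrow> bool" where
  "multiplicative f \<longleftrightarrow> (\<forall>m n. m > 0 \<longrightarrow> n > 0 \<longrightarrow> coprime m n \<longrightarrow> f (m * n) = f m * f n)"

text \<open>
  Usual definitions of multiplicativity also demand \<open>f 1 = 1\<close> (or \<open>f\<close> not identically 0);
  below this follows from \<open>f 1 = f 1 * f 1\<close> and \<open>norm (f 1) = 1\<close>.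
\<close>

definition M1 :: "(nat \<Rightarrow> complex) set" where
  "M1 = {f. multiplicative f \<and> (\<forall>n>0. norm (f n) = 1)}"

definition divisor_sum :: "nat \<Rightarrow> nat" where
  "divisor_sum n = (\<Sum>d | d dvd n. d)"

text \<open>
  In the supremum below, \<open>M1\<close> is nonempty (it contains the constant function 1) and
  for \<open>x > 0\<close> the values are bounded by 1, so the supremum over the reals is the true one.
  It is used with \<open>g = totient ^^ k\<close> and \<open>g = divisor_sum ^^ k\<close>, the \<open>k\<close>-fold iterates under composition.
\<close>

definition sup_mean :: "(nat \<Rightarrow> nat) \<Rightarrow> real \<Rightarrow> real \<Rightarrow> real" where
  "sup_mean g \<alpha> x =
     (SUP f\<in>M1. 1 / x * norm (\<Sum>n | 0 < n \<and> real n \<le> x. f n * unit_exp (\<alpha> * real (g n))))"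

end

theory Submission
  imports Defs "HOL-Real_Asymp.Real_Asymp" "HOL-Computational_Algebra.Squarefree"
begin

text \<open>
  Write $F$ for \<open>totient\<close> or \<open>divisor_sum\<close> and $F_k$ for its $k$-th iterate. The mean of $f(n)\,e(\alpha F_k(n))$
  is controlled uniformly in $f$ by bilinear structure, as in the theorem of Daboussi and its proof by Katai.
  By the Turan-Kubilius inequality almost every $n \le N$ has about $L = \sum 1/p$ prime factors in a window of
  primes, so the sum over $n$ is, up to $O(N/\sqrt L)$, the average of the sums over $n = pm$ with $p$ in the
  window. There $f(pm) = f(p) f(m)$ for most pairs, and the Cauchy-Schwarz inequality in $m$ removes $f$ altogether
  (\<open>mean_le_correlations\<close>): what remains are the correlations
  $\sum_m e(\alpha (F_k(pm) - F_k(qm)))$ for pairs $p \ne q$ in one dyadic block.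
  
  Integrated over $\alpha$, the square of such a correlation counts the coincidences
  $F_k(pm) - F_k(qm) = F_k(pm') - F_k(qm')$. The arithmetic core (\<open>card_coincidences_le\<close>) is that these
  are rarer than the trivial bound by more than any power of $\log N$. The reason is a chain of primes. A typical $m$
  is divisible by a large prime $q_0$ such that $F(q_0) = q_0 \pm 1$ has a large prime factor $q_1$, then
  $q_1 \pm 1$ has a large prime factor $q_2$, and so on. For typical $n$ every large prime divides each iterate
  $F_i(n)$ at most once, so that $q_i$ splits off from $F_i(n)$ and the multiplicativity of $F$ gives
  $F_k(pm) = F(q_{k-1}) A$, where $A$ depends only on the cofactors $F(q_i)/q_{i+1}$, on $m/q_0$ and on $p$. Hence a
  difference $F_k(pm) - F_k(qm) = F(q_{k-1}) (A - A')$ with a given value $v \ne 0$ determines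
  $q_{k-1}$ from the cofactors, then $q_{k-2}, \dots, q_0$ and $m$ itself. As $q_{k-1}$ is large, there are few
  choices of cofactors, so each $v \ne 0$ is taken rarely. That the difference itself rarely vanishes follows from
  the same argument with the roles exchanged: $m$ and $p$ are kept fixed and the chain starts at $q$.
  
  The exceptional integers are those with a repeated large prime, rare because $\sum_{q > z} 1/q^2 \le 1/z$, and those with
  too many prime factors or without a chain, rare by \<open>sum_inverse_many_prime_factors\<close>. Both savings beat every power
  of $\log N$, and this pays both for the crude bound
  $\sum_{p \le x,\, m \mid p \pm 1} 1/p \ll (\log x)/m$, used in place of sieve estimates, and for the
  summability over the sequence $N_j = \lfloor \exp \sqrt j \rfloor$. So the correlations tend to $0$ along $N_j$ for almost every
  $\alpha$, and since $N_{j+1}/N_j \to 1$ the means tend to $0$ along all real $x$.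
\<close>

section \<open>Harmonic sums over integers and primes\<close>

abbreviation harmr :: "nat \<Rightarrow> real" where "harmr \<equiv> harm"

definition bigomega :: "nat \<Rightarrow> nat" where
  "bigomega n = size (prime_factorization n)"

lemma bigomega_mult: "a > 0 \<Longrightarrow> b > 0 \<Longrightarrow> bigomega (a * b) = bigomega a + bigomega b"
  by (simp add: bigomega_def prime_factorization_mult)

lemma bigomega_prod:
  "finite A \<Longrightarrow> (\<And>x. x \<in> A \<Longrightarrow> f x > 0) \<Longrightarrow> bigomega (prod f A) = (\<Sum>x\<in>A. bigomega (f x))"
  by (induction A rule: finite_induct) (auto simp: bigomega_mult prod_pos, simp add: bigomega_def)

lemma bigomega_eq_sum: "bigomega n = (\<Sum>p\<in>prime_factors n. multiplicity p n)"
  unfolding bigomega_def size_multiset_overloaded_eq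
  by (intro sum.cong refl) (auto simp: count_prime_factorization_prime in_prime_factors_imp_prime)

lemma prod_prime_powers: "n > 0 \<Longrightarrow> (\<Prod>p\<in>prime_factors n. p ^ multiplicity p n) = (n::nat)"
  by (subst prod_prime_factors) auto

lemma two_power_bigomega_le:
  assumes "n > 0" shows "2 ^ bigomega n \<le> n"
proof -
  have "2 ^ bigomega n = (\<Prod>p\<in>prime_factors n. 2 ^ multiplicity p n :: nat)"
    by (simp add: bigomega_eq_sum power_sum)
  also have "\<dots> \<le> (\<Prod>p\<in>prime_factors n. p ^ multiplicity p n)"
    by (intro prod_mono) (auto intro!: power_mono dest!: in_prime_factors_imp_prime prime_ge_2_nat)
  finally show ?thesis using prod_prime_powers[OF assms] by simp
qed

lemma le_power_bigomega:
  assumes "n > 0" "\<And>p. prime p \<Longrightarrow> p dvd n \<Longrightarrow> p \<le> y"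
  shows "n \<le> y ^ bigomega n"
proof -
  have "(\<Prod>p\<in>prime_factors n. p ^ multiplicity p n) \<le> (\<Prod>p\<in>prime_factors n. y ^ multiplicity p n)"
    using assms(2) by (intro prod_mono) (auto intro!: power_mono)
  also have "\<dots> = y ^ bigomega n"
    by (simp add: bigomega_eq_sum power_sum)
  finally show ?thesis using prod_prime_powers[OF assms(1)] by simp
qed

lemma card_prime_factors_le_bigomega: "card (prime_factors n) \<le> bigomega n"
proof -
  have "card (prime_factors n) = (\<Sum>p\<in>prime_factors n. 1)" by simp
  also have "\<dots> \<le> bigomega n" unfolding bigomega_eq_sum
    by (rule sum_mono) (auto simp: prime_factors_multiplicity)
  finally show ?thesis .
qed

lemma harm_eq: "harmr Y = (\<Sum>t=1..Y. 1 / real t)"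
  by (simp add: harm_def inverse_eq_divide)

lemma multiples_eq_image:
  assumes "(d::nat) \<ge> 1"
  shows "{m. m \<in> {1..Y} \<and> d dvd m} = (\<lambda>t. d * t) ` {1..Y div d}"
  using assms by (auto simp: image_iff less_eq_div_iff_mult_less_eq mult.commute elim!: dvdE)

lemma sum_multiples_reindex:
  assumes "(d::nat) > 0"
  shows "(\<Sum>n | n \<in> {1..N} \<and> d dvd n. h n) = (\<Sum>m\<in>{1..N div d}. h (d * m))"
  using assms by (subst multiples_eq_image) (auto simp: sum.reindex inj_on_def)

lemma card_multiples_eq: "(d::nat) > 0 \<Longrightarrow> card {n \<in> {1..N}. d dvd n} = N div d"
  using sum_multiples_reindex[of d "\<lambda>_. 1 :: nat" N] by simp

lemma sum_inverse_multiples: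
  assumes "d \<ge> 1"
  shows "(\<Sum>m | m \<in> {1..Y} \<and> d dvd m. 1 / real m) \<le> harmr Y / real d"
proof -
  have "(\<Sum>m | m \<in> {1..Y} \<and> d dvd m. 1 / real m) = harmr (Y div d) / real d"
    using assms by (subst sum_multiples_reindex) (auto simp: harm_eq sum_divide_distrib mult.commute)
  also have "\<dots> \<le> harmr Y / real d"
    by (intro divide_right_mono harm_mono) auto
  finally show ?thesis .
qed

lemma card_multiples_le:
  assumes "d \<ge> 1"
  shows "real (card {m \<in> {1..Y}. d dvd m}) \<le> real Y / real d"
  using assms of_nat_div_le_of_nat[of Y d, where 'a = real] by (subst card_multiples_eq) auto

lemma prod_primes_dvd:
  assumes "A \<subseteq> prime_factors n" "(n::nat) > 0"
  shows "\<Prod>A dvd n"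
proof -
  have "\<Prod>A dvd (\<Prod>p\<in>A. p ^ multiplicity p n)"
    using assms by (intro prod_dvd_prod) (auto simp: prime_factors_multiplicity subset_iff)
  also have "\<dots> dvd (\<Prod>p\<in>prime_factors n. p ^ multiplicity p n)"
    using assms by (intro prod_dvd_prod_subset) auto
  finally show "\<Prod>A dvd n" using prod_prime_powers[OF assms(2)] by simp
qed

text \<open>
  Distinct sets of prime factors have distinct products, and each of these products is a divisor.
\<close>
lemma two_power_card_prime_factors_le:
  assumes "(n::nat) > 0" shows "2 ^ card (prime_factors n) \<le> card {d. d dvd n}"
proof -
  have "inj_on (\<lambda>A. \<Prod>A) (Pow (prime_factors n))"
  proof (rule inj_on_inverseI)
    fix A assume "A \<in> Pow (prime_factors n)"
    then have "finite A" "\<And>p. p \<in> A \<Longrightarrow> prime p" by (auto intro: finite_subset)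
    moreover from this have "0 \<notin> A" using not_prime_0 by metis
    ultimately show "prime_factors (\<Prod>A) = A"
      by (subst prime_factors_prod) (auto simp: prime_prime_factors)
  qed
  moreover have "(\<lambda>A. \<Prod>A) ` Pow (prime_factors n) \<subseteq> {d. d dvd n}"
    using assms prod_primes_dvd by auto
  ultimately have "card (Pow (prime_factors n)) \<le> card {d. d dvd n}"
    using assms by (intro card_inj_on_le) auto
  then show ?thesis by (simp add: card_Pow)
qed

lemma sum_divisor_count_le:
  "(\<Sum>m=1..Y. real (card {d. d dvd m}) / real m) \<le> (harmr Y)\<^sup>2"
proof -
  have "(\<Sum>m=1..Y. real (card {d. d dvd m}) / real m) = (\<Sum>m=1..Y. \<Sum>d=1..Y. if d dvd m then 1 / real m else 0)"
  proof (rule sum.cong[OF refl])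
    fix m assume m: "m \<in> {1..Y}"
    have "d \<in> {1..Y}" if "d dvd m" for d
      using m that dvd_imp_le[OF that] dvd_pos_nat[OF _ that] by auto
    then have "{d. d dvd m} = {d \<in> {1..Y}. d dvd m}" by auto
    then show "real (card {d. d dvd m}) / real m = (\<Sum>d=1..Y. if d dvd m then 1 / real m else 0)"
      by (simp only: sum.inter_filter[symmetric] finite_atLeastAtMost sum_constant) simp
  qed
  also have "\<dots> = (\<Sum>d=1..Y. \<Sum>m=1..Y. if d dvd m then 1 / real m else 0)"
    by (rule sum.swap)
  also have "\<dots> = (\<Sum>d=1..Y. \<Sum>m | m \<in> {1..Y} \<and> d dvd m. 1 / real m)"
    by (simp add: sum.If_cases Int_def)
  also have "\<dots> \<le> (\<Sum>d=1..Y. harmr Y / real d)"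
    by (intro sum_mono sum_inverse_multiples) auto
  also have "\<dots> = (harmr Y)\<^sup>2"
    unfolding power2_eq_square by (subst (3) harm_eq) (simp add: sum_distrib_left)
  finally show ?thesis .
qed

lemma sum_UN_le:
  fixes f :: "'a \<Rightarrow> real"
  assumes "finite I" "\<And>i. i \<in> I \<Longrightarrow> finite (A i)" "\<And>x. f x \<ge> 0"
  shows "sum f (\<Union>i\<in>I. A i) \<le> (\<Sum>i\<in>I. sum f (A i))"
  using assms(1,2)
proof (induction I rule: finite_induct)
  case (insert i I)
  have "sum f (\<Union>i\<in>insert i I. A i) \<le> sum f (A i) + sum f (\<Union>i\<in>I. A i)"
    using insert by (simp add: sum_Un sum_nonneg assms(3))
  also have "\<dots> \<le> sum f (A i) + (\<Sum>i\<in>I. sum f (A i))" using insert by auto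
  finally show ?case using insert by simp
qed simp

lemma card_UN_real_le:
  assumes "finite I" "\<And>i. i \<in> I \<Longrightarrow> real (card (A i)) \<le> f i" 
  shows "real (card (\<Union>i\<in>I. A i)) \<le> (\<Sum>i\<in>I. f i)"
proof -
  have "real (card (\<Union>i\<in>I. A i)) \<le> real (\<Sum>i\<in>I. card (A i))"
    using card_UN_le[OF assms(1), of A] of_nat_mono by blast
  also have "\<dots> \<le> (\<Sum>i\<in>I. f i)" using assms(2) by (simp add: sum_mono)
  finally show ?thesis .
qed

lemma card_subset_real_le: "real (card B) \<le> c \<Longrightarrow> A \<subseteq> B \<Longrightarrow> finite B \<Longrightarrow> real (card A) \<le> c"
  using card_mono[of B A] by linarith

lemma sum_inverse_squares_le:
  assumes "z \<ge> 1" shows "(\<Sum>n\<in>{z<..Y}. 1 / (real n)\<^sup>2) \<le> 1 / real z"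
proof -
  have "(\<Sum>n\<in>{z<..Y}. 1 / (real n)\<^sup>2) \<le> 1 / real z - 1 / real Y" if "Y \<ge> z"
    using that
  proof (induction Y rule: dec_induct)
    case (step Y)
    have "{z<..Suc Y} = insert (Suc Y) {z<..Y}" using step by auto
    then have "(\<Sum>n\<in>{z<..Suc Y}. 1 / (real n)\<^sup>2) = 1 / (real (Suc Y))\<^sup>2 + (\<Sum>n\<in>{z<..Y}. 1 / (real n)\<^sup>2)"
      by (simp only: sum.insert finite_greaterThanAtMost) auto
    moreover have "1 / (real (Suc Y))\<^sup>2 \<le> 1 / real Y - 1 / real (Suc Y)"
    proof -
      have "1 / real Y - 1 / real (Suc Y) = 1 / (real Y * real (Suc Y))"
        using step assms by (simp add: field_simps)
      also have "\<dots> \<ge> 1 / (real (Suc Y))\<^sup>2"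
        using step assms by (intro divide_left_mono) (auto simp: power2_eq_square)
      finally show ?thesis .
    qed
    ultimately show ?case using step by linarith
  qed auto
  moreover have "1 / real Y \<ge> 0" by simp
  ultimately show ?thesis by (cases "Y \<ge> z") (auto intro: order.trans)
qed

text \<open>
  If $\Omega(m) > T^2$ then $m$ has at least $T$ distinct prime factors or is divisible by the $T$-th power of a prime.
  In the first case $m$ has at least $2^T$ divisors, while the divisor function has logarithmic average; in the
  second case the multiples of $p^T$ contribute $\ll (\log Y) / p^T$. Not only integers with too many prime
  factors are controlled by this, but also large integers without a large prime factor.
\<close>
lemma sum_inverse_many_prime_factors:
  assumes "T \<ge> 2"
  shows "(\<Sum>m | m \<in> {1..Y} \<and> bigomega m > T\<^sup>2. 1 / real m) \<le> ((harmr Y)\<^sup>2 + 4 * harmr Y) / 2 ^ T"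
proof -
  let ?A = "{m. m \<in> {1..Y} \<and> 2 ^ T \<le> card {d. d dvd m}}"
  let ?P = "{p \<in> {2..Y}. prime p}"
  let ?B = "\<lambda>p. {m. m \<in> {1..Y} \<and> p ^ T dvd m}"
  have "{m. m \<in> {1..Y} \<and> bigomega m > T\<^sup>2} \<subseteq> ?A \<union> (\<Union>p\<in>?P. ?B p)"
  proof
    fix m assume "m \<in> {m. m \<in> {1..Y} \<and> bigomega m > T\<^sup>2}"
    then have m: "m > 0" "m \<le> Y" "bigomega m > T\<^sup>2" by auto
    show "m \<in> ?A \<union> (\<Union>p\<in>?P. ?B p)"
    proof (cases "card (prime_factors m) \<ge> T")
      case True
      then have "(2::nat) ^ T \<le> 2 ^ card (prime_factors m)" by (intro power_increasing) auto
      also note two_power_card_prime_factors_le[OF m(1)]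
      finally show ?thesis using m by auto
    next
      case False
      have "\<exists>p\<in>prime_factors m. multiplicity p m > T"
      proof (rule ccontr)
        assume "\<not> ?thesis"
        then have "bigomega m \<le> card (prime_factors m) * T"
          unfolding bigomega_eq_sum using sum_bounded_above[of "prime_factors m" "\<lambda>p. multiplicity p m" T] by force
        also have "\<dots> \<le> T\<^sup>2" using False by (simp add: power2_eq_square)
        finally show False using m by simp
      qed
      then obtain p where "p \<in> prime_factors m" "multiplicity p m > T" by blast
      then have p: "prime p" "p dvd m" "multiplicity p m > T" by auto
      have "p ^ T dvd m" using multiplicity_dvd'[of T p m] p(3) by simp
      moreover have "p \<le> Y" using p m dvd_imp_le[of p m] by simp
      ultimately show ?thesis using p m prime_ge_2_nat[of p] by auto
    qed
  qed
  then have "(\<Sum>m | m \<in> {1..Y} \<and> bigomega m > T\<^sup>2. 1 / real m) \<le> (\<Sum>m\<in>?A \<union> (\<Union>p\<in>?P. ?B p). 1 / real m)"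
    by (intro sum_mono2) auto
  also have "\<dots> \<le> (\<Sum>m\<in>?A. 1 / real m) + (\<Sum>m\<in>(\<Union>p\<in>?P. ?B p). 1 / real m)"
    by (subst sum_Un) (auto intro!: sum_nonneg)
  also have "(\<Sum>m\<in>(\<Union>p\<in>?P. ?B p). 1 / real m) \<le> (\<Sum>p\<in>?P. \<Sum>m\<in>?B p. 1 / real m)"
    by (intro sum_UN_le) auto
  also have "\<dots> \<le> (\<Sum>p\<in>?P. harmr Y * 4 / 2 ^ T * (1 / (real p)\<^sup>2))"
  proof (rule sum_mono)
    fix p assume p: "p \<in> ?P"
    have "(\<Sum>m\<in>?B p. 1 / real m) \<le> harmr Y / real (p ^ T)"
      using p by (intro sum_inverse_multiples) (auto simp: Suc_le_eq)
    also have "\<dots> = harmr Y * (1 / (real p ^ (T - 2) * (real p)\<^sup>2))"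
    proof -
      have "real p ^ T = real p ^ (T - 2) * (real p)\<^sup>2"
        using assms by (metis power_add le_add_diff_inverse2)
      then show ?thesis by simp
    qed
    also have "\<dots> \<le> harmr Y * (1 / (2 ^ (T - 2) * (real p)\<^sup>2))"
      using p by (intro mult_left_mono divide_left_mono mult_right_mono power_mono harm_nonneg) auto
    also have "\<dots> = harmr Y * 4 / 2 ^ T * (1 / (real p)\<^sup>2)"
    proof -
      have "(2::real) ^ T = 2 ^ (T - 2) * 2\<^sup>2"
        using assms by (metis power_add le_add_diff_inverse2)
      then show ?thesis by (simp only:) (simp add: field_simps)
    qed
    finally show "(\<Sum>m\<in>?B p. 1 / real m) \<le> harmr Y * 4 / 2 ^ T * (1 / (real p)\<^sup>2)" .
  qed
  also have "\<dots> = harmr Y * 4 / 2 ^ T * (\<Sum>p\<in>?P. 1 / (real p)\<^sup>2)"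
    by (simp only: sum_distrib_left)
  also have "\<dots> \<le> harmr Y * 4 / 2 ^ T * 1"
  proof (rule mult_left_mono)
    have "(\<Sum>p\<in>?P. 1 / (real p)\<^sup>2) \<le> (\<Sum>p\<in>{1<..Y}. 1 / (real p)\<^sup>2)"
      by (intro sum_mono2) auto
    also have "\<dots> \<le> 1" using sum_inverse_squares_le[of 1 Y] by simp
    finally show "(\<Sum>p\<in>?P. 1 / (real p)\<^sup>2) \<le> 1" .
  qed (use harm_nonneg[of Y, where 'a=real] in simp)
  also have "(\<Sum>m\<in>?A. 1 / real m) \<le> (\<Sum>m\<in>?A. real (card {d. d dvd m}) / real m / 2 ^ T)"
  proof (rule sum_mono)
    fix m assume m: "m \<in> ?A"
    then have "real (2 ^ T) \<le> real (card {d. d dvd m})" by (intro of_nat_mono) auto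
    then show "1 / real m \<le> real (card {d. d dvd m}) / real m / 2 ^ T"
      using m by (simp add: field_simps)
  qed
  also have "\<dots> \<le> (\<Sum>m=1..Y. real (card {d. d dvd m}) / real m / 2 ^ T)"
    by (intro sum_mono2) auto
  also have "\<dots> \<le> (harmr Y)\<^sup>2 / 2 ^ T"
    unfolding sum_divide_distrib[symmetric] by (intro divide_right_mono sum_divisor_count_le) auto
  finally show ?thesis by (simp add: add_divide_distrib mult.commute)
qed

lemma prime_dvd_central_binomial:
  assumes "prime (p::nat)" "n < p" "p \<le> 2 * n"
  shows "p dvd (2 * n) choose n"
proof -
  have "p dvd fact (2 * n)" using assms by (subst prime_dvd_fact_iff)
  moreover have "fact (2 * n) = fact n * (fact n * ((2 * n) choose n))"
    using binomial_fact_lemma[of n "2 * n"] by simp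
  moreover have "\<not> p dvd fact n" using assms by (subst prime_dvd_fact_iff) auto
  ultimately show ?thesis using assms(1) by (metis prime_dvd_mult_iff)
qed

text \<open>
  Chebyshev's argument: these primes all divide a central binomial coefficient, which is at most $4^{2^i}$.
\<close>
lemma primes_dyadic_count:
  "i * card {p::nat. prime p \<and> 2 ^ i < p \<and> p \<le> 2 ^ Suc i} \<le> 2 ^ Suc i"
proof -
  define n where "n = (2 ^ i :: nat)"
  define P where "P = {p::nat. prime p \<and> n < p \<and> p \<le> 2 * n}"
  have "P \<subseteq> prime_factors ((2 * n) choose n)"
    using prime_dvd_central_binomial[of _ n] by (auto simp: P_def prime_factors_dvd)
  then have "\<Prod>P \<le> (2 * n) choose n" by (intro dvd_imp_le prod_primes_dvd) auto
  also have "\<dots> \<le> 2 ^ (2 * n)" by (rule binomial_le_pow2)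
  finally have "\<Prod>P \<le> 2 ^ (2 * n)" .
  moreover have "(\<Prod>p\<in>P. n) \<le> \<Prod>P" by (intro prod_mono) (auto simp: P_def)
  ultimately have "n ^ card P \<le> 2 ^ (2 * n)" by simp
  then have "(2::nat) ^ (i * card P) \<le> 2 ^ (2 * n)" by (simp add: n_def power_mult)
  then have "i * card P \<le> 2 * n" by (subst (asm) power_increasing_iff) auto
  then show ?thesis by (simp add: P_def n_def)
qed

lemma finite_primes_le [simp]: "finite {p::nat. prime p \<and> p \<le> x}"
  by (rule finite_subset[of _ "{..x}"]) auto

lemma sum_inverse_primes_upper:
  "(\<Sum>p | prime p \<and> p \<le> 2 ^ Suc I. 1 / real p) \<le> 1 + 2 * harmr I"
proof (induction I)
  case 0
  have "{p::nat. prime p \<and> p \<le> 2} = {2}" by (auto dest: prime_ge_2_nat)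
  then show ?case by (simp add: harm_nonneg)
next
  case (Suc I)
  define n where "n = (2 ^ Suc I :: nat)"
  define P where "P = {p::nat. prime p \<and> n < p \<and> p \<le> 2 * n}"
  have n: "n > 0" "2 ^ Suc (Suc I) = 2 * n" by (auto simp: n_def)
  have "finite P" by (rule finite_subset[of _ "{..2 * n}"]) (auto simp: P_def)
  moreover have "{p::nat. prime p \<and> p \<le> 2 * n} = {p. prime p \<and> p \<le> n} \<union> P"
    by (auto simp: P_def)
  ultimately have "(\<Sum>p | prime p \<and> p \<le> 2 * n. 1 / real p) =
      (\<Sum>p | prime p \<and> p \<le> n. 1 / real p) + (\<Sum>p\<in>P. 1 / real p)"
    by (simp only:) (intro sum.union_disjoint, auto simp: P_def)
  also have "(\<Sum>p\<in>P. 1 / real p) \<le> (\<Sum>p\<in>P. 1 / real n)"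
    using n by (intro sum_mono divide_left_mono) (auto simp: P_def)
  also have "\<dots> = real (card P) / real n" by simp
  also have "real (Suc I) * real (card P) \<le> 2 * real n"
    using primes_dyadic_count[of "Suc I"] unfolding n(2) n_def[symmetric] P_def[symmetric]
    by (metis of_nat_le_iff of_nat_mult of_nat_numeral)
  then have "real (card P) / real n \<le> 2 * inverse (real (Suc I))"
    using n(1) by (simp add: field_simps del: of_nat_Suc)
  finally show ?case using Suc unfolding n(2) by (simp add: harm_Suc n_def)
qed

text \<open>
  Every $n \le x$ is a squarefree number with prime factors $\le x$ times a square, so that
  $\sum_{n \le x} 1/n \le 2 \prod_{p \le x} (1 + 1/p)$.
\<close>
lemma sum_inverse_primes_lower:
  assumes "x \<ge> 1"
  shows "ln (real x + 1) \<le> 2 * exp (\<Sum>p | prime p \<and> p \<le> x. 1 / real p)"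
proof -
  define P where "P = {p::nat. prime p \<and> p \<le> x}"
  have finP: "finite P" by (simp add: P_def)
  define g where "g = (\<lambda>n::nat. (prime_factors (squarefree_part n), square_part n))"
  have dec: "\<Prod>(fst (g n)) * snd (g n) ^ 2 = n" if "n > 0" for n
  proof -
    have "squarefree_part n = (\<Prod>p\<in>prime_factors (squarefree_part n). p ^ multiplicity p (squarefree_part n))"
      by (rule prod_prime_powers[symmetric]) (metis gr0I squarefree_part_nonzero)
    also have "\<dots> = \<Prod>(prime_factors (squarefree_part n))"
    proof (rule prod.cong[OF refl])
      fix p assume "p \<in> prime_factors (squarefree_part n)"
      then have "prime p" "multiplicity p (squarefree_part n) > 0" by (auto simp: prime_factors_multiplicity)
      then have "multiplicity p (squarefree_part n) = 1"
        by (auto simp: prime_multiplicity_squarefree_part split: if_splits)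
      then show "p ^ multiplicity p (squarefree_part n) = p" by simp
    qed
    finally have "\<Prod>(prime_factors (squarefree_part n)) * square_part n ^ 2 = squarefree_part n * square_part n ^ 2"
      by (rule arg_cong[where f = "\<lambda>t. t * square_part n ^ 2", OF sym])
    also have "\<dots> = n" by (rule squarefree_decompose[symmetric])
    finally show ?thesis by (simp add: g_def)
  qed
  have inj: "inj_on g {1..x}" by (rule inj_on_inverseI[where g = "\<lambda>(A, b). \<Prod>A * b ^ 2"]) (use dec in \<open>simp add: case_prod_beta\<close>)
  have sub: "g ` {1..x} \<subseteq> Pow P \<times> {1..x}"
  proof (rule image_subsetI)
    fix n assume n: "n \<in> {1..x}"
    have "squarefree_part n dvd n"
      by (metis dvd_triv_left squarefree_decompose)
    have "p \<le> x" if "p dvd squarefree_part n" for p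
      using dvd_imp_le[OF dvd_trans[OF that \<open>squarefree_part n dvd n\<close>]] n by simp
    moreover have "square_part n dvd n"
      using dvd_trans[OF dvd_power square_part_square_dvd[of n]] by simp
    then have "square_part n \<le> x" "square_part n > 0"
      using dvd_imp_le[of "square_part n" n] n by (auto intro!: Nat.gr0I)
    ultimately show "g n \<in> Pow P \<times> {1..x}" by (auto simp: g_def P_def)
  qed
  have "harmr x = (\<Sum>n\<in>{1..x}. (\<Prod>p\<in>fst (g n). 1 / real p) * (1 / real (snd (g n)) ^ 2))"
    unfolding harm_eq
  proof (rule sum.cong[OF refl])
    fix n assume "n \<in> {1..x}"
    then have "real n = real (\<Prod>(fst (g n)) * snd (g n) ^ 2)" using dec[of n] by simp
    then show "1 / real n = (\<Prod>p\<in>fst (g n). 1 / real p) * (1 / real (snd (g n)) ^ 2)"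
      by (simp add: prod_dividef)
  qed
  also have "\<dots> = (\<Sum>(A, b)\<in>g ` {1..x}. (\<Prod>p\<in>A. 1 / real p) * (1 / real b ^ 2))"
    by (subst sum.reindex[OF inj]) (simp add: case_prod_beta)
  also have "\<dots> \<le> (\<Sum>(A, b)\<in>Pow P \<times> {1..x}. (\<Prod>p\<in>A. 1 / real p) * (1 / real b ^ 2))"
    using finP sub by (intro sum_mono2) (auto intro!: divide_nonneg_nonneg prod_nonneg)
  also have "\<dots> = (\<Sum>A\<in>Pow P. \<Prod>p\<in>A. 1 / real p) * (\<Sum>b=1..x. 1 / real b ^ 2)"
    by (simp add: sum_product sum.cartesian_product)
  also have "(\<Sum>A\<in>Pow P. \<Prod>p\<in>A. 1 / real p) = (\<Prod>p\<in>P. 1 / real p + 1)"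
    using prod_add[OF finP, of "\<lambda>p. 1 / real p" "\<lambda>_. 1"] by simp
  also have "(\<Prod>p\<in>P. 1 / real p + 1) * (\<Sum>b=1..x. 1 / real b ^ 2) \<le> exp (\<Sum>p\<in>P. 1 / real p) * 2"
  proof (rule mult_mono)
    show "(\<Prod>p\<in>P. 1 / real p + 1) \<le> exp (\<Sum>p\<in>P. 1 / real p)"
      unfolding exp_sum[OF finP] by (intro prod_mono) (auto simp: add.commute)
    have "{1..x} = insert 1 {1<..x}" using assms by auto
    then have "(\<Sum>b=1..x. 1 / real b ^ 2) = 1 + (\<Sum>b\<in>{1<..x}. 1 / real b ^ 2)"
      by (simp only:) (subst sum.insert, auto)
    then show "(\<Sum>b=1..x. 1 / real b ^ 2) \<le> 2"
      using sum_inverse_squares_le[of 1 x] by simp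
  qed (auto intro!: sum_nonneg)
  finally show ?thesis using harm_ge_ln[of x] by (simp add: P_def)
qed

section \<open>Multiplicative functions that shift the primes\<close>

text \<open>
  The properties of \<open>totient\<close> and \<open>divisor_sum\<close> that matter: values on prime powers enter only through
  the bound $F(n) \le n^2$, whereas at a prime $p$ the value is $p \pm 1$ with one sign for all $p$. The common sign
  makes $F$ injective on the primes.
\<close>
locale shift_map =
  fixes F :: "nat \<Rightarrow> nat"
  assumes F_coprime: "m > 0 \<Longrightarrow> n > 0 \<Longrightarrow> coprime m n \<Longrightarrow> F (m * n) = F m * F n"
    and F_pos: "n > 0 \<Longrightarrow> F n > 0"
    and F_le_square: "n > 0 \<Longrightarrow> F n \<le> n\<^sup>2"
    and F_prime: "(\<forall>p. prime p \<longrightarrow> F p = p + 1) \<or> (\<forall>p. prime p \<longrightarrow> F p = p - 1)"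
begin

lemma F_prime_le: "prime p \<Longrightarrow> F p \<le> p + 1" and F_prime_ge: "prime p \<Longrightarrow> p \<le> F p + 1"
  using F_prime by fastforce+

lemma F_prime_inj: "prime p \<Longrightarrow> prime q \<Longrightarrow> F p = F q \<Longrightarrow> p = q"
  using F_prime prime_gt_0_nat[of p] prime_gt_0_nat[of q] by fastforce

lemma F_one: "F 1 = 1"
  using F_coprime[of 1 1] F_pos[of 1] by simp

lemma F_prod_primes:
  assumes "finite A" "\<And>p. p \<in> A \<Longrightarrow> prime p"
  shows "F (\<Prod>A) = (\<Prod>p\<in>A. F p)"
  using assms
proof (induction A rule: finite_induct)
  case (insert p A)
  have "coprime p (\<Prod>A)" using insert by (intro prod_coprime_right) (auto intro!: primes_coprime)
  then have "F (p * \<Prod>A) = F p * F (\<Prod>A)"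
    using insert by (intro F_coprime) (auto intro!: prod_pos prime_gt_0_nat)
  then show ?case using insert by simp
qed (use F_one in simp)

end

lemma (in shift_map) F_iter_pos: "n > 0 \<Longrightarrow> (F ^^ i) n > 0"
  by (induction i) (auto intro: F_pos)

definition big_primes :: "nat \<Rightarrow> nat \<Rightarrow> nat set" where
  "big_primes R m = {p. prime p \<and> p dvd m \<and> 2 ^ R < p}"

lemma big_primes_subset: "m > 0 \<Longrightarrow> big_primes R m \<subseteq> prime_factors m"
  by (auto simp: big_primes_def prime_factors_dvd)

lemma finite_big_primes: "m > 0 \<Longrightarrow> finite (big_primes R m)"
  by (rule finite_subset[OF big_primes_subset]) auto

text \<open>
  Primes beyond $2^R$ count as large. The same $R$ bounds the number of prime factors, so that the part of $m$ composed of
  small primes is at most $2^{R^2}$.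
\<close>
definition few_factors :: "nat \<Rightarrow> nat \<Rightarrow> bool" where
  "few_factors R m \<longleftrightarrow> bigomega m \<le> R \<and> (\<forall>q. prime q \<longrightarrow> 2 ^ R < q \<longrightarrow> \<not> q\<^sup>2 dvd m)"

text \<open>
  The small primes form a factor $S \le 2^{R^2}$ of $m$ and therefore $F(S) < 2^{R^3}$. So primes beyond
  $2^{R^3}$ can divide $F(m)$ only through $F(p)$ for large primes $p$, and passing from $m$ to $F(m)$ costs the step
  from $R$ to $R^3$.
\<close>
lemma (in shift_map) few_factors_decompose:
  assumes m: "m > 0" and few: "few_factors R m" and R: "R \<ge> 3"
  obtains S where "F m = F S * (\<Prod>p\<in>big_primes R m. F p)" "S > 0" "F S < 2 ^ (R ^ 3)"
    "bigomega (F S) \<le> 2 * R\<^sup>2"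
proof
  let ?B = "big_primes R m"
  define S where "S = (\<Prod>p\<in>prime_factors m - ?B. p ^ multiplicity p m)"
  have B: "finite ?B" "?B \<subseteq> prime_factors m" using m by (simp_all add: finite_big_primes big_primes_subset)
  have multB: "multiplicity p m = 1" if "p \<in> ?B" for p
  proof -
    have "prime p" "p dvd m" "\<not> p\<^sup>2 dvd m" using that few by (auto simp: big_primes_def few_factors_def)
    then have "multiplicity p m > 0" "\<not> multiplicity p m \<ge> 2"
      using m multiplicity_dvd'[of 2 p m] by (auto simp: prime_multiplicity_gt_zero_iff)
    then show ?thesis by linarith
  qed
  have "m = (\<Prod>p\<in>prime_factors m. p ^ multiplicity p m)" using prod_prime_powers[OF m] by simp
  also have "\<dots> = S * (\<Prod>p\<in>?B. p ^ multiplicity p m)"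
    unfolding S_def using B by (intro prod.subset_diff) auto
  also have "(\<Prod>p\<in>?B. p ^ multiplicity p m) = \<Prod>?B"
    by (rule prod.cong) (use multB in auto)
  finally have m_eq: "m = S * \<Prod>?B" .
  show S: "S > 0" using m m_eq by (cases "S = 0") auto
  have cop: "coprime S (\<Prod>?B)"
    unfolding S_def by (intro prod_coprime_left prod_coprime_right)
      (auto simp: big_primes_def intro!: coprime_power_left_iff[THEN iffD2] primes_coprime disjI1)
  have "F m = F S * F (\<Prod>?B)"
    by (subst m_eq, rule F_coprime[OF S _ cop], intro prod_pos) (auto simp: big_primes_def intro: prime_gt_0_nat)
  also have "F (\<Prod>?B) = (\<Prod>p\<in>?B. F p)"
    using B(1) by (rule F_prod_primes) (auto simp: big_primes_def)
  finally show "F m = F S * (\<Prod>p\<in>?B. F p)" .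
  have "S \<le> (\<Prod>p\<in>prime_factors m - ?B. (2 ^ R) ^ multiplicity p m)"
    unfolding S_def by (intro prod_mono) (auto simp: big_primes_def intro!: power_mono)
  also have "\<dots> = 2 ^ (R * (\<Sum>p\<in>prime_factors m - ?B. multiplicity p m))"
    by (simp add: power_sum power_mult)
  also have "\<dots> \<le> 2 ^ (R * R)"
  proof -
    have "(\<Sum>p\<in>prime_factors m - ?B. multiplicity p m) \<le> bigomega m"
      unfolding bigomega_eq_sum by (intro sum_mono2) auto
    also have "\<dots> \<le> R" using few by (simp add: few_factors_def)
    finally show ?thesis by (intro power_increasing mult_left_mono) auto
  qed
  finally have "S\<^sup>2 \<le> (2 ^ (R * R))\<^sup>2" by (intro power_mono) auto
  then have FS: "F S \<le> 2 ^ (2 * R\<^sup>2)"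
    using F_le_square[OF S] by (simp add: power_mult[symmetric] power2_eq_square[of R] mult.commute)
  have "2 * R\<^sup>2 < R ^ 3" using R by (simp add: power2_eq_square power3_eq_cube)
  then have "(2::nat) ^ (2 * R\<^sup>2) < 2 ^ (R ^ 3)" by (intro power_strict_increasing) auto
  with FS show "F S < 2 ^ (R ^ 3)" by linarith
  have "(2::nat) ^ bigomega (F S) \<le> 2 ^ (2 * R\<^sup>2)"
    using two_power_bigomega_le[OF F_pos[OF S]] FS by linarith
  then show "bigomega (F S) \<le> 2 * R\<^sup>2" by (subst (asm) power_increasing_iff) auto
qed

lemma prime_dvd_prodD:
  assumes "prime (q::nat)" "finite A" "q dvd (\<Prod>x\<in>A. f x)"
  shows "\<exists>x\<in>A. q dvd f x"
  using assms prime_dvd_prod_iff[of A q f] by auto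

lemma (in shift_map) big_prime_dvd_F:
  assumes "m > 0" "few_factors R m" "R \<ge> 3" "prime q" "q > 2 ^ (R ^ 3)" "q dvd F m"
  shows "\<exists>p\<in>big_primes R m. q dvd F p"
proof -
  obtain S where S: "F m = F S * (\<Prod>p\<in>big_primes R m. F p)" "S > 0" "F S < 2 ^ (R ^ 3)"
    using few_factors_decompose[OF assms(1-3)] by metis
  have "\<not> q dvd F S" using dvd_imp_le[of q "F S"] S assms(5) F_pos[OF S(2)] by auto
  then have "q dvd (\<Prod>p\<in>big_primes R m. F p)"
    using assms(4,6) S(1) prime_dvd_mult_iff[OF assms(4)] by auto
  then show ?thesis using prime_dvd_prodD[OF assms(4) finite_big_primes[OF assms(1)]] by auto
qed

text \<open>
  The case \<open>q = r\<close> is included: it describes how the square of a large prime can divide $F(m)$.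
\<close>
lemma (in shift_map) two_big_primes_dvd_F:
  assumes "m > 0" "few_factors R m" "R \<ge> 3"
    and q: "prime q" "q > 2 ^ (R ^ 3)" and r: "prime r" "r > 2 ^ (R ^ 3)" and dvd: "q * r dvd F m"
  shows "(\<exists>p\<in>big_primes R m. q * r dvd F p) \<or>
         (\<exists>p\<in>big_primes R m. \<exists>p'\<in>big_primes R m. p \<noteq> p' \<and> q dvd F p \<and> r dvd F p')"
proof -
  let ?B = "big_primes R m"
  have fin: "finite ?B" using finite_big_primes[OF assms(1)] .
  obtain S where S: "F m = F S * (\<Prod>p\<in>?B. F p)" "S > 0" "F S < 2 ^ (R ^ 3)"
    using few_factors_decompose[OF assms(1-3)] by metis
  have nd: "\<not> x dvd F S" if "x > 2 ^ (R ^ 3)" for x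
    using dvd_imp_le[of x "F S"] S that F_pos[OF S(2)] by auto
  then have cop: "coprime (q * r) (F S)"
    using q r by (auto simp: coprime_mult_left_iff prime_imp_coprime)
  have dvdP: "q * r dvd (\<Prod>p\<in>?B. F p)"
    using dvd cop S(1) by (simp add: coprime_dvd_mult_right_iff)
  then have "q dvd (\<Prod>p\<in>?B. F p)" by (rule dvd_mult_left)
  from prime_dvd_prodD[OF q(1) fin this] obtain p where p: "p \<in> ?B" "q dvd F p" by (elim bexE)
  have finD: "finite (?B - {p})" using fin by simp
  show ?thesis
  proof (cases "\<exists>p'\<in>?B - {p}. r dvd F p'")
    case True
    then obtain p' where "p' \<in> ?B" "p \<noteq> p'" "r dvd F p'" by auto
    with p show ?thesis by (intro disjI2 bexI[of _ p] bexI[of _ p'] conjI)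
  next
    case False
    then have "\<not> r dvd (\<Prod>p\<in>?B - {p}. F p)" using prime_dvd_prodD[OF r(1) finD, of F] by metis
    then have r': "coprime r (\<Prod>p\<in>?B - {p}. F p)" using r(1) by (rule prime_imp_coprime[rotated])
    have eq: "(\<Prod>p\<in>?B. F p) = F p * (\<Prod>p\<in>?B - {p}. F p)" using p fin by (simp add: prod.remove)
    show ?thesis
    proof (cases "\<exists>p'\<in>?B - {p}. q dvd F p'")
      case True
      then obtain p' where p': "p' \<in> ?B" "p' \<noteq> p" "q dvd F p'" by auto
      have "r dvd (\<Prod>p\<in>?B. F p)" using dvdP by (rule dvd_mult_right)
      then have "r dvd F p" unfolding eq using r' by (simp add: coprime_dvd_mult_left_iff)
      with p p' show ?thesis by (intro disjI2 bexI[of _ p] bexI[of _ p'] conjI)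
    next
      case False
      then have "\<not> q dvd (\<Prod>p\<in>?B - {p}. F p)" using prime_dvd_prodD[OF q(1) finD, of F] by metis
      then have "coprime q (\<Prod>p\<in>?B - {p}. F p)" using q(1) by (rule prime_imp_coprime[rotated])
      with r' have "coprime (q * r) (\<Prod>p\<in>?B - {p}. F p)" by (simp add: coprime_mult_left_iff)
      then have "q * r dvd F p" using dvdP unfolding eq by (simp add: coprime_dvd_mult_left_iff)
      then show ?thesis using p by (intro disjI1 bexI[of _ p])
    qed
  qed
qed

lemma (in shift_map) bigomega_F_le:
  assumes "m > 0" "few_factors R m" "R \<ge> 3" "K \<le> R"
    and "\<And>p. p \<in> big_primes R m \<Longrightarrow> bigomega (F p) \<le> K"
  shows "bigomega (F m) \<le> R ^ 3"
proof -
  let ?B = "big_primes R m"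
  obtain S where S: "F m = F S * (\<Prod>p\<in>?B. F p)" "S > 0" "bigomega (F S) \<le> 2 * R\<^sup>2"
    using few_factors_decompose[OF assms(1-3)] by metis
  have pos: "F p > 0" if "p \<in> ?B" for p using that by (intro F_pos prime_gt_0_nat) (auto simp: big_primes_def)
  have "bigomega (F m) = bigomega (F S) + (\<Sum>p\<in>?B. bigomega (F p))"
    unfolding S(1) using pos S(2) finite_big_primes[OF assms(1)]
    by (simp add: bigomega_mult F_pos prod_pos bigomega_prod)
  also have "(\<Sum>p\<in>?B. bigomega (F p)) \<le> card ?B * K"
    using sum_bounded_above[of ?B "\<lambda>p. bigomega (F p)" K] assms(5) by simp
  also have "card ?B * K \<le> R * R"
  proof (rule mult_le_mono)
    have "card ?B \<le> card (prime_factors m)"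
      by (rule card_mono[OF _ big_primes_subset[OF assms(1)]]) simp
    also note card_prime_factors_le_bigomega[of m]
    also have "bigomega m \<le> R" using assms(2) by (simp add: few_factors_def)
    finally show "card ?B \<le> R" .
  qed (rule assms(4))
  finally have "bigomega (F m) \<le> 2 * R\<^sup>2 + R * R"
    using S(3) by linarith
  also have "\<dots> \<le> R ^ 3" using assms(3) by (simp add: power2_eq_square power3_eq_cube)
  finally show ?thesis .
qed

section \<open>Almost all integers are typical\<close>

text \<open>
  Fixed for the counting of integers up to $N$: the estimates save the factor $2^{-T}$ and lose powers of $\log N$.
\<close>
locale shift_map_upto = shift_map F for F :: "nat \<Rightarrow> nat" +
  fixes N T :: nat
  assumes T: "T \<ge> 2"
begin

text \<open>
  An integer with more than \<open>K\<close> prime factors is exceptional, \<open>R j\<close> is the parameter of \<open>few_factors\<close> for the $j$-th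
  iterate (each application of $F$ cubes it), \<open>H\<close> the logarithmic factor lost when summing over
  one prime, and \<open>\<delta>\<close> the proportion of exceptional integers up to powers of \<open>H\<close>.
\<close>
definition K :: nat where "K = T\<^sup>2"
definition R :: "nat \<Rightarrow> nat" where "R j = K ^ (3 ^ j)"
definition H :: real where "H = 2 * harm (2 * N + 1)"
definition \<delta> :: real where "\<delta> = 2 * H\<^sup>2 / 2 ^ T"

lemma K_ge: "K \<ge> 4" "T \<le> K"
  using T mult_mono[of 2 T 2 T] mult_mono[of 1 T T T] by (auto simp: K_def power2_eq_square)

lemma R_0: "R 0 = K" and R_Suc: "R (Suc j) = R j ^ 3"
  by (auto simp: R_def power_mult[symmetric] mult.commute)

lemma R_mono: "i \<le> j \<Longrightarrow> R i \<le> R j"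
  unfolding R_def using K_ge by (intro power_increasing) auto

lemma K_le_R: "K \<le> R j"
  using R_mono[of 0 j] by (simp add: R_0)

lemma R_ge_3: "R j \<ge> 3"
  using K_le_R[of j] K_ge by simp

lemma T_le_R: "T \<le> R j"
  using K_le_R[of j] K_ge by simp

lemma H_ge_2: "H \<ge> 2"
  using harm_mono[of 1 "2 * N + 1", where 'a = real] by (simp add: H_def harm_expand)

lemma \<delta>_pos: "\<delta> > 0"
  using H_ge_2 by (simp add: \<delta>_def)

lemma inverse_two_power_le: "1 / 2 ^ T \<le> \<delta>"
  using H_ge_2 mult_mono[of 1 H 1 H] unfolding \<delta>_def by (intro divide_right_mono) (auto simp: power2_eq_square)

lemma sum_many_factors_le:
  "(\<Sum>m | m \<in> {1..2 * N + 1} \<and> bigomega m > K. 1 / real m) \<le> \<delta>"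
proof -
  have "(\<Sum>m | m \<in> {1..2 * N + 1} \<and> bigomega m > K. 1 / real m) \<le> ((H / 2)\<^sup>2 + 4 * (H / 2)) / 2 ^ T"
    using sum_inverse_many_prime_factors[OF T, of "2 * N + 1"] by (simp add: H_def K_def)
  also have "(H / 2)\<^sup>2 + 4 * (H / 2) \<le> 2 * H\<^sup>2"
    using H_ge_2 mult_right_mono[of 2 H H] by (simp add: power2_eq_square field_simps)
  finally show ?thesis by (simp add: \<delta>_def divide_right_mono)
qed

text \<open>
  $F$ is injective on the primes and $F(p) \le 2p$, so a sum over primes becomes one over integers.
\<close>
lemma sum_primes_shift_le:
  "(\<Sum>p | prime p \<and> p \<le> 2 * N \<and> A (F p). 1 / real p) \<le> 2 * (\<Sum>t | t \<in> {1..2 * N + 1} \<and> A t. 1 / real t)"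
proof -
  let ?P = "{p. prime p \<and> p \<le> 2 * N \<and> A (F p)}"
  have fin: "finite ?P" by (rule finite_subset[of _ "{..2 * N}"]) auto
  have inj: "inj_on F ?P" by (rule inj_onI) (auto dest: F_prime_inj)
  have "(\<Sum>p\<in>?P. 1 / real p) \<le> (\<Sum>p\<in>?P. 2 * (1 / real (F p)))"
  proof (rule sum_mono)
    fix p assume "p \<in> ?P"
    then have p: "prime p" by simp
    have "real (F p) \<le> 2 * real p" using F_prime_le[OF p] prime_gt_0_nat[OF p] by simp
    then show "1 / real p \<le> 2 * (1 / real (F p))"
      using F_pos[OF prime_gt_0_nat[OF p]] prime_gt_0_nat[OF p] by (simp add: field_simps)
  qed
  also have "\<dots> = 2 * (\<Sum>t\<in>F ` ?P. 1 / real t)"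
    by (simp add: sum.reindex[OF inj] sum_distrib_left)
  also have "(\<Sum>t\<in>F ` ?P. 1 / real t) \<le> (\<Sum>t | t \<in> {1..2 * N + 1} \<and> A t. 1 / real t)"
  proof (rule sum_mono2)
    show "F ` ?P \<subseteq> {t. t \<in> {1..2 * N + 1} \<and> A t}"
    proof (rule image_subsetI)
      fix p assume p: "p \<in> ?P"
      then have "F p \<le> p + 1" "F p > 0" using F_prime_le[of p] F_pos[of p] prime_gt_0_nat by auto
      then show "F p \<in> {t. t \<in> {1..2 * N + 1} \<and> A t}" using p by auto
    qed
  qed auto
  finally show ?thesis by simp
qed

lemma sum_primes_dvd_shift_le:
  assumes "m \<ge> 1"
  shows "(\<Sum>p | prime p \<and> p \<le> 2 * N \<and> m dvd F p. 1 / real p) \<le> H / real m"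
proof -
  have "(\<Sum>p | prime p \<and> p \<le> 2 * N \<and> m dvd F p. 1 / real p) \<le> 2 * (harm (2 * N + 1) / real m)"
    using sum_primes_shift_le[of "\<lambda>t. m dvd t"] sum_inverse_multiples[OF assms, of "2 * N + 1"] by linarith
  then show ?thesis by (simp add: H_def)
qed

lemma sum_primes_many_factors_le:
  "(\<Sum>p | prime p \<and> p \<le> 2 * N \<and> bigomega (F p) > K. 1 / real p) \<le> 2 * \<delta>"
  using sum_primes_shift_le[of "\<lambda>t. bigomega t > K"] sum_many_factors_le by linarith

text \<open>
  The \<open>j\<close>-th iterate itself is left free, so that one can count how often it has a given divisor.
\<close>
definition typical :: "nat \<Rightarrow> nat \<Rightarrow> bool" where
  "typical j n \<longleftrightarrow> (\<forall>i<j. few_factors (R i) ((F ^^ i) n))"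

lemma typical_Suc: "typical (Suc j) n \<longleftrightarrow> typical j n \<and> few_factors (R j) ((F ^^ j) n)"
  by (auto simp: typical_def less_Suc_eq)

lemma typical_prime_dvd_step:
  assumes "n > 0" "typical (Suc j) n" "prime q" "2 ^ R (Suc j) < q" "q dvd (F ^^ Suc j) n"
  shows "\<exists>p. prime p \<and> 2 ^ R j < p \<and> p dvd (F ^^ j) n \<and> q dvd F p"
proof -
  have "\<exists>p\<in>big_primes (R j) ((F ^^ j) n). q dvd F p"
    using assms by (intro big_prime_dvd_F) (auto simp: F_iter_pos R_ge_3 typical_Suc R_Suc)
  then show ?thesis by (auto simp: big_primes_def)
qed

text \<open>
  The iterates of $n$ may far exceed $N$, but a large prime factor of the $j$-th iterate ends a chain of primes that
  starts with a divisor of $n$, and each link of the chain gains at most $1$.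
\<close>
lemma typical_prime_dvd_le:
  assumes "n > 0" "n \<le> N" "typical j n" "prime q" "2 ^ R j < q" "q dvd (F ^^ j) n"
  shows "q \<le> N + j"
  using assms
proof (induction j arbitrary: q)
  case 0
  then show ?case using dvd_imp_le[of q n] by simp
next
  case (Suc j)
  from typical_prime_dvd_step[OF Suc.prems(1,3-6)] obtain p where
    p: "prime p" "2 ^ R j < p" "p dvd (F ^^ j) n" "q dvd F p" by auto
  then have "p \<le> N + j" using Suc by (auto simp: typical_Suc)
  moreover have "q \<le> F p" using p dvd_imp_le[of q "F p"] F_pos[of p] prime_gt_0_nat by simp
  ultimately show ?case using F_prime_le[OF p(1)] by simp
qed

lemma finite_primes_upto [simp]: "finite {p. prime p \<and> p \<le> 2 * N \<and> A p}"
  by (rule finite_subset[of _ "{..2 * N}"]) auto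

text \<open>
  Large primes reach the next iterate only through a large prime of the present one; summing over that prime costs a factor \<open>H\<close>.
\<close>
lemma card_typical_dvd:
  assumes "j \<le> N" "prime q" "2 ^ R j < q"
  shows "real (card {n \<in> {1..N}. typical j n \<and> q dvd (F ^^ j) n}) \<le> N * H ^ j / q"
  using assms
proof (induction j arbitrary: q)
  case 0
  have "{n \<in> {1..N}. typical 0 n \<and> q dvd (F ^^ 0) n} = {n \<in> {1..N}. q dvd n}"
    by (auto simp: typical_def)
  then show ?case using card_multiples_le[of q N] 0 prime_ge_1_nat[of q] by simp
next
  case (Suc j)
  let ?P = "{p. prime p \<and> p \<le> 2 * N \<and> q dvd F p \<and> 2 ^ R j < p}"
  let ?A = "\<lambda>p. {n \<in> {1..N}. typical j n \<and> p dvd (F ^^ j) n}"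
  have sub: "{n \<in> {1..N}. typical (Suc j) n \<and> q dvd (F ^^ Suc j) n} \<subseteq> (\<Union>p\<in>?P. ?A p)"
  proof
    fix n assume n: "n \<in> {n \<in> {1..N}. typical (Suc j) n \<and> q dvd (F ^^ Suc j) n}"
    then obtain p where p: "prime p" "2 ^ R j < p" "p dvd (F ^^ j) n" "q dvd F p"
      using typical_prime_dvd_step[of n j q] Suc.prems by auto
    moreover have "p \<le> 2 * N" using typical_prime_dvd_le[of n j p] n p Suc.prems by (auto simp: typical_Suc)
    ultimately show "n \<in> (\<Union>p\<in>?P. ?A p)" using n by (auto simp: typical_Suc)
  qed
  have "real (card (\<Union>p\<in>?P. ?A p)) \<le> (\<Sum>p\<in>?P. N * H ^ j / p)"
    using Suc by (intro card_UN_real_le) auto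
  also have "\<dots> = N * H ^ j * (\<Sum>p\<in>?P. 1 / p)" by (simp add: sum_distrib_left)
  also have "\<dots> \<le> N * H ^ j * (H / q)"
  proof (rule mult_left_mono)
    have "(\<Sum>p\<in>?P. 1 / real p) \<le> (\<Sum>p | prime p \<and> p \<le> 2 * N \<and> q dvd F p. 1 / real p)"
      by (rule sum_mono2) auto
    also have "\<dots> \<le> H / q" using Suc.prems prime_ge_1_nat by (intro sum_primes_dvd_shift_le) auto
    finally show "(\<Sum>p\<in>?P. 1 / real p) \<le> H / q" .
  qed (use H_ge_2 in auto)
  finally have "real (card (\<Union>p\<in>?P. ?A p)) \<le> N * H ^ Suc j / q" by (simp add: mult_ac)
  then show ?case using sub by (rule card_subset_real_le) auto
qed

text \<open>
  The two primes come from the same prime of the previous iterate or from two different ones. Taking \<open>q = r\<close>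
  bounds the integers whose $j$-th iterate is divisible by the square of a large prime.
\<close>
lemma card_typical_two_dvd:
  assumes "j \<le> N" "prime q" "2 ^ R j < q" "prime r" "2 ^ R j < r"
  shows "real (card {n \<in> {1..N}. typical j n \<and> q * r dvd (F ^^ j) n}) \<le> (j + 1) * N * H ^ (2 * j) / (q * r)"
  using assms
proof (induction j arbitrary: q r)
  case 0
  have "{n \<in> {1..N}. typical 0 n \<and> q * r dvd (F ^^ 0) n} = {n \<in> {1..N}. q * r dvd n}"
    by (auto simp: typical_def)
  then show ?case using card_multiples_le[of "q * r" N] 0 prime_gt_0_nat[of q] prime_gt_0_nat[of r] by simp
next
  case (Suc j)
  let ?P = "\<lambda>m. {p. prime p \<and> p \<le> 2 * N \<and> m dvd F p \<and> 2 ^ R j < p}"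
  let ?A = "\<lambda>m. {n \<in> {1..N}. typical j n \<and> m dvd (F ^^ j) n}"
  have qr: "q > 0" "r > 0" using Suc.prems prime_gt_0_nat by auto
  have sumP: "(\<Sum>p\<in>?P m. 1 / real p) \<le> H / m" if "m > 0" for m
  proof -
    have "(\<Sum>p\<in>?P m. 1 / real p) \<le> (\<Sum>p | prime p \<and> p \<le> 2 * N \<and> m dvd F p. 1 / real p)"
      by (rule sum_mono2) auto
    also have "\<dots> \<le> H / m" using that by (intro sum_primes_dvd_shift_le) auto
    finally show ?thesis .
  qed
  have sub: "{n \<in> {1..N}. typical (Suc j) n \<and> q * r dvd (F ^^ Suc j) n} \<subseteq>
      (\<Union>p\<in>?P (q * r). ?A p) \<union> (\<Union>p\<in>?P q. \<Union>p'\<in>?P r. ?A (p * p'))"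
  proof
    fix n assume n: "n \<in> {n \<in> {1..N}. typical (Suc j) n \<and> q * r dvd (F ^^ Suc j) n}"
    let ?B = "big_primes (R j) ((F ^^ j) n)"
    have le: "p \<le> 2 * N" if "p \<in> ?B" for p
      using typical_prime_dvd_le[of n j p] that n Suc.prems by (auto simp: typical_Suc big_primes_def)
    have "(\<exists>p\<in>?B. q * r dvd F p) \<or> (\<exists>p\<in>?B. \<exists>p'\<in>?B. p \<noteq> p' \<and> q dvd F p \<and> r dvd F p')"
      using n Suc.prems by (intro two_big_primes_dvd_F) (auto simp: F_iter_pos R_ge_3 typical_Suc R_Suc)
    then show "n \<in> (\<Union>p\<in>?P (q * r). ?A p) \<union> (\<Union>p\<in>?P q. \<Union>p'\<in>?P r. ?A (p * p'))"
    proof (elim disjE bexE conjE)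
      fix p assume p: "p \<in> ?B" "q * r dvd F p"
      then have "p \<in> ?P (q * r)" "n \<in> ?A p" using le n by (auto simp: big_primes_def typical_Suc)
      then show ?thesis by blast
    next
      fix p p' assume p: "p \<in> ?B" "p' \<in> ?B" "p \<noteq> p'" "q dvd F p" "r dvd F p'"
      then have "p * p' dvd (F ^^ j) n"
        by (intro divides_mult) (auto simp: big_primes_def intro: primes_coprime)
      then have "p \<in> ?P q" "p' \<in> ?P r" "n \<in> ?A (p * p')" using p le n by (auto simp: big_primes_def typical_Suc)
      then show ?thesis by blast
    qed
  qed
  have "real (card (\<Union>p\<in>?P (q * r). ?A p)) \<le> (\<Sum>p\<in>?P (q * r). N * H ^ j / p)"
    using Suc.prems by (intro card_UN_real_le card_typical_dvd) auto
  also have "\<dots> = N * H ^ j * (\<Sum>p\<in>?P (q * r). 1 / p)" by (simp add: sum_distrib_left)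
  also have "\<dots> \<le> N * H ^ j * (H / (q * r))"
    using sumP[of "q * r"] qr H_ge_2 by (intro mult_left_mono) auto
  also have "\<dots> = N * H ^ Suc j / (q * r)" by simp
  also have "\<dots> \<le> N * H ^ (2 * Suc j) / (q * r)"
    using H_ge_2 by (intro divide_right_mono mult_left_mono power_increasing) auto
  finally have 1: "real (card (\<Union>p\<in>?P (q * r). ?A p)) \<le> N * H ^ (2 * Suc j) / (q * r)" .
  have "real (card (\<Union>p\<in>?P q. \<Union>p'\<in>?P r. ?A (p * p'))) \<le> (\<Sum>p\<in>?P q. \<Sum>p'\<in>?P r. (j + 1) * N * H ^ (2 * j) / (p * p'))"
    using Suc by (intro card_UN_real_le) auto
  also have "\<dots> = (j + 1) * N * H ^ (2 * j) * ((\<Sum>p\<in>?P q. 1 / p) * (\<Sum>p\<in>?P r. 1 / p))"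
    by (subst sum_product, unfold sum_distrib_left, intro sum.cong refl) (simp add: field_simps)
  also have "\<dots> \<le> (j + 1) * N * H ^ (2 * j) * ((H / q) * (H / r))"
    using sumP[of q] sumP[of r] qr H_ge_2 by (intro mult_left_mono mult_mono) (auto intro!: sum_nonneg)
  also have "\<dots> = (j + 1) * (N * H ^ (2 * Suc j) / (q * r))"
    by (simp add: power2_eq_square distrib_right)
  finally have 2: "real (card (\<Union>p\<in>?P q. \<Union>p'\<in>?P r. ?A (p * p'))) \<le> (j + 1) * (N * H ^ (2 * Suc j) / (q * r))" .
  have "real (card ((\<Union>p\<in>?P (q * r). ?A p) \<union> (\<Union>p\<in>?P q. \<Union>p'\<in>?P r. ?A (p * p'))))
      \<le> real (card (\<Union>p\<in>?P (q * r). ?A p)) + real (card (\<Union>p\<in>?P q. \<Union>p'\<in>?P r. ?A (p * p')))"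
    unfolding of_nat_add[symmetric] of_nat_le_iff by (rule card_Un_le)
  also have "\<dots> \<le> N * H ^ (2 * Suc j) / (q * r) + (j + 1) * (N * H ^ (2 * Suc j) / (q * r))"
    by (intro add_mono 1 2)
  also have "\<dots> = (real j + 2) * (N * H ^ (2 * Suc j) / (q * r))"
    by (simp only: of_nat_add of_nat_1 distrib_right) simp
  also have "\<dots> = (Suc j + 1) * N * H ^ (2 * Suc j) / (real q * real r)"
    by (simp add: distrib_right)
  finally show ?case using sub by (rule card_subset_real_le) auto
qed

lemma card_many_factors_le:
  assumes "M \<le> N"
  shows "real (card {n \<in> {1..M}. bigomega n > K}) \<le> M * \<delta>"
proof -
  have "real (card {n \<in> {1..M}. bigomega n > K}) = (\<Sum>n | n \<in> {1..M} \<and> bigomega n > K. 1)" by simp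
  also have "\<dots> \<le> (\<Sum>n | n \<in> {1..M} \<and> bigomega n > K. M * (1 / real n))"
    by (rule sum_mono) auto
  also have "\<dots> = M * (\<Sum>n | n \<in> {1..M} \<and> bigomega n > K. 1 / real n)"
    by (simp add: sum_distrib_left)
  also have "\<dots> \<le> M * (\<Sum>n | n \<in> {1..2 * N + 1} \<and> bigomega n > K. 1 / real n)"
    using assms by (intro mult_left_mono sum_mono2) auto
  also have "\<dots> \<le> M * \<delta>" by (intro mult_left_mono sum_many_factors_le) auto
  finally show ?thesis .
qed

text \<open>
  Too many prime factors in the next iterate force some large prime $p$ of the present one to have $\Omega(F(p)) > K$.
\<close>
lemma card_typical_many_factors_le:
  assumes "j \<le> N"
  shows "real (card {n \<in> {1..N}. typical j n \<and> bigomega ((F ^^ j) n) > R j}) \<le> 2 * N * H ^ (2 * j) * \<delta>"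
proof (cases j)
  case 0
  then have "real (card {n \<in> {1..N}. typical j n \<and> bigomega ((F ^^ j) n) > R j}) \<le> N * \<delta>"
    using card_many_factors_le[of N] by (simp add: typical_def R_0)
  also have "\<dots> \<le> 2 * N * H ^ (2 * j) * \<delta>" using 0 \<delta>_pos by simp
  finally show ?thesis .
next
  case (Suc i)
  let ?P = "{p. prime p \<and> p \<le> 2 * N \<and> bigomega (F p) > K \<and> 2 ^ R i < p}"
  let ?A = "\<lambda>p. {n \<in> {1..N}. typical i n \<and> p dvd (F ^^ i) n}"
  have sub: "{n \<in> {1..N}. typical j n \<and> bigomega ((F ^^ j) n) > R j} \<subseteq> (\<Union>p\<in>?P. ?A p)"
  proof
    fix n assume n: "n \<in> {n \<in> {1..N}. typical j n \<and> bigomega ((F ^^ j) n) > R j}"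
    let ?B = "big_primes (R i) ((F ^^ i) n)"
    have "\<exists>p\<in>?B. bigomega (F p) > K"
    proof (rule ccontr)
      assume "\<not> ?thesis"
      then have "bigomega (F ((F ^^ i) n)) \<le> R i ^ 3"
        using n Suc by (intro bigomega_F_le[where K = K]) (auto simp: F_iter_pos R_ge_3 typical_Suc K_le_R not_less)
      then show False using n by (simp add: Suc R_Suc)
    qed
    then obtain p where p: "p \<in> ?B" "bigomega (F p) > K" by blast
    moreover have "p \<le> 2 * N"
      using typical_prime_dvd_le[of n i p] p n Suc assms by (auto simp: typical_Suc big_primes_def)
    ultimately have "p \<in> ?P" "n \<in> ?A p" using n Suc by (auto simp: big_primes_def typical_Suc)
    then show "n \<in> (\<Union>p\<in>?P. ?A p)" by blast
  qed
  have "real (card (\<Union>p\<in>?P. ?A p)) \<le> (\<Sum>p\<in>?P. N * H ^ i / p)"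
    using Suc assms by (intro card_UN_real_le card_typical_dvd) auto
  also have "\<dots> = N * H ^ i * (\<Sum>p\<in>?P. 1 / p)" by (simp add: sum_distrib_left)
  also have "\<dots> \<le> N * H ^ i * (2 * \<delta>)"
  proof (rule mult_left_mono)
    have "(\<Sum>p\<in>?P. 1 / real p) \<le> (\<Sum>p | prime p \<and> p \<le> 2 * N \<and> bigomega (F p) > K. 1 / real p)"
      by (rule sum_mono2) auto
    also have "\<dots> \<le> 2 * \<delta>" by (rule sum_primes_many_factors_le)
    finally show "(\<Sum>p\<in>?P. 1 / real p) \<le> 2 * \<delta>" .
  qed (use H_ge_2 in auto)
  also have "N * H ^ i * (2 * \<delta>) \<le> N * H ^ (2 * j) * (2 * \<delta>)"
    using H_ge_2 \<delta>_pos Suc by (intro mult_right_mono mult_left_mono power_increasing) auto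
  finally have "real (card (\<Union>p\<in>?P. ?A p)) \<le> 2 * N * H ^ (2 * j) * \<delta>"
    by (simp add: mult_ac)
  then show ?thesis using sub by (rule card_subset_real_le) auto
qed

lemma card_typical_square_dvd_le:
  assumes "j \<le> N"
  shows "real (card {n \<in> {1..N}. typical j n \<and> (\<exists>q. prime q \<and> 2 ^ R j < q \<and> q\<^sup>2 dvd (F ^^ j) n)})
         \<le> (j + 1) * N * H ^ (2 * j) * \<delta>"
proof -
  let ?Q = "{q. prime q \<and> q \<le> 2 * N \<and> 2 ^ R j < q}"
  let ?A = "\<lambda>q. {n \<in> {1..N}. typical j n \<and> q * q dvd (F ^^ j) n}"
  have sub: "{n \<in> {1..N}. typical j n \<and> (\<exists>q. prime q \<and> 2 ^ R j < q \<and> q\<^sup>2 dvd (F ^^ j) n)} \<subseteq> (\<Union>q\<in>?Q. ?A q)"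
  proof safe
    fix n q assume n: "n \<in> {1..N}" "typical j n" and q: "prime q" "2 ^ R j < q" "q\<^sup>2 dvd (F ^^ j) n"
    have "q dvd (F ^^ j) n" using q(3) by (simp add: power2_eq_square dvd_mult_left)
    then have "q \<le> 2 * N" using typical_prime_dvd_le[of n j q] n q assms by simp
    then show "n \<in> (\<Union>q\<in>?Q. ?A q)" using n q by (auto simp: power2_eq_square)
  qed
  have "real (card (\<Union>q\<in>?Q. ?A q)) \<le> (\<Sum>q\<in>?Q. (j + 1) * N * H ^ (2 * j) / (q * q))"
    using assms card_typical_two_dvd[of j] by (intro card_UN_real_le) auto
  also have "\<dots> = (j + 1) * N * H ^ (2 * j) * (\<Sum>q\<in>?Q. 1 / (real q)\<^sup>2)"
    by (simp add: sum_distrib_left power2_eq_square)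
  also have "\<dots> \<le> (j + 1) * N * H ^ (2 * j) * \<delta>"
  proof (rule mult_left_mono)
    have "(\<Sum>q\<in>?Q. 1 / (real q)\<^sup>2) \<le> (\<Sum>q\<in>{2 ^ R j<..2 * N}. 1 / (real q)\<^sup>2)"
      by (rule sum_mono2) auto
    also have "\<dots> \<le> 1 / real (2 ^ R j)" by (rule sum_inverse_squares_le) auto
    also have "\<dots> \<le> 1 / 2 ^ T" using T_le_R[of j] by (simp add: frac_le)
    also have "\<dots> \<le> \<delta>" by (rule inverse_two_power_le)
    finally show "(\<Sum>q\<in>?Q. 1 / (real q)\<^sup>2) \<le> \<delta>" .
  qed (use H_ge_2 in auto)
  finally have "real (card (\<Union>q\<in>?Q. ?A q)) \<le> (j + 1) * N * H ^ (2 * j) * \<delta>" .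
  then show ?thesis using sub by (rule card_subset_real_le) auto
qed

lemma card_not_typical_le:
  assumes "j \<le> N"
  shows "real (card {n \<in> {1..N}. \<not> typical j n}) \<le> j * (j + 2) * N * H ^ (2 * j) * \<delta>"
  using assms
proof (induction j)
  case 0
  have "{n \<in> {1..N}. \<not> typical 0 n} = {}" by (auto simp: typical_def)
  then show ?case by (simp only: card.empty)
next
  case (Suc j)
  let ?A = "{n \<in> {1..N}. \<not> typical j n}"
  let ?B = "{n \<in> {1..N}. typical j n \<and> bigomega ((F ^^ j) n) > R j}"
  let ?C = "{n \<in> {1..N}. typical j n \<and> (\<exists>q. prime q \<and> 2 ^ R j < q \<and> q\<^sup>2 dvd (F ^^ j) n)}"
  have sub: "{n \<in> {1..N}. \<not> typical (Suc j) n} \<subseteq> ?A \<union> (?B \<union> ?C)"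
    by (auto simp: typical_Suc few_factors_def)
  have "real (card (?A \<union> (?B \<union> ?C))) \<le> real (card ?A) + (real (card ?B) + real (card ?C))"
    using card_Un_le[of ?A "?B \<union> ?C"] card_Un_le[of ?B ?C] by linarith
  also have "\<dots> \<le> j * (j + 2) * N * H ^ (2 * j) * \<delta> + (2 * N * H ^ (2 * j) * \<delta> + (j + 1) * N * H ^ (2 * j) * \<delta>)"
    using Suc card_typical_many_factors_le[of j] card_typical_square_dvd_le[of j] by (intro add_mono) auto
  also have "\<dots> = (j * (j + 2) + (j + 3)) * (N * \<delta>) * H ^ (2 * j)" by (simp add: algebra_simps)
  also have "\<dots> \<le> (Suc j * (Suc j + 2)) * (N * \<delta>) * H ^ (2 * Suc j)"
    using H_ge_2 \<delta>_pos by (intro mult_mono power_increasing) (auto simp: algebra_simps)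
  also have "\<dots> = real (Suc j * (Suc j + 2) * N) * H ^ (2 * Suc j) * \<delta>"
    unfolding of_nat_mult by (simp only: mult_ac)
  finally show ?case using sub by (rule card_subset_real_le) simp
qed

end

section \<open>Chains of primes and their cofactors\<close>

lemma prod_list_ge_1: "(\<forall>c\<in>set cs. 1 \<le> c) \<Longrightarrow> 1 \<le> prod_list (cs :: nat list)"
  by (induction cs) (auto simp: Suc_le_eq)

lemma card_lists_prod_le:
  assumes "W \<le> real M" "W \<ge> 0"
  shows "finite {cs. length cs = Suc d \<and> (\<forall>c\<in>set cs. 1 \<le> c) \<and> real (prod_list cs) \<le> W} \<and>
         real (card {cs. length cs = Suc d \<and> (\<forall>c\<in>set cs. 1 \<le> c) \<and> real (prod_list cs) \<le> W}) \<le> W * harm M ^ d"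
    (is "finite (?L d W) \<and> real (card (?L d W)) \<le> _")
  using assms
proof (induction d arbitrary: W)
  case 0
  have eq: "?L 0 W = (\<lambda>c. [c]) ` {1..nat \<lfloor>W\<rfloor>}"
    using 0 by (auto simp: length_Suc_conv le_nat_iff le_floor_iff)
  have "real (card (?L 0 W)) = real (nat \<lfloor>W\<rfloor>)"
    unfolding eq by (subst card_image) (auto simp: inj_on_def)
  then show ?case using 0 eq by simp
next
  case (Suc d)
  let ?A = "\<lambda>c. (\<lambda>cs. c # cs) ` ?L d (W / real c)"
  have sub: "?L (Suc d) W \<subseteq> (\<Union>c\<in>{1..M}. ?A c)"
  proof
    fix l assume l: "l \<in> ?L (Suc d) W"
    then obtain c cs where cs: "l = c # cs" "length cs = Suc d" by (auto simp: length_Suc_conv)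
    with l have c: "1 \<le> c" "\<forall>x\<in>set cs. 1 \<le> x" "real c * real (prod_list cs) \<le> W" by auto
    have "c * 1 \<le> c * prod_list cs" using prod_list_ge_1[OF c(2)] by (intro mult_left_mono) auto
    then have "real c \<le> real c * real (prod_list cs)" by (metis mult.right_neutral of_nat_le_iff of_nat_mult)
    then have "c \<le> M" using c(3) Suc.prems by linarith
    moreover have "cs \<in> ?L d (W / real c)" using c cs by (simp add: field_simps)
    ultimately show "l \<in> (\<Union>c\<in>{1..M}. ?A c)" using cs c by auto
  qed
  have IH: "finite (?L d (W / real c))" "real (card (?L d (W / real c))) \<le> W / real c * harm M ^ d"
    if "c \<in> {1..M}" for c
  proof -
    have "W / real c \<le> W / 1" using that Suc.prems by (intro divide_left_mono) auto
    then have "W / real c \<le> real M" "W / real c \<ge> 0" using Suc.prems by auto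
    from Suc.IH[OF this] show "finite (?L d (W / real c))" "real (card (?L d (W / real c))) \<le> W / real c * harm M ^ d"
      by blast+
  qed
  have "real (card (\<Union>c\<in>{1..M}. ?A c)) \<le> (\<Sum>c\<in>{1..M}. W / real c * harm M ^ d)"
  proof (rule card_UN_real_le)
    fix c assume c: "c \<in> {1..M}"
    have "card (?A c) = card (?L d (W / real c))" by (rule card_image) (auto simp: inj_on_def)
    then show "real (card (?A c)) \<le> W / real c * harm M ^ d" using IH(2)[OF c] by simp
  qed simp
  also have "\<dots> = W * harm M ^ d * (\<Sum>c=1..M. 1 / real c)"
    by (simp add: sum_distrib_left)
  also have "\<dots> = W * harm M ^ Suc d" by (simp add: harm_eq)
  finally have card: "real (card (\<Union>c\<in>{1..M}. ?A c)) \<le> W * harm M ^ Suc d" .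
  have fin: "finite (\<Union>c\<in>{1..M}. ?A c)" using IH(1) by (intro finite_UN_I finite_imageI) auto
  show ?case using finite_subset[OF sub fin] card_subset_real_le[OF card sub fin] by blast
qed

text \<open>
  The number of iterations is \<open>Suc d\<close>, and a chain has \<open>d\<close> links.
\<close>
locale shift_map_chain = shift_map_upto F N T for F :: "nat \<Rightarrow> nat" and N T +
  fixes d :: nat
  assumes d: "Suc d \<le> N"
begin

text \<open>
  Large enough to be beyond the small primes of all levels that occur, so that typical integers have no repeated prime factor above \<open>z\<close> in any iterate.
\<close>
definition z :: nat where "z = 2 ^ R (Suc d)"

lemma z_ge: "2 ^ d \<le> z"
proof -
  have "Suc d < 2 ^ Suc d" by (rule less_exp)
  also have "\<dots> \<le> 3 ^ Suc d" by (rule power_mono) auto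
  also have "(3::nat) ^ Suc d < 2 ^ (3 ^ Suc d)" by (rule less_exp)
  also have "\<dots> \<le> 4 ^ (3 ^ Suc d)" by (rule power_mono) auto
  also have "(4::nat) ^ (3 ^ Suc d) \<le> K ^ (3 ^ Suc d)" using K_ge by (intro power_mono) auto
  finally have "d \<le> R (Suc d)" by (simp add: R_def)
  then show ?thesis by (simp add: z_def)
qed

lemma z_pos: "z > 0" by (simp add: z_def)

lemma inverse_z_le: "1 / real z \<le> \<delta>"
proof -
  have "1 / real z \<le> 1 / 2 ^ T" using T_le_R[of "Suc d"] by (simp add: z_def frac_le)
  also note inverse_two_power_le
  finally show ?thesis .
qed

lemma typical_square_free:
  assumes "typical (Suc d) n" "i \<le> d" "prime p" "z < p"
  shows "\<not> p\<^sup>2 dvd (F ^^ i) n"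
proof -
  have "(2::nat) ^ R i \<le> z" unfolding z_def using assms R_mono[of i "Suc d"] by (intro power_increasing) auto
  then show ?thesis using assms by (auto simp: typical_def few_factors_def)
qed

text \<open>
  \<open>link cs q r\<close>: a chain of primes above \<open>z\<close> from \<open>q\<close> to \<open>r\<close>, each dividing the value of $F$ at the one
  before. Instead of the intermediate primes the list records the complementary factors: they determine the chain backwards from \<open>r\<close>
  (\<open>link_inj\<close>) and have a small product (\<open>link_prod_le\<close>).
\<close>
primrec link :: "nat list \<Rightarrow> nat \<Rightarrow> nat \<Rightarrow> bool" where
  "link [] q r \<longleftrightarrow> prime q \<and> z < q \<and> q = r"
| "link (c # cs) q r \<longleftrightarrow> prime q \<and> z < q \<and> (\<exists>q'. F q = c * q' \<and> link cs q' r)"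

text \<open>
  The factor that accompanies $F(r)$ when $F$ is iterated on $q b$ along a chain from $q$ to $r$; it depends on the chain only through the list.
\<close>
primrec cofactor :: "nat list \<Rightarrow> nat \<Rightarrow> nat" where
  "cofactor [] b = F b"
| "cofactor (c # cs) b = cofactor cs (c * F b)"

lemma link_prime: "link cs q r \<Longrightarrow> prime q \<and> z < q \<and> prime r \<and> z < r"
  by (induction cs arbitrary: q) auto

lemma link_pos: "link cs q r \<Longrightarrow> \<forall>c\<in>set cs. 1 \<le> c"
proof (induction cs arbitrary: q)
  case (Cons c cs)
  then have "F q > 0" using F_pos[of q] prime_gt_0_nat by auto
  then show ?case using Cons by (auto simp: Suc_le_eq)
qed simp

lemma link_inj: "link cs q r \<Longrightarrow> link cs q' r \<Longrightarrow> q = q'"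
proof (induction cs arbitrary: q q')
  case (Cons c cs)
  then show ?case by (auto intro: F_prime_inj)
qed simp

lemma link_prod_le: "link cs q r \<Longrightarrow> r * prod_list cs \<le> 2 ^ length cs * q"
proof (induction cs arbitrary: q)
  case (Cons c cs)
  then obtain q' where q': "prime q" "F q = c * q'" "link cs q' r" by auto
  have "r * prod_list (c # cs) = c * (r * prod_list cs)" by simp
  also have "\<dots> \<le> c * (2 ^ length cs * q')" by (intro mult_left_mono Cons.IH q') auto
  also have "\<dots> = 2 ^ length cs * F q" by (simp add: q')
  also have "\<dots> \<le> 2 ^ length cs * (2 * q)"
    using F_prime_le[OF q'(1)] prime_gt_0_nat[OF q'(1)] by (intro mult_left_mono) auto
  finally show ?case by simp
qed simp

text \<open>
  As long as $q^2 \nmid q b$, the prime splits off: $F(q b) = F(q) F(b) = q' (c\,F(b))$ with the next prime $q'$ of the chain in place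
  of $q$. The factors $c$ and $F(b)$ may have primes in common, so their product is carried along as a whole.
\<close>
lemma link_cofactor:
  assumes "link cs q r" "b > 0"
    and "\<And>i p. i \<le> length cs \<Longrightarrow> prime p \<Longrightarrow> z < p \<Longrightarrow> \<not> p\<^sup>2 dvd (F ^^ i) (q * b)"
  shows "(F ^^ Suc (length cs)) (q * b) = F r * cofactor cs b"
  using assms
proof (induction cs arbitrary: q b)
  have F_step: "F (q * b) = F q * F b" if "prime q" "b > 0" "\<not> q\<^sup>2 dvd q * b" for q b
  proof -
    have "\<not> q dvd b" using that by (auto simp: power2_eq_square)
    then show ?thesis using that by (intro F_coprime) (auto intro: prime_gt_0_nat prime_imp_coprime)
  qed
  {
    case Nil
    then show ?case using Nil.prems(3)[of 0 q] F_step[of q b] by auto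
  next
    case (Cons c cs)
    then obtain q' where q': "prime q" "z < q" "F q = c * q'" "link cs q' r" by auto
    have eq: "F (q * b) = q' * (c * F b)"
      using Cons.prems(3)[of 0 q] F_step[of q b] q' Cons.prems by simp
    have "c > 0" using F_pos[OF prime_gt_0_nat[OF q'(1)]] q' by (auto intro: Nat.gr0I)
    have "(F ^^ Suc (length cs)) (q' * (c * F b)) = F r * cofactor cs (c * F b)"
    proof (rule Cons.IH[OF q'(4)])
      show "c * F b > 0" using \<open>c > 0\<close> F_pos[OF Cons.prems(2)] by simp
      fix i p assume "i \<le> length cs" "prime (p::nat)" "z < p"
      then show "\<not> p\<^sup>2 dvd (F ^^ i) (q' * (c * F b))"
        using Cons.prems(3)[of "Suc i" p] unfolding funpow_Suc_right comp_def eq by simp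
    qed
    then show ?case by (simp add: funpow_swap1 eq)
  }
qed

lemma typical_link_cofactor:
  assumes "typical (Suc d) (q * b)" "link cs q r" "length cs = d" "b > 0"
  shows "(F ^^ Suc d) (q * b) = F r * cofactor cs b"
  using link_cofactor[OF assms(2,4)] typical_square_free[OF assms(1)] assms(3) by simp

text \<open>
  The heart of the matter. A value $v \ne 0$ together with $b$ and the cofactors determines $F(r)$, hence the last prime $r$,
  hence the whole chain and $m = q b$. The product of $b$ and the cofactors is at most $2^d Y / z$ because $r > z$, and few lists have
  such a product.
\<close>
lemma card_fibre_le:
  fixes g :: "nat \<Rightarrow> nat list \<Rightarrow> int"
  assumes Y: "Y \<le> N" "S \<subseteq> {1..Y}" and v: "v \<noteq> 0"
    and S: "\<And>m. m \<in> S \<Longrightarrow> \<exists>b cs q r. b \<ge> 1 \<and> length cs = d \<and> m = q * b \<and> link cs q r \<and> int (F r) * g b cs = v"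
  shows "real (card S) \<le> 2 ^ d * Y / z * H ^ d"
proof -
  define W where "W = 2 ^ d * real Y / real z"
  let ?L = "{cs. length cs = Suc d \<and> (\<forall>c\<in>set cs. 1 \<le> c) \<and> real (prod_list cs) \<le> W}"
  have "\<forall>m\<in>S. \<exists>l. length l = Suc d \<and> hd l \<ge> 1 \<and> (\<exists>q r. m = q * hd l \<and> link (tl l) q r \<and> int (F r) * g (hd l) (tl l) = v)"
  proof
    fix m assume "m \<in> S"
    from S[OF this] obtain b cs q r where
      "b \<ge> 1" "length cs = d" "m = q * b" "link cs q r" "int (F r) * g b cs = v" by blast
    then show "\<exists>l. length l = Suc d \<and> hd l \<ge> 1 \<and> (\<exists>q r. m = q * hd l \<and> link (tl l) q r \<and> int (F r) * g (hd l) (tl l) = v)"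
      by (intro exI[of _ "b # cs"]) auto
  qed
  from bchoice[OF this] obtain f where
    f: "\<And>m. m \<in> S \<Longrightarrow> length (f m) = Suc d \<and> hd (f m) \<ge> 1 \<and>
      (\<exists>q r. m = q * hd (f m) \<and> link (tl (f m)) q r \<and> int (F r) * g (hd (f m)) (tl (f m)) = v)" by blast
  have W: "W \<le> real (2 * N + 1)" "W \<ge> 0"
  proof -
    have "2 ^ d * real Y / real z \<le> real z * real Y / real z"
      using z_ge by (intro divide_right_mono mult_right_mono) (auto simp flip: of_nat_le_iff)
    also have "\<dots> = real Y" using z_pos by simp
    finally show "W \<le> real (2 * N + 1)" using Y by (simp add: W_def)
  qed (simp add: W_def)
  have inj: "inj_on f S"
  proof (rule inj_onI)
    fix m m' assume m: "m \<in> S" "m' \<in> S" "f m = f m'"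
    obtain q r where q: "m = q * hd (f m)" "link (tl (f m)) q r" "int (F r) * g (hd (f m)) (tl (f m)) = v"
      using f[OF m(1)] by blast
    obtain q' r' where q': "m' = q' * hd (f m)" "link (tl (f m)) q' r'" "int (F r') * g (hd (f m)) (tl (f m)) = v"
      using f[OF m(2)] m(3) by auto
    have "F r = F r'" using q(3) q'(3) v by auto
    then have "r = r'" using F_prime_inj link_prime[OF q(2)] link_prime[OF q'(2)] by blast
    then have "q = q'" using q(2) q'(2) link_inj by blast
    then show "m = m'" using q(1) q'(1) by simp
  qed
  have sub: "f ` S \<subseteq> ?L"
  proof (rule image_subsetI)
    fix m assume m: "m \<in> S"
    obtain b cs where bcs: "f m = b # cs" "length cs = d" "b \<ge> 1" using f[OF m] by (cases "f m") auto
    then obtain q r where q: "m = q * b" "link cs q r" using f[OF m] by auto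
    have "z * (b * prod_list cs) \<le> r * (b * prod_list cs)"
      using link_prime[OF q(2)] by (intro mult_right_mono) auto
    also have "\<dots> = b * (r * prod_list cs)" by simp
    also have "\<dots> \<le> b * (2 ^ d * q)" using link_prod_le[OF q(2)] bcs by (intro mult_left_mono) auto
    also have "\<dots> = 2 ^ d * m" using q by simp
    also have "\<dots> \<le> 2 ^ d * Y" using m Y by (intro mult_left_mono) auto
    finally have "real (z * (b * prod_list cs)) \<le> real (2 ^ d * Y)" by (rule of_nat_mono)
    then have "real (b * prod_list cs) \<le> W" using z_pos by (simp add: W_def field_simps)
    then show "f m \<in> ?L" using bcs link_pos[OF q(2)] by auto
  qed
  have L: "finite ?L" "real (card ?L) \<le> W * harm (2 * N + 1) ^ d"
    using card_lists_prod_le[OF W] by blast+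
  have "card S \<le> card ?L" by (rule card_inj_on_le[OF inj sub L(1)])
  then have "real (card S) \<le> W * harm (2 * N + 1) ^ d" using L(2) by linarith
  also have "\<dots> \<le> W * H ^ d"
    using W(2) harm_nonneg[of "2 * N + 1", where 'a = real] by (intro mult_left_mono power_mono) (auto simp: H_def)
  finally show ?thesis by (simp add: W_def)
qed

definition has_chain :: "nat \<Rightarrow> nat \<Rightarrow> bool" where
  "has_chain e q \<longleftrightarrow> (\<exists>cs r. length cs = e \<and> link cs q r)"

lemma has_chain_0: "has_chain 0 q \<longleftrightarrow> prime q \<and> z < q"
  by (auto simp: has_chain_def)

lemma has_chain_Suc:
  assumes "prime q" "z < q" "q' dvd F q" "has_chain e q'"
  shows "has_chain (Suc e) q"
proof -
  obtain cs r where "length cs = e" "link cs q' r" using assms by (auto simp: has_chain_def)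
  moreover obtain c where "F q = c * q'" using assms by (metis dvd_def mult.commute)
  ultimately have "length (c # cs) = Suc e" "link (c # cs) q r" using assms by auto
  then show ?thesis unfolding has_chain_def by blast
qed

text \<open>
  Above \<open>y e\<close> almost all primes have a chain with \<open>e\<close> links; each link raises the threshold to the power $K + 1$.
\<close>
definition y :: "nat \<Rightarrow> nat" where "y e = 2 ^ (R (Suc d) * (K + 1) ^ e)"

lemma y_0: "y 0 = z" and y_Suc: "y (Suc e) = y e ^ (K + 1)"
  by (simp_all only: y_def z_def power_mult[symmetric] power_Suc2 mult.assoc power_0 mult_1_right)

lemma y_gt_1: "y e > 1"
  unfolding y_def using R_ge_3[of "Suc d"] by (intro one_less_power) auto

lemma z_le_y: "z \<le> y e"
proof (induction e)
  case (Suc e)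
  have "y e \<le> y e ^ (K + 1)" using y_gt_1[of e] by (intro self_le_power) auto
  with Suc show ?case unfolding y_Suc by (rule order.trans)
qed (simp add: y_0)

text \<open>
  A product of at most $K$ primes below the old threshold stays below the new one.
\<close>
lemma exists_large_prime_factor:
  assumes "n \<ge> y (Suc e)" "bigomega n \<le> K"
  shows "\<exists>q. prime q \<and> q dvd n \<and> y e < q"
proof (rule ccontr)
  assume "\<not> ?thesis"
  then have "n \<le> y e ^ bigomega n"
    using assms y_gt_1[of "Suc e"] by (intro le_power_bigomega) (auto simp: not_less)
  also have "\<dots> \<le> y e ^ K" using assms y_gt_1[of e] by (intro power_increasing) auto
  also have "\<dots> < y e ^ (K + 1)" using y_gt_1[of e] by (intro power_strict_increasing) auto
  finally show False using assms by (simp add: y_Suc)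
qed

text \<open>
  A prime $p$ above the threshold without a chain has $\Omega(F(p)) > K$, or else $F(p)$ has a prime factor above the previous threshold, which then
  has no chain either.
\<close>
lemma sum_primes_without_chain_le:
  assumes "Y + e \<le> 2 * N"
  shows "(\<Sum>p | prime p \<and> p \<le> Y \<and> y e < p \<and> \<not> has_chain e p. 1 / real p) \<le> 2 * real e * H ^ e * \<delta>"
  using assms
proof (induction e arbitrary: Y)
  case 0
  have "{p. prime p \<and> p \<le> Y \<and> y 0 < p \<and> \<not> has_chain 0 p} = {}" by (auto simp: y_0 has_chain_0)
  then show ?case by (simp only: sum.empty)
next
  case (Suc e)
  let ?A = "{p. prime p \<and> p \<le> 2 * N \<and> bigomega (F p) > K}"
  let ?Q = "{q. prime q \<and> q \<le> Suc Y \<and> y e < q \<and> \<not> has_chain e q}"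
  let ?B = "\<lambda>q. {p. prime p \<and> p \<le> 2 * N \<and> q dvd F p}"
  have finQ: "finite ?Q" by (rule finite_subset[of _ "{..Suc Y}"]) auto
  have sub: "{p. prime p \<and> p \<le> Y \<and> y (Suc e) < p \<and> \<not> has_chain (Suc e) p} \<subseteq> ?A \<union> (\<Union>q\<in>?Q. ?B q)"
  proof
    fix p assume p: "p \<in> {p. prime p \<and> p \<le> Y \<and> y (Suc e) < p \<and> \<not> has_chain (Suc e) p}"
    show "p \<in> ?A \<union> (\<Union>q\<in>?Q. ?B q)"
    proof (cases "bigomega (F p) > K")
      case True then show ?thesis using p Suc.prems by auto
    next
      case False
      have "y (Suc e) \<le> F p" using F_prime_ge[of p] p by auto
      then obtain q where q: "prime q" "q dvd F p" "y e < q"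
        using exists_large_prime_factor[of e "F p"] False by auto
      have "q \<le> Suc Y"
        using dvd_imp_le[OF q(2)] F_pos[of p] F_prime_le[of p] p prime_gt_0_nat[of p] by auto
      moreover have "\<not> has_chain e q"
        using has_chain_Suc[of p q e] p q z_le_y[of "Suc e"] by auto
      ultimately have "q \<in> ?Q" "p \<in> ?B q" using q p Suc.prems by auto
      then show ?thesis by blast
    qed
  qed
  have "(\<Sum>p | prime p \<and> p \<le> Y \<and> y (Suc e) < p \<and> \<not> has_chain (Suc e) p. 1 / real p)
      \<le> (\<Sum>p\<in>?A \<union> (\<Union>q\<in>?Q. ?B q). 1 / real p)"
    using sub finQ by (intro sum_mono2) auto
  also have "\<dots> \<le> (\<Sum>p\<in>?A. 1 / real p) + (\<Sum>p\<in>(\<Union>q\<in>?Q. ?B q). 1 / real p)"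
    using finQ by (subst sum_Un) (auto intro!: sum_nonneg)
  also have "\<dots> \<le> 2 * \<delta> + (\<Sum>q\<in>?Q. \<Sum>p\<in>?B q. 1 / real p)"
    using finQ by (intro add_mono sum_primes_many_factors_le sum_UN_le) auto
  also have "\<dots> \<le> 2 * \<delta> + (\<Sum>q\<in>?Q. H / real q)"
    by (intro add_left_mono sum_mono sum_primes_dvd_shift_le) (auto simp: prime_ge_1_nat)
  also have "\<dots> = 2 * \<delta> + H * (\<Sum>q\<in>?Q. 1 / real q)" by (simp add: sum_distrib_left)
  also have "\<dots> \<le> 2 * \<delta> + H * (2 * real e * H ^ e * \<delta>)"
    using Suc.IH[of "Suc Y"] Suc.prems H_ge_2 by (intro add_left_mono mult_left_mono) auto
  also have "\<dots> \<le> 2 * \<delta> * H ^ Suc e + H * (2 * real e * H ^ e * \<delta>)"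
    using H_ge_2 \<delta>_pos one_le_power[of H "Suc e"] by (intro add_right_mono) simp
  also have "\<dots> = 2 * real (Suc e) * H ^ Suc e * \<delta>" by (simp add: algebra_simps)
  finally show ?case .
qed

lemma card_without_chain_le:
  assumes "M \<le> N"
  shows "real (card {m \<in> {1..M}. \<not> (\<exists>q. q dvd m \<and> has_chain d q)}) \<le> M * ((2 * d + 1) * H ^ d * \<delta>) + y (Suc d)"
proof -
  let ?A = "{n \<in> {1..M}. bigomega n > K}"
  let ?Q = "{q. prime q \<and> q \<le> N \<and> y d < q \<and> \<not> has_chain d q}"
  let ?B = "\<lambda>q. {m \<in> {1..M}. q dvd m}"
  have finQ: "finite ?Q" by (rule finite_subset[of _ "{..N}"]) auto
  have sub: "{m \<in> {1..M}. \<not> (\<exists>q. q dvd m \<and> has_chain d q)} \<subseteq> {1..y (Suc d)} \<union> (?A \<union> (\<Union>q\<in>?Q. ?B q))"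
  proof
    fix m assume m: "m \<in> {m \<in> {1..M}. \<not> (\<exists>q. q dvd m \<and> has_chain d q)}"
    show "m \<in> {1..y (Suc d)} \<union> (?A \<union> (\<Union>q\<in>?Q. ?B q))"
    proof (cases "m \<le> y (Suc d) \<or> bigomega m > K")
      case True then show ?thesis using m by auto
    next
      case False
      then obtain q where q: "prime q" "q dvd m" "y d < q"
        using exists_large_prime_factor[of d m] by auto
      moreover have "q \<le> N" using dvd_imp_le[OF q(2)] m assms by auto
      ultimately have "q \<in> ?Q" "m \<in> ?B q" using m by auto
      then show ?thesis by blast
    qed
  qed
  have "real (card ({1..y (Suc d)} \<union> (?A \<union> (\<Union>q\<in>?Q. ?B q)))) \<le> y (Suc d) + (real (card ?A) + real (card (\<Union>q\<in>?Q. ?B q)))"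
    using card_Un_le[of "{1..y (Suc d)}" "?A \<union> (\<Union>q\<in>?Q. ?B q)"] card_Un_le[of ?A "\<Union>q\<in>?Q. ?B q"]
    unfolding of_nat_add[symmetric] of_nat_le_iff card_atLeastAtMost by linarith
  also have "\<dots> \<le> y (Suc d) + (M * \<delta> + (\<Sum>q\<in>?Q. M / q))"
    using finQ by (intro add_mono card_many_factors_le assms card_UN_real_le card_multiples_le) (auto simp: prime_ge_1_nat)
  also have "(\<Sum>q\<in>?Q. M / q) = M * (\<Sum>q\<in>?Q. 1 / q)" by (simp add: sum_distrib_left)
  also have "y (Suc d) + (M * \<delta> + M * (\<Sum>q\<in>?Q. 1 / q)) \<le> y (Suc d) + (M * (H ^ d * \<delta>) + M * (2 * real d * H ^ d * \<delta>))"
    using sum_primes_without_chain_le[of N d] d \<delta>_pos H_ge_2 one_le_power[of H d]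
    by (intro add_mono mult_left_mono) auto
  also have "\<dots> = M * ((2 * d + 1) * H ^ d * \<delta>) + y (Suc d)" by (simp add: algebra_simps)
  finally show ?thesis using sub by (rule card_subset_real_le) (use finQ in auto)
qed

end

section \<open>Coincidences of differences\<close>

lemma card_image_Sigma_le:
  assumes "finite A" "\<And>a. a \<in> A \<Longrightarrow> finite (S a)" "\<And>a. a \<in> A \<Longrightarrow> real (card (S a)) \<le> c"
    and "X \<subseteq> f ` (SIGMA a:A. S a)"
  shows "real (card X) \<le> real (card A) * c"
proof -
  have fin: "finite (SIGMA a:A. S a)" using assms by auto
  have "card X \<le> card (f ` (SIGMA a:A. S a))" by (rule card_mono[OF finite_imageI[OF fin] assms(4)])
  also have "\<dots> \<le> card (SIGMA a:A. S a)" by (rule card_image_le[OF fin])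
  also have "\<dots> = (\<Sum>a\<in>A. card (S a))" using assms by (intro card_SigmaI) auto
  finally have "real (card X) \<le> (\<Sum>a\<in>A. real (card (S a)))" by (metis of_nat_le_iff of_nat_sum)
  also have "\<dots> \<le> real (card A) * c" using assms(3) by (rule sum_bounded_above)
  finally show ?thesis .
qed

definition block :: "nat \<Rightarrow> nat set" where
  "block B = {p. prime p \<and> B < p \<and> p \<le> 2 * B}"

lemma finite_block [simp]: "finite (block B)"
  by (rule finite_subset[of _ "{..2 * B}"]) (auto simp: block_def)

lemma card_block_le: "card (block B) \<le> B"
proof -
  have "card (block B) \<le> card {B<..2 * B}" by (rule card_mono) (auto simp: block_def)
  then show ?thesis by simp
qed

definition coincidence_const :: "nat \<Rightarrow> real" where
  "coincidence_const d = 2 * (Suc d * (Suc d + 2)) + (6 * d + 2) + 3 * 2 ^ d"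

context shift_map_chain
begin

lemma card_prime_factors_le_H:
  assumes "n \<ge> 1" "n \<le> N" shows "real (card (prime_factors n)) \<le> H"
proof -
  have "2 ^ card (prime_factors n) \<le> (2::nat) ^ bigomega n"
    by (intro power_increasing card_prime_factors_le_bigomega) auto
  also have "\<dots> \<le> N" using two_power_bigomega_le[of n] assms by simp
  finally have "(2::real) ^ card (prime_factors n) \<le> real N"
    by (metis of_nat_le_iff of_nat_numeral of_nat_power)
  then have "ln ((2::real) ^ card (prime_factors n)) \<le> ln (real N)" using assms by (subst ln_le_cancel_iff) auto
  then have "real (card (prime_factors n)) * ln 2 \<le> ln (real N)" by (simp add: ln_realpow)
  moreover have "ln (real N) \<le> ln (real (2 * N + 1) + 1)" using assms by (subst ln_le_cancel_iff) auto
  moreover have "ln (real (2 * N + 1) + 1) \<le> H / 2" using harm_ge_ln[of "2 * N + 1"] by (simp add: H_def)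
  moreover have "real (card (prime_factors n)) * (1 / 2) \<le> real (card (prime_factors n)) * ln 2"
    using ln2_ge_two_thirds by (intro mult_left_mono) auto
  ultimately show ?thesis by linarith
qed

definition pair_diff :: "nat \<Rightarrow> nat \<Rightarrow> nat \<Rightarrow> int" where
  "pair_diff p q m = int ((F ^^ Suc d) (p * m)) - int ((F ^^ Suc d) (q * m))"

text \<open>
  These quadruples are what the mean squares of the correlations count, summed over the pairs of primes in a block.
\<close>
definition coincidences :: "nat \<Rightarrow> (nat \<times> nat \<times> nat \<times> nat) set" where
  "coincidences B = {(p, q, m, m'). p \<in> block B \<and> q \<in> block B \<and> p \<noteq> q \<and> 1 \<le> m \<and> 1 \<le> m' \<and>
     p * m \<le> N \<and> q * m \<le> N \<and> p * m' \<le> N \<and> q * m' \<le> N \<and> pair_diff p q m = pair_diff p q m'}"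

lemma card_block_without_chain_le:
  assumes "y d \<le> B" "2 * B \<le> N"
  shows "real (card {p \<in> block B. \<not> has_chain d p}) \<le> 2 * real B * (2 * real d * H ^ d * \<delta>)"
proof -
  let ?P = "{p \<in> block B. \<not> has_chain d p}"
  have "real (card ?P) = (\<Sum>p\<in>?P. 1)" by simp
  also have "\<dots> \<le> (\<Sum>p\<in>?P. 2 * B * (1 / p))"
    by (rule sum_mono) (auto simp: block_def field_simps)
  also have "\<dots> = 2 * B * (\<Sum>p\<in>?P. 1 / p)" by (simp add: sum_distrib_left)
  also have "\<dots> \<le> 2 * B * (\<Sum>p | prime p \<and> p \<le> N \<and> y d < p \<and> \<not> has_chain d p. 1 / p)"
    using assms by (intro mult_left_mono sum_mono2 finite_subset[of "{p. _ p}" "{..N}"]) (auto simp: block_def)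
  also have "\<dots> \<le> 2 * real B * (2 * real d * H ^ d * \<delta>)"
    using sum_primes_without_chain_le[of N d] d unfolding of_nat_mult of_nat_numeral
    by (intro mult_left_mono) auto
  finally show ?thesis .
qed

text \<open>
  The chain starts at the prime $q$ itself, and $m$ enters only through the cofactor.
\<close>
lemma card_equal_values_le:
  assumes m: "m \<ge> 1" and B: "2 * B \<le> N"
  shows "real (card {q \<in> block B. typical (Suc d) (q * m) \<and> has_chain d q \<and> (F ^^ Suc d) (q * m) = v})
    \<le> 2 ^ d * (2 * real B) / z * H ^ d" (is "real (card ?S) \<le> _")
proof (cases "v = 0")
  case True
  have "?S = {}" using m True F_iter_pos[of "_ * m" "Suc d"] by (force simp: block_def prime_gt_0_nat)
  then show ?thesis using H_ge_2 by (simp only: card.empty) simp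
next
  case False
  show ?thesis
  proof (rule card_fibre_le[where v = "int v" and g = "\<lambda>_ cs. int (cofactor cs m)", of "2 * B", simplified of_nat_mult of_nat_numeral])
    fix q assume q: "q \<in> ?S"
    then obtain cs r where cs: "length cs = d" "link cs q r" by (auto simp: has_chain_def)
    then have "(F ^^ Suc d) (q * m) = F r * cofactor cs m"
      using q m by (intro typical_link_cofactor) auto
    then show "\<exists>b cs q' r. b \<ge> 1 \<and> length cs = d \<and> q = q' * b \<and> link cs q' r \<and> int (F r) * int (cofactor cs m) = int v"
      using q cs by (intro exI[of _ 1] exI[of _ cs] exI[of _ q] exI[of _ r]) (auto simp flip: of_nat_mult)
  qed (use B False in \<open>auto simp: block_def prime_ge_1_nat\<close>)
qed

text \<open>
  The chain starts at a prime factor of $m$. It serves $p m$ and $q m$ simultaneously, so that $F(r)$ is a factor of the difference.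
\<close>
lemma card_equal_differences_le:
  assumes v: "v \<noteq> 0" and M: "M \<le> N" and pq: "p > 0" "q > 0"
  shows "real (card {m \<in> {1..M}. typical (Suc d) (p * m) \<and> typical (Suc d) (q * m) \<and>
      (\<exists>l. l dvd m \<and> has_chain d l) \<and> pair_diff p q m = v}) \<le> 2 ^ d * real M / z * H ^ d" (is "real (card ?S) \<le> _")
proof (rule card_fibre_le[where v = v and g = "\<lambda>b cs. int (cofactor cs (p * b)) - int (cofactor cs (q * b))"])
  fix m assume m: "m \<in> ?S"
  then obtain l b cs r where l: "m = l * b" "length cs = d" "link cs l r"
    by (auto simp: has_chain_def elim!: dvdE)
  then have b: "b > 0" using m by (cases "b = 0") auto
  have "(F ^^ Suc d) (l * (p * b)) = F r * cofactor cs (p * b)"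
    by (rule typical_link_cofactor) (use m l b pq in \<open>auto simp: mult_ac\<close>)
  moreover have "(F ^^ Suc d) (l * (q * b)) = F r * cofactor cs (q * b)"
    by (rule typical_link_cofactor) (use m l b pq in \<open>auto simp: mult_ac\<close>)
  moreover have "p * m = l * (p * b)" "q * m = l * (q * b)" using l by simp_all
  ultimately have "pair_diff p q m = int (F r) * (int (cofactor cs (p * b)) - int (cofactor cs (q * b)))"
    unfolding pair_diff_def by (simp only: of_nat_mult right_diff_distrib)
  then show "\<exists>b cs l r. b \<ge> 1 \<and> length cs = d \<and> m = l * b \<and> link cs l r \<and>
      int (F r) * (int (cofactor cs (p * b)) - int (cofactor cs (q * b))) = v"
    using m l b by (intro exI[of _ b] exI[of _ cs] exI[of _ l] exI[of _ r]) auto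
qed (use M v in auto)

text \<open>
  A coincidence $(p, q, m, m')$ is exceptional if $p m$ or $q m$ is not typical, or if $m$ or $q$ has no chain. Otherwise the
  difference vanishes, and then $p$, $m$, $m'$ leave few choices for $q$; or it does not, and then $p$, $q$, $m'$ leave few
  choices for $m$.
\<close>
lemma card_coincidences_le:
  assumes B: "y d \<le> B" "2 * B \<le> N" and By: "real (B * y (Suc d)) \<le> N * \<delta>"
  shows "real (card (coincidences B)) \<le> (real N)\<^sup>2 * (coincidence_const d * H ^ (2 * d + 3) * \<delta>)"
proof -
  define M where "M = N div B"
  define P where "P = block B"
  define J where "J = {1..M}"
  define Bad where "Bad = {n \<in> {1..N}. \<not> typical (Suc d) n}"
  define C where "C = {m \<in> J. \<not> (\<exists>q. q dvd m \<and> has_chain d q)}"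
  define E where "E = {p \<in> P. \<not> has_chain d p}"
  define S5 where "S5 = (\<lambda>(p, m, m'::nat). {q \<in> P. typical (Suc d) (q * m) \<and> has_chain d q \<and> (F ^^ Suc d) (q * m) = (F ^^ Suc d) (p * m)})"
  define S6 where "S6 = (\<lambda>(p, q, m'). if pair_diff p q m' = 0 then {} else {m \<in> J. typical (Suc d) (p * m) \<and> typical (Suc d) (q * m) \<and>
      (\<exists>l. l dvd m \<and> has_chain d l) \<and> pair_diff p q m = pair_diff p q m'})"
  define X1 where "X1 = (\<lambda>(n, p, q, m'). (p, q, n div p, m')) ` (SIGMA n:Bad. prime_factors n \<times> (P \<times> J))"
  define X2 where "X2 = (\<lambda>(n, q, p, m'). (p, q, n div q, m')) ` (SIGMA n:Bad. prime_factors n \<times> (P \<times> J))"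
  define X3 where "X3 = P \<times> P \<times> C \<times> J"
  define X4 where "X4 = P \<times> E \<times> J \<times> J"
  define X5 where "X5 = (\<lambda>((p, m, m'), q). (p, q, m, m')) ` (SIGMA t:P \<times> J \<times> J. S5 t)"
  define X6 where "X6 = (\<lambda>((p, q, m'), m). (p, q, m, m')) ` (SIGMA t:P \<times> P \<times> J. S6 t)"
  note defs = M_def P_def J_def Bad_def C_def E_def S5_def S6_def
  have B1: "B > 0" using B y_gt_1[of d] by simp
  have fin: "finite P" "finite J" "finite Bad" "finite C" "finite E" by (auto simp: defs)
  have fin56: "finite (S5 t)" "finite (S6 u)" for t u by (auto simp: defs case_prod_beta)
  have Jmem: "m \<in> J" if "p \<in> P" "1 \<le> m" "p * m \<le> N" for p m
  proof -
    have "m * B \<le> m * p" using that by (intro mult_left_mono) (auto simp: P_def block_def)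
    also have "\<dots> \<le> N" using that by (simp add: mult.commute)
    finally show ?thesis using that B1 by (simp add: J_def M_def less_eq_div_iff_mult_less_eq)
  qed
  have Ppos: "p > 0" if "p \<in> P" for p using that by (auto simp: P_def block_def)
  have MB: "real M * real B \<le> real N" unfolding M_def by (metis div_times_less_eq_dividend of_nat_le_iff of_nat_mult)
  have cP: "real (card P) \<le> B" using card_block_le[of B] by (simp add: P_def)
  have cJ: "card J = M" by (simp add: J_def)
  have M: "M \<le> N" by (simp add: M_def)
  \<comment> \<open>The six sets: \<open>p * m\<close> or \<open>q * m\<close> is not typical, \<open>m\<close> or \<open>q\<close> has no chain, the difference is zero, the difference
      is not zero. A non-typical product \<open>n\<close> leaves only the prime factors of \<open>n\<close> for \<open>p\<close> (or \<open>q\<close>).\<close>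
  have sub: "coincidences B \<subseteq> X1 \<union> (X2 \<union> (X3 \<union> (X4 \<union> (X5 \<union> X6))))"
  proof (rule subsetI, rule ccontr)
    fix t assume t: "t \<in> coincidences B" "t \<notin> X1 \<union> (X2 \<union> (X3 \<union> (X4 \<union> (X5 \<union> X6))))"
    obtain p q m m' where t_eq: "t = (p, q, m, m')" by (cases t)
    have c: "(p, q, m, m') \<in> coincidences B" and n6: "(p, q, m, m') \<notin> X6" and n5: "(p, q, m, m') \<notin> X5"
      and n4: "(p, q, m, m') \<notin> X4" and n3: "(p, q, m, m') \<notin> X3" and n2: "(p, q, m, m') \<notin> X2"
      and n1: "(p, q, m, m') \<notin> X1"
      using t unfolding t_eq by blast+
    have pq: "p \<in> P" "q \<in> P" and mm: "m \<in> J" "m' \<in> J" and mpos: "1 \<le> m" "1 \<le> m'"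
      and N: "p * m \<le> N" "q * m \<le> N" and eq: "pair_diff p q m = pair_diff p q m'"
      using c Jmem[of p m] Jmem[of p m'] by (auto simp: coincidences_def P_def)
    have pf: "p \<in> prime_factors (p * m)" "q \<in> prime_factors (q * m)"
      using pq mpos by (auto simp: P_def block_def prime_factors_dvd)
    have typ_p: "typical (Suc d) (p * m)"
    proof (rule ccontr)
      assume "\<not> ?thesis"
      then have "p * m \<in> Bad" using N pq mpos Ppos by (auto simp: Bad_def Suc_le_eq)
      then have "(p, q, m, m') \<in> X1"
        unfolding X1_def by (intro image_eqI[of _ _ "(p * m, p, q, m')"]) (use pf pq mm Ppos[OF pq(1)] in auto)
      with n1 show False ..
    qed
    have typ_q: "typical (Suc d) (q * m)"
    proof (rule ccontr)
      assume "\<not> ?thesis"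
      then have "q * m \<in> Bad" using N pq mpos Ppos by (auto simp: Bad_def Suc_le_eq)
      then have "(p, q, m, m') \<in> X2"
        unfolding X2_def by (intro image_eqI[of _ _ "(q * m, q, p, m')"]) (use pf pq mm Ppos[OF pq(2)] in auto)
      with n2 show False ..
    qed
    have chain_m: "\<exists>l. l dvd m \<and> has_chain d l" using n3 pq mm by (auto simp: X3_def C_def)
    have chain_q: "has_chain d q" using n4 pq mm by (auto simp: X4_def E_def)
    have nz: "pair_diff p q m' \<noteq> 0"
    proof
      assume "pair_diff p q m' = 0"
      then have "(F ^^ Suc d) (q * m) = (F ^^ Suc d) (p * m)" using eq by (simp add: pair_diff_def)
      then have "(p, q, m, m') \<in> X5" unfolding X5_def
        by (intro image_eqI[of _ _ "((p, m, m'), q)"]) (use pq mm typ_q chain_q in \<open>auto simp: S5_def\<close>)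
      with n5 show False ..
    qed
    have "(p, q, m, m') \<in> X6" unfolding X6_def using typ_p typ_q chain_m nz eq pq mm
      by (intro image_eqI[of _ _ "((p, q, m'), m)"]) (auto simp: S6_def)
    with n6 show False ..
  qed
  define h where "h = H ^ (2 * d + 3) * \<delta>"
  have h: "h \<ge> 0" using H_ge_2 \<delta>_pos by (simp add: h_def)
  have Hd: "H ^ e * \<delta> \<le> h" if "e \<le> 2 * d + 3" for e
    unfolding h_def using that H_ge_2 \<delta>_pos by (intro mult_right_mono power_increasing) auto
  have NN: "real B * real M * (real B * real M) \<le> (real N)\<^sup>2"
    using mult_mono[OF MB MB] by (simp add: power2_eq_square mult_ac)
  have bad: "real (card Bad) * (H * (real B * real M)) \<le> (real N)\<^sup>2 * (Suc d * (Suc d + 2) * h)"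
  proof -
    have "real (card Bad) * (H * (real B * real M)) \<le> (Suc d * (Suc d + 2) * N * H ^ (2 * Suc d) * \<delta>) * (H * real N)"
      using card_not_typical_le[of "Suc d"] d MB H_ge_2 \<delta>_pos unfolding Bad_def
      by (intro mult_mono) (auto simp: mult_ac)
    also have "\<dots> = (real N)\<^sup>2 * (Suc d * (Suc d + 2) * (H ^ (2 * d + 3) * \<delta>))"
      by (simp add: power2_eq_square power_add eval_nat_numeral algebra_simps)
    finally show ?thesis by (simp add: h_def)
  qed
  have cfac: "real (card (prime_factors n \<times> (P \<times> J))) \<le> H * (real B * real M)" if "n \<in> Bad" for n
    using card_prime_factors_le_H[of n] that cP H_ge_2 unfolding card_cartesian_product of_nat_mult cJ
    by (intro mult_mono) (auto simp: Bad_def)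
  have c1: "real (card X1) \<le> (real N)\<^sup>2 * (Suc d * (Suc d + 2) * h)"
  proof -
    have "real (card X1) \<le> real (card Bad) * (H * (real B * real M))"
      unfolding X1_def by (rule card_image_Sigma_le[OF fin(3) _ cfac order.refl]) (use fin in auto)
    then show ?thesis using bad by linarith
  qed
  have c2: "real (card X2) \<le> (real N)\<^sup>2 * (Suc d * (Suc d + 2) * h)"
  proof -
    have "real (card X2) \<le> real (card Bad) * (H * (real B * real M))"
      unfolding X2_def by (rule card_image_Sigma_le[OF fin(3) _ cfac order.refl]) (use fin in auto)
    then show ?thesis using bad by linarith
  qed
  have c3: "real (card X3) \<le> (real N)\<^sup>2 * ((2 * d + 2) * h)"
  proof -
    have "real (card X3) = real (card P) * real (card P) * real M * real (card C)"
      unfolding X3_def card_cartesian_product cJ by simp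
    also have "\<dots> \<le> real B * real B * real M * (real M * ((2 * d + 1) * H ^ d * \<delta>) + y (Suc d))"
      using card_without_chain_le[OF M] cP unfolding C_def J_def by (intro mult_mono) auto
    also have "\<dots> = (real B * real M * (real B * real M)) * ((2 * d + 1) * (H ^ d * \<delta>)) + (real M * real B) * real (B * y (Suc d))"
      by (simp add: algebra_simps)
    also have "\<dots> \<le> (real N)\<^sup>2 * ((2 * d + 1) * h) + real N * (N * h)"
      using NN Hd[of d] MB By Hd[of 0] mult_left_mono[of \<delta> h "real N"] \<delta>_pos h H_ge_2
      by (intro add_mono mult_mono) auto
    also have "\<dots> = (real N)\<^sup>2 * ((2 * d + 2) * h)" by (simp add: power2_eq_square algebra_simps)
    finally show ?thesis .
  qed
  have c4: "real (card X4) \<le> (real N)\<^sup>2 * (4 * d * h)"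
  proof -
    have "real (card X4) = real (card P) * real (card E) * real M * real M"
      unfolding X4_def card_cartesian_product cJ by simp
    also have "\<dots> \<le> real B * (2 * real B * (2 * real d * H ^ d * \<delta>)) * real M * real M"
      using card_block_without_chain_le[OF B] cP unfolding E_def P_def by (intro mult_mono) auto
    also have "\<dots> = (real B * real M * (real B * real M)) * (4 * d * (H ^ d * \<delta>))"
      by (simp add: algebra_simps)
    also have "\<dots> \<le> (real N)\<^sup>2 * (4 * d * h)"
      using NN Hd[of d] \<delta>_pos H_ge_2 by (intro mult_mono) auto
    finally show ?thesis .
  qed
  have zd: "H ^ d * (1 / z) \<le> h"
    using mult_left_mono[OF inverse_z_le, of "H ^ d"] Hd[of d] H_ge_2 by simp
  have c5: "real (card X5) \<le> (real N)\<^sup>2 * (2 * 2 ^ d * h)"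
  proof -
    have "real (card X5) \<le> real (card (P \<times> J \<times> J)) * (2 ^ d * (2 * real B) / z * H ^ d)"
      unfolding X5_def
    proof (rule card_image_Sigma_le[OF _ fin56(1) _ order.refl])
      fix t assume "t \<in> P \<times> J \<times> J"
      then show "real (card (S5 t)) \<le> 2 ^ d * (2 * real B) / z * H ^ d"
        using card_equal_values_le[OF _ B(2)] by (auto simp: S5_def P_def J_def)
    qed (use fin in auto)
    also have "\<dots> = (real (card P) * real M * real M) * (2 ^ d * (2 * real B) / z * H ^ d)"
      unfolding card_cartesian_product cJ by simp
    also have "\<dots> \<le> (real B * real M * real M) * (2 ^ d * (2 * real B) / z * H ^ d)"
      using cP H_ge_2 by (intro mult_right_mono) auto
    also have "\<dots> = (real B * real M * (real B * real M)) * (2 * 2 ^ d * (H ^ d * (1 / z)))"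
      by (simp add: algebra_simps)
    also have "\<dots> \<le> (real N)\<^sup>2 * (2 * 2 ^ d * h)"
      using NN zd H_ge_2 by (intro mult_mono) auto
    finally show ?thesis .
  qed
  have c6: "real (card X6) \<le> (real N)\<^sup>2 * (2 ^ d * h)"
  proof -
    have "real (card X6) \<le> real (card (P \<times> P \<times> J)) * (2 ^ d * real M / z * H ^ d)"
      unfolding X6_def
    proof (rule card_image_Sigma_le[OF _ fin56(2) _ order.refl])
      fix t assume t: "t \<in> P \<times> P \<times> J"
      obtain p q m' where t': "t = (p, q, m')" by (cases t)
      show "real (card (S6 t)) \<le> 2 ^ d * real M / z * H ^ d"
        using card_equal_differences_le[OF _ M, of "pair_diff p q m'" p q] t t' Ppos H_ge_2
        by (auto simp: S6_def J_def)
    qed (use fin in auto)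
    also have "\<dots> = (real (card P) * real (card P) * real M) * (2 ^ d * real M / z * H ^ d)"
      unfolding card_cartesian_product cJ by simp
    also have "\<dots> \<le> (real B * real B * real M) * (2 ^ d * real M / z * H ^ d)"
      using cP H_ge_2 by (intro mult_right_mono mult_mono) auto
    also have "\<dots> = (real B * real M * (real B * real M)) * (2 ^ d * (H ^ d * (1 / z)))"
      by (simp add: algebra_simps)
    also have "\<dots> \<le> (real N)\<^sup>2 * (2 ^ d * h)"
      using NN zd H_ge_2 by (intro mult_mono) auto
    finally show ?thesis .
  qed
  have finX: "finite (X1 \<union> (X2 \<union> (X3 \<union> (X4 \<union> (X5 \<union> X6)))))"
    using fin fin56 unfolding X1_def X2_def X3_def X4_def X5_def X6_def by auto
  have "card (X1 \<union> (X2 \<union> (X3 \<union> (X4 \<union> (X5 \<union> X6))))) \<le> card X1 + (card X2 + (card X3 + (card X4 + (card X5 + card X6))))"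
    by (intro order.trans[OF card_Un_le] add_left_mono card_Un_le)
  then have "card (coincidences B) \<le> card X1 + (card X2 + (card X3 + (card X4 + (card X5 + card X6))))"
    using card_mono[OF finX sub] by linarith
  then have "real (card (coincidences B)) \<le> real (card X1) + (real (card X2) + (real (card X3) + (real (card X4) + (real (card X5) + real (card X6)))))"
    by (simp only: of_nat_add[symmetric] of_nat_le_iff)
  also have "\<dots> \<le> (real N)\<^sup>2 * (Suc d * (Suc d + 2) * h) + ((real N)\<^sup>2 * (Suc d * (Suc d + 2) * h) + ((real N)\<^sup>2 * ((2 * d + 2) * h) +
      ((real N)\<^sup>2 * (4 * d * h) + ((real N)\<^sup>2 * (2 * 2 ^ d * h) + (real N)\<^sup>2 * (2 ^ d * h)))))"
    by (intro add_mono c1 c2 c3 c4 c5 c6)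
  also have "\<dots> = (real N)\<^sup>2 * (coincidence_const d * h)"
    by (simp add: coincidence_const_def algebra_simps)
  finally show ?thesis by (simp add: h_def mult_ac)
qed

end

section \<open>From mean values to correlations\<close>

lemma norm_M1: "f \<in> M1 \<Longrightarrow> n > 0 \<Longrightarrow> norm (f n) = 1"
  by (simp add: M1_def)

lemma M1_mult: "f \<in> M1 \<Longrightarrow> m > 0 \<Longrightarrow> n > 0 \<Longrightarrow> coprime m n \<Longrightarrow> f (m * n) = f m * f n"
  by (simp add: M1_def multiplicative_def)

lemma sum_card_divisors_swap:
  fixes P :: "nat set" and N :: nat
  assumes "finite P"
  shows "(\<Sum>n=1..N. \<Sum>p | p \<in> P \<and> p dvd n. h p n) = (\<Sum>p\<in>P. \<Sum>n | n \<in> {1..N} \<and> p dvd n. h p n)"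
  by (rule sum.swap_restrict[OF finite_atLeastAtMost assms])

text \<open>
  By the first two moments. The hypothesis on the size of $P$ makes the rounding errors in the
  first moment negligible, and in the second moment they have the favourable sign.
\<close>
lemma turan_kubilius:
  fixes P :: "nat set"
  defines "L \<equiv> (\<Sum>p\<in>P. 1 / real p)"
  assumes P: "finite P" "\<And>p. p \<in> P \<Longrightarrow> prime p" and card: "card P \<le> N"
  shows "(\<Sum>n=1..N. (real (card {p \<in> P. p dvd n}) - L)\<^sup>2) \<le> 3 * real N * L"
proof -
  define w where "w = (\<lambda>n. real (card {p \<in> P. p dvd n}))"
  have L: "L \<ge> 0" unfolding L_def by (intro sum_nonneg) auto
  have pos: "p > 0" if "p \<in> P" for p using P(2)[OF that] prime_gt_0_nat by auto
  have w_eq: "w n = (\<Sum>p | p \<in> P \<and> p dvd n. 1)" for n by (simp add: w_def)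
  have mean: "(\<Sum>n=1..N. w n) \<ge> N * L - card P"
  proof -
    have "(\<Sum>n=1..N. w n) = (\<Sum>p\<in>P. real (N div p))"
      unfolding w_eq sum_card_divisors_swap[OF P(1)]
      using card_multiples_eq[OF pos, of _ N] by (intro sum.cong) auto
    also have "\<dots> \<ge> (\<Sum>p\<in>P. N / p - 1)"
    proof (rule sum_mono)
      fix p assume p: "p \<in> P"
      then have "N < p + p * (N div p)" using pos by (intro dividend_less_times_div)
      then have "real N < real p * (1 + real (N div p))" by (metis of_nat_less_iff of_nat_mult of_nat_1 of_nat_add distrib_left mult.right_neutral)
      then show "N / p - 1 \<le> real (N div p)" using pos[OF p] by (simp add: field_simps)
    qed
    also have "(\<Sum>p\<in>P. N / p - 1) = N * L - card P"
      by (simp add: sum_subtractf L_def sum_distrib_left)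
    finally show ?thesis .
  qed
  have second: "(\<Sum>n=1..N. (w n)\<^sup>2) \<le> N * L\<^sup>2 + N * L"
  proof -
    have "(\<Sum>n=1..N. (w n)\<^sup>2) = (\<Sum>n=1..N. \<Sum>p | p \<in> P \<and> p dvd n. w n)"
      by (simp add: w_def power2_eq_square)
    also have "\<dots> = (\<Sum>p\<in>P. \<Sum>n | n \<in> {1..N} \<and> p dvd n. w n)"
      by (rule sum_card_divisors_swap[OF P(1)])
    also have "\<dots> \<le> (\<Sum>p\<in>P. \<Sum>q\<in>P. N / (real p * real q) + (if q = p then N / p else 0))"
    proof (rule sum_mono)
      fix p assume p: "p \<in> P"
      have "(\<Sum>n | n \<in> {1..N} \<and> p dvd n. w n) = (\<Sum>n | n \<in> {1..N} \<and> p dvd n. \<Sum>q | q \<in> P \<and> q dvd n. 1)"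
        by (simp only: w_eq)
      also have "\<dots> = (\<Sum>q\<in>P. \<Sum>n | n \<in> {n. n \<in> {1..N} \<and> p dvd n} \<and> q dvd n. 1)"
        using P(1) by (intro sum.swap_restrict) auto
      also have "\<dots> = (\<Sum>q\<in>P. real (card {n \<in> {1..N}. p dvd n \<and> q dvd n}))"
        by (simp add: conj_assoc)
      also have "\<dots> \<le> (\<Sum>q\<in>P. N / (real p * real q) + (if q = p then N / p else 0))"
      proof (rule sum_mono)
        fix q assume q: "q \<in> P"
        show "real (card {n \<in> {1..N}. p dvd n \<and> q dvd n}) \<le> N / (real p * real q) + (if q = p then N / p else 0)"
        proof (cases "q = p")
          case True
          have "real (card {n \<in> {1..N}. p dvd n}) \<le> N / p" using pos[OF p] by (intro card_multiples_le) auto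
          then show ?thesis using True by (simp add: add_increasing)
        next
          case False
          then have "coprime p q" using P(2) p q by (intro primes_coprime) auto
          then have "{n \<in> {1..N}. p dvd n \<and> q dvd n} \<subseteq> {n \<in> {1..N}. p * q dvd n}" by (auto intro: divides_mult)
          then have "card {n \<in> {1..N}. p dvd n \<and> q dvd n} \<le> card {n \<in> {1..N}. p * q dvd n}" by (intro card_mono) auto
          also have "real (card {n \<in> {1..N}. p * q dvd n}) \<le> N / real (p * q)"
            using pos[OF p] pos[OF q] by (intro card_multiples_le) (simp add: Suc_le_eq)
          finally show ?thesis using False by simp
        qed
      qed
      finally show "(\<Sum>n | n \<in> {1..N} \<and> p dvd n. w n) \<le> (\<Sum>q\<in>P. N / (real p * real q) + (if q = p then N / p else 0))" .
    qed
    also have "\<dots> = (\<Sum>p\<in>P. \<Sum>q\<in>P. N / (real p * real q)) + (\<Sum>p\<in>P. N / p)"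
      using P(1) by (simp add: sum.distrib)
    also have "(\<Sum>p\<in>P. \<Sum>q\<in>P. N / (real p * real q)) = N * L\<^sup>2"
      unfolding L_def power2_eq_square sum_product by (simp add: sum_distrib_left)
    also have "(\<Sum>p\<in>P. N / p) = N * L" by (simp add: L_def sum_distrib_left)
    finally show ?thesis .
  qed
  have "(\<Sum>n=1..N. (w n - L)\<^sup>2) = (\<Sum>n=1..N. (w n)\<^sup>2 - 2 * L * w n + L\<^sup>2)"
    by (intro sum.cong) (auto simp: power2_eq_square algebra_simps)
  also have "\<dots> = (\<Sum>n=1..N. (w n)\<^sup>2) - 2 * L * (\<Sum>n=1..N. w n) + N * L\<^sup>2"
    by (simp add: sum.distrib sum_subtractf sum_distrib_left)
  also have "\<dots> \<le> (N * L\<^sup>2 + N * L) - 2 * L * (N * L - card P) + N * L\<^sup>2"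
    using second mult_left_mono[OF mean, of "2 * L"] L by linarith
  also have "\<dots> = N * L + 2 * L * card P" by (simp add: power2_eq_square algebra_simps)
  also have "\<dots> \<le> N * L + 2 * L * N" using card L by (intro add_left_mono mult_left_mono) auto
  also have "\<dots> = 3 * real N * L" by simp
  finally show ?thesis by (simp add: w_def)
qed

definition correlation :: "(nat \<Rightarrow> complex) \<Rightarrow> nat \<Rightarrow> nat \<Rightarrow> nat \<Rightarrow> complex" where
  "correlation a N p q = (\<Sum>m | 1 \<le> m \<and> p * m \<le> N \<and> q * m \<le> N. a (p * m) * cnj (a (q * m)))"

definition correlation_energy :: "(nat \<Rightarrow> complex) \<Rightarrow> nat \<Rightarrow> nat \<Rightarrow> real" where
  "correlation_energy a N B = (\<Sum>(p, q) | p \<in> block B \<and> q \<in> block B \<and> p \<noteq> q. (norm (correlation a N p q))\<^sup>2)"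

lemma correlation_energy_nonneg: "correlation_energy a N B \<ge> 0"
  unfolding correlation_energy_def by (intro sum_nonneg) auto

lemma cauchy_schwarz_count:
  fixes f :: "'a \<Rightarrow> real"
  shows "(\<Sum>x\<in>A. f x)\<^sup>2 \<le> card A * (\<Sum>x\<in>A. (f x)\<^sup>2)"
  using Cauchy_Schwarz_ineq_sum[of "\<lambda>_. 1" f A] by simp

text \<open>
  Cauchy-Schwarz in $m$. All $p$ in the block have the same size up to a factor $2$, so $m$ runs up to about $N / B$ for each of them and
  the diagonal terms $p = q$ contribute only $N^2 / B$ to the square.
\<close>
lemma block_bilinear_le:
  assumes f: "f \<in> M1" and a: "\<And>n. norm (a n) \<le> 1" and B: "B > 0"
  shows "norm (\<Sum>p\<in>block B. f p * (\<Sum>m\<in>{1..N div p}. f m * a (p * m)))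
    \<le> real N / sqrt B + sqrt (real N * sqrt (correlation_energy a N B))"
proof -
  define M where "M = N div B"
  define P where "P = block B"
  define U where "U = correlation_energy a N B"
  define c where "c = (\<lambda>p m. if p * m \<le> N then a (p * m) else 0)"
  define t where "t = (\<lambda>m. \<Sum>p\<in>P. f p * c p m)"
  have P: "finite P" "real (card P) \<le> B" using card_block_le[of B] by (auto simp: P_def)
  have pos: "p > 0" if "p \<in> P" for p using that by (auto simp: P_def block_def prime_gt_0_nat)
  have MB: "real B * real M \<le> real N" unfolding M_def by (metis times_div_less_eq_dividend of_nat_le_iff of_nat_mult)
  have Jmem: "m \<le> M" if "p \<in> P" "p * m \<le> N" for p m
  proof -
    have "m * B \<le> m * p" using that by (intro mult_left_mono) (auto simp: P_def block_def)
    also have "\<dots> \<le> N" using that by (simp add: mult.commute)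
    finally show ?thesis using that B by (simp add: M_def less_eq_div_iff_mult_less_eq)
  qed
  have inner: "(\<Sum>m\<in>{1..N div p}. f m * a (p * m)) = (\<Sum>m=1..M. f m * c p m)" if p: "p \<in> P" for p
  proof (rule sum.mono_neutral_cong_left)
    show "{1..N div p} \<subseteq> {1..M}" using Jmem[OF p] pos[OF p] by (auto simp: less_eq_div_iff_mult_less_eq mult.commute)
  qed (use pos[OF p] in \<open>auto simp: c_def less_eq_div_iff_mult_less_eq mult.commute\<close>)
  have "(\<Sum>p\<in>P. f p * (\<Sum>m\<in>{1..N div p}. f m * a (p * m))) = (\<Sum>p\<in>P. \<Sum>m=1..M. f m * (f p * c p m))"
    by (intro sum.cong refl) (simp only: inner sum_distrib_left mult.left_commute)
  also have "\<dots> = (\<Sum>m=1..M. f m * t m)"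
    by (subst sum.swap) (simp add: t_def sum_distrib_left)
  finally have S_eq: "(\<Sum>p\<in>P. f p * (\<Sum>m\<in>{1..N div p}. f m * a (p * m))) = (\<Sum>m=1..M. f m * t m)" .
  have "norm (\<Sum>m=1..M. f m * t m) \<le> (\<Sum>m=1..M. norm (t m))"
    by (rule order.trans[OF norm_sum], rule sum_mono) (auto simp: norm_mult norm_M1[OF f])
  then have "(norm (\<Sum>m=1..M. f m * t m))\<^sup>2 \<le> (\<Sum>m=1..M. norm (t m))\<^sup>2" by (intro power_mono) auto
  also have "\<dots> \<le> M * (\<Sum>m=1..M. (norm (t m))\<^sup>2)"
    using cauchy_schwarz_count[of "\<lambda>m. norm (t m)" "{1..M}"] by simp
  also have "\<dots> \<le> M * (real N + B * sqrt U)"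
  proof (rule mult_left_mono)
    have corr: "(\<Sum>m=1..M. c p m * cnj (c q m)) = correlation a N p q" if "p \<in> P" "q \<in> P" for p q
      unfolding correlation_def
    proof (rule sum.mono_neutral_cong_right)
      show "{m. 1 \<le> m \<and> p * m \<le> N \<and> q * m \<le> N} \<subseteq> {1..M}" using Jmem[OF that(1)] by auto
    qed (auto simp: c_def)
    have "complex_of_real (\<Sum>m=1..M. (norm (t m))\<^sup>2) = (\<Sum>m=1..M. t m * cnj (t m))"
      by (simp only: of_real_sum complex_norm_square)
    also have "\<dots> = (\<Sum>m=1..M. \<Sum>p\<in>P. \<Sum>q\<in>P. (f p * cnj (f q)) * (c p m * cnj (c q m)))"
      unfolding t_def by (simp add: sum_product mult_ac)
    also have "\<dots> = (\<Sum>p\<in>P. \<Sum>m=1..M. \<Sum>q\<in>P. (f p * cnj (f q)) * (c p m * cnj (c q m)))"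
      by (rule sum.swap)
    also have "\<dots> = (\<Sum>p\<in>P. \<Sum>q\<in>P. \<Sum>m=1..M. (f p * cnj (f q)) * (c p m * cnj (c q m)))"
      by (intro sum.cong refl sum.swap)
    also have "\<dots> = (\<Sum>p\<in>P. \<Sum>q\<in>P. (f p * cnj (f q)) * correlation a N p q)"
      by (intro sum.cong refl) (simp only: sum_distrib_left[symmetric] corr)
    finally have eq: "complex_of_real (\<Sum>m=1..M. (norm (t m))\<^sup>2) = (\<Sum>p\<in>P. \<Sum>q\<in>P. (f p * cnj (f q)) * correlation a N p q)" .
    have "(\<Sum>m=1..M. (norm (t m))\<^sup>2) = norm (complex_of_real (\<Sum>m=1..M. (norm (t m))\<^sup>2))"
      unfolding norm_of_real by (intro abs_of_nonneg[symmetric] sum_nonneg) auto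
    also have "\<dots> = norm (\<Sum>p\<in>P. \<Sum>q\<in>P. (f p * cnj (f q)) * correlation a N p q)"
      by (simp only: eq)
    also have "\<dots> \<le> (\<Sum>p\<in>P. \<Sum>q\<in>P. norm (correlation a N p q))"
      using pos by (intro order.trans[OF norm_sum] sum_mono order.trans[OF norm_sum])
        (auto simp: norm_mult norm_M1[OF f])
    also have "\<dots> = (\<Sum>(p, q)\<in>P \<times> P. norm (correlation a N p q))"
      by (simp add: sum.cartesian_product)
    also have "P \<times> P = (\<lambda>p. (p, p)) ` P \<union> {(p, q). p \<in> P \<and> q \<in> P \<and> p \<noteq> q}" by auto
    also have "(\<Sum>(p, q)\<in>\<dots>. norm (correlation a N p q)) =
        (\<Sum>(p, q)\<in>(\<lambda>p. (p, p)) ` P. norm (correlation a N p q)) + (\<Sum>(p, q) | p \<in> P \<and> q \<in> P \<and> p \<noteq> q. norm (correlation a N p q))"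
      using P(1) by (intro sum.union_disjoint finite_subset[of "{(p, q). p \<in> P \<and> q \<in> P \<and> p \<noteq> q}" "P \<times> P"]) auto
    also have "(\<Sum>(p, q)\<in>(\<lambda>p. (p, p)) ` P. norm (correlation a N p q)) = (\<Sum>p\<in>P. norm (correlation a N p p))"
      by (subst sum.reindex) (auto simp: inj_on_def)
    also have "\<dots> \<le> real N"
    proof -
      have "(\<Sum>p\<in>P. norm (correlation a N p p)) \<le> (\<Sum>p\<in>P. real M)"
      proof (rule sum_mono)
        fix p assume p: "p \<in> P"
        have "norm (correlation a N p p) \<le> (\<Sum>m=1..M. norm (c p m * cnj (c p m)))"
          unfolding corr[OF p p, symmetric] by (rule norm_sum)
        also have "\<dots> \<le> (\<Sum>m=1..M. 1)"
          using a by (intro sum_mono) (auto simp: c_def norm_mult intro!: mult_le_one)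
        finally show "norm (correlation a N p p) \<le> real M" by simp
      qed
      also have "\<dots> \<le> real B * real M" using P(2) by (simp add: mult_right_mono)
      finally show ?thesis using MB by simp
    qed
    also have "(\<Sum>(p, q) | p \<in> P \<and> q \<in> P \<and> p \<noteq> q. norm (correlation a N p q)) \<le> B * sqrt U"
    proof -
      let ?D = "{(p, q). p \<in> P \<and> q \<in> P \<and> p \<noteq> q}"
      have "card ?D \<le> card (P \<times> P)" using P(1) by (intro card_mono) auto
      then have "real (card ?D) \<le> real (card P) * real (card P)" by (simp only: card_cartesian_product of_nat_mult[symmetric] of_nat_le_iff)
      also have "\<dots> \<le> real B * real B" using P(2) by (intro mult_mono) auto
      finally have D: "real (card ?D) \<le> (real B)\<^sup>2" by (simp add: power2_eq_square)
      have "(\<Sum>(p, q)\<in>?D. norm (correlation a N p q))\<^sup>2 \<le> card ?D * (\<Sum>(p, q)\<in>?D. (norm (correlation a N p q))\<^sup>2)"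
        using cauchy_schwarz_count[of "\<lambda>(p, q). norm (correlation a N p q)" ?D] by (simp add: case_prod_beta)
      also have "\<dots> \<le> (real B)\<^sup>2 * U"
        using D unfolding U_def correlation_energy_def P_def[symmetric] by (intro mult_right_mono sum_nonneg) auto
      finally have "sqrt ((\<Sum>(p, q)\<in>?D. norm (correlation a N p q))\<^sup>2) \<le> sqrt ((real B)\<^sup>2 * U)" by (rule real_sqrt_le_mono)
      then show ?thesis by (simp add: real_sqrt_mult sum_nonneg case_prod_beta)
    qed
    finally show "(\<Sum>m=1..M. (norm (t m))\<^sup>2) \<le> real N + B * sqrt U" by simp
  qed simp
  also have "\<dots> = real M * real N + (real B * real M) * sqrt U" by (simp add: algebra_simps)
  also have "\<dots> \<le> (real N)\<^sup>2 / B + real N * sqrt U"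
  proof (intro add_mono mult_right_mono MB)
    have "real M \<le> real N / B" using MB B by (simp add: field_simps)
    then have "real M * real N \<le> real N / B * real N" by (rule mult_right_mono) simp
    then show "real M * real N \<le> (real N)\<^sup>2 / B" by (simp add: power2_eq_square)
  qed (simp add: U_def correlation_energy_nonneg)
  finally have "sqrt ((norm (\<Sum>m=1..M. f m * t m))\<^sup>2) \<le> sqrt ((real N)\<^sup>2 / B + real N * sqrt U)"
    by (rule real_sqrt_le_mono)
  also have "\<dots> \<le> sqrt ((real N)\<^sup>2 / B) + sqrt (real N * sqrt U)"
    by (intro sqrt_add_le_add_sqrt) (auto simp: U_def correlation_energy_nonneg)
  finally show ?thesis using S_eq by (simp add: P_def U_def real_sqrt_divide)
qed

text \<open>
  Multiplicativity fails only for the multiples $m$ of $p$.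
\<close>
lemma mult_approx:
  assumes f: "f \<in> M1" and p: "prime p" and a: "\<And>n. norm (a n) \<le> 1"
  shows "norm ((\<Sum>m\<in>{1..N div p}. f (p * m) * a (p * m)) - f p * (\<Sum>m\<in>{1..N div p}. f m * a (p * m))) \<le> 2 * real N * (1 / (real p)\<^sup>2)"
proof -
  have p0: "p > 0" using p by (rule prime_gt_0_nat)
  have "(\<Sum>m\<in>{1..N div p}. f (p * m) * a (p * m)) - f p * (\<Sum>m\<in>{1..N div p}. f m * a (p * m)) =
      (\<Sum>m\<in>{1..N div p}. (f (p * m) - f p * f m) * a (p * m))"
    unfolding sum_distrib_left sum_subtractf[symmetric] by (intro sum.cong refl) (simp add: algebra_simps)
  also have "norm \<dots> \<le> (\<Sum>m\<in>{1..N div p}. if p dvd m then 2 else 0)"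
  proof (rule order.trans[OF norm_sum], rule sum_mono)
    fix m assume m: "m \<in> {1..N div p}"
    show "norm ((f (p * m) - f p * f m) * a (p * m)) \<le> (if p dvd m then 2 else 0)"
    proof (cases "p dvd m")
      case True
      have "norm ((f (p * m) - f p * f m) * a (p * m)) \<le> norm (f (p * m) - f p * f m) * 1"
        unfolding norm_mult by (intro mult_left_mono a) auto
      also have "\<dots> \<le> norm (f (p * m)) + norm (f p * f m)" using norm_triangle_ineq4 by simp
      also have "\<dots> = 2" using norm_M1[OF f] p0 m by (simp add: norm_mult)
      finally show ?thesis using True by simp
    next
      case False
      then have "coprime p m" using p by (intro prime_imp_coprime)
      then have "f (p * m) = f p * f m" using M1_mult[OF f p0] m by simp
      then show ?thesis by simp
    qed
  qed
  also have "\<dots> = 2 * real (card {m \<in> {1..N div p}. p dvd m})"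
    by (simp add: sum.inter_filter[symmetric])
  also have "\<dots> \<le> 2 * (real (N div p) / real p)"
    using p0 by (intro mult_left_mono card_multiples_le) auto
  also have "\<dots> \<le> 2 * (real N / real p / real p)"
    by (intro mult_left_mono divide_right_mono) (auto simp: of_nat_div_le_of_nat)
  finally show ?thesis by (simp add: power2_eq_square)
qed

lemma sum_sqrt_powers_le: "(\<Sum>i\<in>{i0..<i1}. 1 / sqrt (2 ^ i)) \<le> 4"
proof -
  \<comment> \<open>A rational ratio above \<open>1 / sqrt 2\<close>, as \<open>1 / 2 \<le> (3 / 4)\<^sup>2\<close>.\<close>
  have "(\<Sum>i\<in>{i0..<i1}. 1 / sqrt (2 ^ i)) \<le> (\<Sum>i\<in>{i0..<i1}. (3 / 4) ^ i)"
  proof (rule sum_mono)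
    fix i
    have "1 / sqrt (2 ^ i) = sqrt ((1 / 2) ^ i)" by (simp add: real_sqrt_divide power_one_over)
    also have "\<dots> \<le> sqrt (((3 / 4) ^ 2) ^ i)" by (intro real_sqrt_le_mono power_mono) (auto simp: power2_eq_square)
    also have "\<dots> = (3 / 4) ^ i" unfolding power_mult[symmetric] mult.commute[of 2] unfolding power_mult by simp
    finally show "1 / sqrt (2 ^ i) \<le> (3 / 4) ^ i" .
  qed
  also have "\<dots> \<le> (\<Sum>i<i1. (3 / 4) ^ i)" by (intro sum_mono2) auto
  also have "\<dots> \<le> 4" by (simp add: geometric_sum)
  finally show ?thesis .
qed

definition window :: "nat \<Rightarrow> nat \<Rightarrow> nat set" where
  "window i0 i1 = {p. prime p \<and> 2 ^ i0 < p \<and> p \<le> 2 ^ i1}"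

lemma window_eq_UN: "window i0 i1 = (\<Union>i\<in>{i0..<i1}. block (2 ^ i))"
proof (induction i1)
  case 0
  then show ?case by (auto simp: window_def dest: prime_gt_1_nat)
next
  case (Suc i1)
  show ?case
  proof (cases "i0 \<le> i1")
    case True
    then have le: "(2::nat) ^ i0 \<le> 2 ^ i1" by (intro power_increasing) auto
    then have "window i0 (Suc i1) = window i0 i1 \<union> block (2 ^ i1)"
      by (auto simp: window_def block_def intro!: le_less_trans[OF le])
    then show ?thesis using Suc True by (auto simp: atLeastLessThanSuc)
  next
    case False
    then have "(2::nat) ^ Suc i1 \<le> 2 ^ i0" by (intro power_increasing) auto
    then show ?thesis using False by (auto simp: window_def)
  qed
qed

lemma finite_window [simp]: "finite (window i0 i1)"
  by (auto simp: window_eq_UN)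

lemma block_disjoint: "i < j \<Longrightarrow> block (2 ^ i) \<inter> block (2 ^ j) = {}"
  using power_increasing[of "Suc i" j "2::nat"] by (auto simp: block_def)

lemma sum_window: "(\<Sum>p\<in>window i0 i1. h p) = (\<Sum>i\<in>{i0..<i1}. \<Sum>p\<in>block (2 ^ i). h p)"
  unfolding window_eq_UN
  by (rule sum.UNION_disjoint) (auto, metis block_disjoint disjoint_iff linorder_neqE_nat)

text \<open>
  The Turan-Kubilius inequality over the window, followed by the bilinear estimate on each dyadic block.
\<close>
theorem mean_le_correlations:
  fixes a :: "nat \<Rightarrow> complex" and i0 i1 N :: nat
  defines "L \<equiv> (\<Sum>p\<in>window i0 i1. 1 / real p)"
    and "G \<equiv> (\<Sum>i\<in>{i0..<i1}. correlation_energy a N (2 ^ i)) / (real N)\<^sup>2"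
  assumes f: "f \<in> M1" and a: "\<And>n. norm (a n) \<le> 1" and N: "2 ^ i1 \<le> N"
  shows "L * norm (\<Sum>n=1..N. f n * a n) \<le> N * (sqrt (3 * L) + 6 + i1 * sqrt (sqrt G))"
proof -
  define P where "P = window i0 i1"
  define w where "w = (\<lambda>n. real (card {p \<in> P. p dvd n}))"
  have P: "finite P" "\<And>p. p \<in> P \<Longrightarrow> prime p" by (auto simp: P_def, auto simp: window_def)
  have L: "L \<ge> 0" unfolding L_def by (intro sum_nonneg) auto
  have "card P \<le> card {1..2 ^ i1 :: nat}" by (intro card_mono) (auto simp: P_def window_def prime_ge_1_nat)
  then have cP: "card P \<le> N" using N by simp
  have N0: "N > 0" using N by (cases N) auto
  have G: "G \<ge> 0" unfolding G_def by (intro divide_nonneg_nonneg sum_nonneg correlation_energy_nonneg) auto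
  have tk: "norm (\<Sum>n=1..N. complex_of_real (w n - L) * (f n * a n)) \<le> N * sqrt (3 * L)"
  proof -
    have "norm (\<Sum>n=1..N. complex_of_real (w n - L) * (f n * a n)) \<le> (\<Sum>n=1..N. \<bar>w n - L\<bar>)"
    proof (rule order.trans[OF norm_sum], rule sum_mono)
      fix n assume n: "n \<in> {1..N}"
      have "norm (complex_of_real (w n - L) * (f n * a n)) = \<bar>w n - L\<bar> * (norm (f n) * norm (a n))"
        by (simp only: norm_mult norm_of_real)
      also have "\<dots> \<le> \<bar>w n - L\<bar> * (1 * 1)"
        using norm_M1[OF f, of n] n a by (intro mult_left_mono mult_mono) auto
      finally show "norm (complex_of_real (w n - L) * (f n * a n)) \<le> \<bar>w n - L\<bar>" by simp
    qed
    also have "\<dots> = sqrt ((\<Sum>n=1..N. \<bar>w n - L\<bar>)\<^sup>2)" by (simp add: sum_nonneg)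
    also have "\<dots> \<le> sqrt (real N * (\<Sum>n=1..N. (w n - L)\<^sup>2))"
      using cauchy_schwarz_count[of "\<lambda>n. \<bar>w n - L\<bar>" "{1..N}"] by (intro real_sqrt_le_mono) simp
    also have "\<dots> \<le> sqrt (real N * (3 * real N * L))"
      using turan_kubilius[OF P cP] unfolding w_def L_def P_def by (intro real_sqrt_le_mono mult_left_mono) auto
    also have "\<dots> = sqrt ((real N)\<^sup>2 * (3 * L))" by (simp add: power2_eq_square mult_ac)
    also have "\<dots> = N * sqrt (3 * L)" by (simp add: real_sqrt_mult)
    finally show ?thesis .
  qed
  have bil: "norm (\<Sum>n=1..N. complex_of_real (w n) * (f n * a n)) \<le> N * (6 + i1 * sqrt (sqrt G))"
  proof -
    define X where "X = (\<lambda>p. \<Sum>m\<in>{1..N div p}. f (p * m) * a (p * m))"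
    define Y where "Y = (\<lambda>p. f p * (\<Sum>m\<in>{1..N div p}. f m * a (p * m)))"
    have "(\<Sum>n=1..N. complex_of_real (w n) * (f n * a n)) = (\<Sum>n=1..N. \<Sum>p | p \<in> P \<and> p dvd n. f n * a n)"
      by (simp add: w_def)
    also have "\<dots> = (\<Sum>p\<in>P. \<Sum>n | n \<in> {1..N} \<and> p dvd n. f n * a n)"
      by (rule sum_card_divisors_swap[OF P(1)])
    also have "\<dots> = (\<Sum>p\<in>P. X p)"
      unfolding X_def using P(2) by (intro sum.cong refl sum_multiples_reindex) (auto simp: prime_gt_0_nat)
    also have "\<dots> = (\<Sum>p\<in>P. X p - Y p) + (\<Sum>p\<in>P. Y p)" by (simp add: sum_subtractf)
    also have "norm \<dots> \<le> norm (\<Sum>p\<in>P. X p - Y p) + norm (\<Sum>p\<in>P. Y p)" by (rule norm_triangle_ineq)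
    also have "norm (\<Sum>p\<in>P. X p - Y p) \<le> 2 * real N"
    proof -
      have "norm (\<Sum>p\<in>P. X p - Y p) \<le> (\<Sum>p\<in>P. 2 * real N * (1 / (real p)\<^sup>2))"
        unfolding X_def Y_def using P(2) by (intro order.trans[OF norm_sum] sum_mono mult_approx f a) auto
      also have "\<dots> = 2 * real N * (\<Sum>p\<in>P. 1 / (real p)\<^sup>2)" by (simp add: sum_distrib_left)
      also have "\<dots> \<le> 2 * real N * 1"
      proof (rule mult_left_mono)
        have "(\<Sum>p\<in>P. 1 / (real p)\<^sup>2) \<le> (\<Sum>p\<in>{1<..2 ^ i1}. 1 / (real p)\<^sup>2)"
          by (intro sum_mono2) (auto simp: P_def window_def prime_gt_Suc_0_nat)
        also have "\<dots> \<le> 1" using sum_inverse_squares_le[of 1 "2 ^ i1"] by simp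
        finally show "(\<Sum>p\<in>P. 1 / (real p)\<^sup>2) \<le> 1" .
      qed simp
      finally show ?thesis by simp
    qed
    also have "norm (\<Sum>p\<in>P. Y p) \<le> N * (4 + i1 * sqrt (sqrt G))"
    proof -
      have "norm (\<Sum>p\<in>P. Y p) \<le> (\<Sum>i\<in>{i0..<i1}. norm (\<Sum>p\<in>block (2 ^ i). Y p))"
        unfolding P_def sum_window by (rule norm_sum)
      also have "\<dots> \<le> (\<Sum>i\<in>{i0..<i1}. N * (1 / sqrt (2 ^ i)) + N * sqrt (sqrt G))"
      proof (rule sum_mono)
        fix i assume i: "i \<in> {i0..<i1}"
        have "norm (\<Sum>p\<in>block (2 ^ i). Y p) \<le> real N / sqrt (real (2 ^ i)) + sqrt (real N * sqrt (correlation_energy a N (2 ^ i)))"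
          unfolding Y_def by (rule block_bilinear_le[OF f a]) simp
        also have "\<dots> \<le> real N / sqrt (real (2 ^ i)) + sqrt (real N * sqrt ((real N)\<^sup>2 * G))"
        proof (intro add_left_mono real_sqrt_le_mono mult_left_mono)
          have "correlation_energy a N (2 ^ i) \<le> (\<Sum>i\<in>{i0..<i1}. correlation_energy a N (2 ^ i))"
            using i correlation_energy_nonneg by (intro member_le_sum) auto
          also have "\<dots> = (real N)\<^sup>2 * G" using N0 by (simp add: G_def)
          finally show "correlation_energy a N (2 ^ i) \<le> (real N)\<^sup>2 * G" .
        qed simp
        also have "sqrt (real N * sqrt ((real N)\<^sup>2 * G)) = N * sqrt (sqrt G)"
          by (simp add: real_sqrt_mult)
        also have "real N / sqrt (real (2 ^ i)) = N * (1 / sqrt (2 ^ i))" by simp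
        finally show "norm (\<Sum>p\<in>block (2 ^ i). Y p) \<le> N * (1 / sqrt (2 ^ i)) + N * sqrt (sqrt G)" .
      qed
      also have "\<dots> = N * (\<Sum>i\<in>{i0..<i1}. 1 / sqrt (2 ^ i)) + real (i1 - i0) * (N * sqrt (sqrt G))"
        by (simp add: sum.distrib sum_distrib_left)
      also have "\<dots> \<le> real N * 4 + i1 * (N * sqrt (sqrt G))"
      proof (rule add_mono)
        show "N * (\<Sum>i\<in>{i0..<i1}. 1 / sqrt (2 ^ i)) \<le> real N * 4"
          by (rule mult_left_mono[OF sum_sqrt_powers_le]) simp
        show "real (i1 - i0) * (N * sqrt (sqrt G)) \<le> i1 * (N * sqrt (sqrt G))"
          using G by (intro mult_right_mono) auto
      qed
      finally show ?thesis by (simp add: algebra_simps)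
    qed
    finally show ?thesis by (simp add: algebra_simps)
  qed
  have "complex_of_real L * (\<Sum>n=1..N. f n * a n) =
      (\<Sum>n=1..N. complex_of_real (w n) * (f n * a n)) - (\<Sum>n=1..N. complex_of_real (w n - L) * (f n * a n))"
    by (simp add: sum_distrib_left algebra_simps flip: sum_subtractf)
  then have "norm (complex_of_real L * (\<Sum>n=1..N. f n * a n)) \<le>
      norm (\<Sum>n=1..N. complex_of_real (w n) * (f n * a n)) + norm (\<Sum>n=1..N. complex_of_real (w n - L) * (f n * a n))"
    using norm_triangle_ineq4 by simp
  also have "\<dots> \<le> N * (6 + i1 * sqrt (sqrt G)) + N * sqrt (3 * L)"
    by (rule add_mono[OF bil tk])
  also have "\<dots> = N * (sqrt (3 * L) + 6 + i1 * sqrt (sqrt G))"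
    by (simp add: algebra_simps)
  finally show ?thesis using L by (simp add: norm_mult)
qed

section \<open>Mean squares over the unit interval\<close>

lemma unit_exp_eq_cis: "unit_exp y = cis (2 * pi * y)"
  by (simp add: unit_exp_def cis_conv_exp mult_ac)

lemma norm_unit_exp [simp]: "norm (unit_exp y) = 1"
  by (simp add: unit_exp_eq_cis)

lemma unit_exp_mult_cnj: "unit_exp x * cnj (unit_exp y) = unit_exp (x - y)"
  by (simp add: unit_exp_eq_cis cis_cnj cis_mult right_diff_distrib)

lemma norm_sum_unit_exp_square:
  assumes "finite A"
  shows "(norm (\<Sum>m\<in>A. unit_exp (\<alpha> * t m)))\<^sup>2 = (\<Sum>m\<in>A. \<Sum>m'\<in>A. cos (2 * pi * (t m - t m') * \<alpha>))"
proof -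
  have "(norm (\<Sum>m\<in>A. unit_exp (\<alpha> * t m)))\<^sup>2 =
      (\<Sum>m\<in>A. cos (2 * pi * (\<alpha> * t m)))\<^sup>2 + (\<Sum>m\<in>A. sin (2 * pi * (\<alpha> * t m)))\<^sup>2"
    by (simp add: cmod_power2 unit_exp_eq_cis)
  also have "\<dots> = (\<Sum>m\<in>A. \<Sum>m'\<in>A. cos (2 * pi * (\<alpha> * t m)) * cos (2 * pi * (\<alpha> * t m')) + sin (2 * pi * (\<alpha> * t m)) * sin (2 * pi * (\<alpha> * t m')))"
    by (simp add: power2_eq_square sum_product sum.distrib)
  also have "\<dots> = (\<Sum>m\<in>A. \<Sum>m'\<in>A. cos (2 * pi * (t m - t m') * \<alpha>))"
    by (intro sum.cong refl) (simp add: cos_diff[symmetric] algebra_simps)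
  finally show ?thesis .
qed

lemma has_integral_cos_period:
  "has_bochner_integral lborel (\<lambda>\<alpha>. cos (2 * pi * real_of_int j * \<alpha>) * indicator {0..1} \<alpha>) (if j = 0 then 1 else 0)"
proof (cases "j = 0")
  case True
  have "has_bochner_integral lborel (\<lambda>\<alpha>. 1 * indicator {0..1::real} \<alpha> :: real) ((\<lambda>x. x) 1 - (\<lambda>x. x) (0::real))"
    by (rule has_bochner_integral_FTC_Icc_real) (auto intro!: derivative_eq_intros)
  then show ?thesis using True by simp
next
  case False
  let ?c = "2 * pi * real_of_int j"
  have "has_bochner_integral lborel (\<lambda>\<alpha>. cos (?c * \<alpha>) * indicator {0..1} \<alpha>)
      ((\<lambda>x. sin (?c * x) / ?c) 1 - (\<lambda>x. sin (?c * x) / ?c) 0)"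
    using False by (intro has_bochner_integral_FTC_Icc_real) (auto intro!: derivative_eq_intros continuous_intros)
  moreover have "sin (2 * pi * real_of_int j) = 0"
    using sin_int_2pin[of j] by (simp add: mult_ac)
  ultimately show ?thesis using False by simp
qed

context shift_map_chain
begin

text \<open>
  Orthogonality: of $\cos(2 \pi (t - t') \alpha)$ for integers $t$ and $t'$ only the terms with $t = t'$ survive integration.
\<close>
lemma correlation_energy_has_integral:
  "has_bochner_integral lborel
    (\<lambda>\<alpha>. correlation_energy (\<lambda>n. unit_exp (\<alpha> * real ((F ^^ Suc d) n))) N B * indicator {0..1} \<alpha>)
    (real (card (coincidences B)))"
proof -
  let ?D = "{(p, q). p \<in> block B \<and> q \<in> block B \<and> p \<noteq> q}"
  let ?m = "\<lambda>(p, q). {m. 1 \<le> m \<and> p * m \<le> N \<and> q * m \<le> N}"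
  let ?d = "\<lambda>(p, q) m. pair_diff p q m"
  have finD: "finite ?D" by (rule finite_subset[of _ "block B \<times> block B"]) auto
  have finm: "finite (?m t)" if "t \<in> ?D" for t
  proof -
    obtain p q where t: "t = (p, q)" by (cases t)
    have "p > 0" using that t by (auto simp: block_def prime_gt_0_nat)
    then have le: "m \<le> p * m" for m by simp
    have "?m t \<subseteq> {..N}" using t by (auto intro: order.trans[OF le])
    then show ?thesis by (rule finite_subset) simp
  qed
  have eq: "correlation_energy (\<lambda>n. unit_exp (\<alpha> * real ((F ^^ Suc d) n))) N B * indicator {0..1} \<alpha> =
      (\<Sum>t\<in>?D. \<Sum>m\<in>?m t. \<Sum>m'\<in>?m t. cos (2 * pi * real_of_int (?d t m - ?d t m') * \<alpha>) * indicator {0..1} \<alpha>)" for \<alpha>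
  proof -
    have "correlation_energy (\<lambda>n. unit_exp (\<alpha> * real ((F ^^ Suc d) n))) N B =
        (\<Sum>t\<in>?D. (norm (\<Sum>m\<in>?m t. unit_exp (\<alpha> * real_of_int (?d t m))))\<^sup>2)"
      unfolding correlation_energy_def correlation_def
      by (intro sum.cong refl) (auto simp: unit_exp_mult_cnj pair_diff_def right_diff_distrib)
    also have "\<dots> = (\<Sum>t\<in>?D. \<Sum>m\<in>?m t. \<Sum>m'\<in>?m t. cos (2 * pi * real_of_int (?d t m - ?d t m') * \<alpha>))"
      by (rule sum.cong[OF refl], simp only: norm_sum_unit_exp_square[OF finm] of_int_diff)
    finally show ?thesis by (simp add: sum_distrib_right)
  qed
  have "has_bochner_integral lborel
      (\<lambda>\<alpha>. \<Sum>t\<in>?D. \<Sum>m\<in>?m t. \<Sum>m'\<in>?m t. cos (2 * pi * real_of_int (?d t m - ?d t m') * \<alpha>) * indicator {0..1} \<alpha>)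
      (\<Sum>t\<in>?D. \<Sum>m\<in>?m t. \<Sum>m'\<in>?m t. if ?d t m - ?d t m' = 0 then 1 else 0)"
    by (intro has_bochner_integral_sum has_integral_cos_period)
  also have "(\<Sum>t\<in>?D. \<Sum>m\<in>?m t. \<Sum>m'\<in>?m t. if ?d t m - ?d t m' = 0 then 1 else 0 :: real) = real (card (coincidences B))"
  proof -
    have co: "coincidences B = (\<lambda>(t, m, m'). (fst t, snd t, m, m')) ` (SIGMA t:?D. SIGMA m:?m t. {m' \<in> ?m t. ?d t m = ?d t m'})"
      by (force simp: coincidences_def image_iff)
    have "card (coincidences B) = card (SIGMA t:?D. SIGMA m:?m t. {m' \<in> ?m t. ?d t m = ?d t m'})"
      unfolding co by (rule card_image) (auto simp: inj_on_def)
    also have "\<dots> = (\<Sum>t\<in>?D. card (SIGMA m:?m t. {m' \<in> ?m t. ?d t m = ?d t m'}))"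
      by (rule card_SigmaI[OF finD], intro ballI finite_SigmaI finite_subset[OF Collect_restrict] finm)
    also have "\<dots> = (\<Sum>t\<in>?D. \<Sum>m\<in>?m t. card {m' \<in> ?m t. ?d t m = ?d t m'})"
      by (rule sum.cong[OF refl], rule card_SigmaI[OF finm], assumption, intro ballI finite_subset[OF Collect_restrict] finm)
    finally have "real (card (coincidences B)) = (\<Sum>t\<in>?D. \<Sum>m\<in>?m t. real (card {m' \<in> ?m t. ?d t m = ?d t m'}))"
      by (simp only: of_nat_sum)
    also have "\<dots> = (\<Sum>t\<in>?D. \<Sum>m\<in>?m t. \<Sum>m'\<in>?m t. if ?d t m - ?d t m' = 0 then 1 else 0)"
    proof (intro sum.cong refl)
      fix t m assume "t \<in> ?D"
      from sum.inter_filter[OF finm[OF this], of "\<lambda>_. 1 :: real" "\<lambda>m'. ?d t m = ?d t m'"]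
      show "real (card {m' \<in> ?m t. ?d t m = ?d t m'}) = (\<Sum>m'\<in>?m t. if ?d t m - ?d t m' = 0 then 1 else 0)"
        by simp
    qed
    finally show ?thesis ..
  qed
  finally show ?thesis by (simp only: eq)
qed

end

text \<open>
  The Borel-Cantelli argument: the sum of the functions has a finite integral, hence is finite almost everywhere.
\<close>
lemma AE_tendsto_0_if_summable_integrals:
  fixes h :: "nat \<Rightarrow> real \<Rightarrow> real"
  assumes int: "\<And>j. has_bochner_integral lborel (\<lambda>\<alpha>. h j \<alpha> * indicator {0..1} \<alpha>) (I j)"
    and nonneg: "\<And>j \<alpha>. h j \<alpha> \<ge> 0" and sum: "summable I"
  shows "AE \<alpha> in lborel. \<alpha> \<in> {0..1} \<longrightarrow> (\<lambda>j. h j \<alpha>) \<longlonglongrightarrow> 0"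
proof -
  let ?g = "\<lambda>j \<alpha>. ennreal (h j \<alpha> * indicator {0..1} \<alpha>)"
  have meas: "(\<lambda>\<alpha>. h j \<alpha> * indicator {0..1} \<alpha>) \<in> borel_measurable lborel" for j
    using int[of j] by (simp add: has_bochner_integral_iff integrable_iff_bounded)
  have nn: "integral\<^sup>N lborel (?g j) = ennreal (I j)" and Ipos: "I j \<ge> 0" for j
  proof -
    have "integrable lborel (\<lambda>\<alpha>. h j \<alpha> * indicator {0..1} \<alpha>)" "integral\<^sup>L lborel (\<lambda>\<alpha>. h j \<alpha> * indicator {0..1} \<alpha>) = I j"
      using int[of j] by (auto simp: has_bochner_integral_iff)
    moreover have "integral\<^sup>L lborel (\<lambda>\<alpha>. h j \<alpha> * indicator {0..1} \<alpha>) \<ge> 0"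
      using nonneg[of j] by (intro Bochner_Integration.integral_nonneg) auto
    ultimately show "integral\<^sup>N lborel (?g j) = ennreal (I j)" "I j \<ge> 0"
      using nonneg[of j] by (auto simp: nn_integral_eq_integral)
  qed
  have "(\<integral>\<^sup>+\<alpha>. (\<Sum>j. ?g j \<alpha>) \<partial>lborel) = (\<Sum>j. ennreal (I j))"
    using meas by (subst nn_integral_suminf) (auto simp: nn)
  also have "\<dots> = ennreal (\<Sum>j. I j)" using sum Ipos by (intro suminf_ennreal2) auto
  finally have "(\<integral>\<^sup>+\<alpha>. (\<Sum>j. ?g j \<alpha>) \<partial>lborel) \<noteq> \<infinity>" by simp
  then have "AE \<alpha> in lborel. (\<Sum>j. ?g j \<alpha>) \<noteq> \<infinity>"
    using meas by (intro nn_integral_PInf_AE) auto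
  then show ?thesis
  proof eventually_elim
    case (elim \<alpha>)
    show ?case
    proof
      assume \<alpha>: "\<alpha> \<in> {0..1}"
      then have "(\<Sum>j. ennreal (h j \<alpha>)) \<noteq> top" using elim by simp
      then have "summable (\<lambda>j. h j \<alpha>)" using nonneg by (intro summable_suminf_not_top) auto
      then show "(\<lambda>j. h j \<alpha>) \<longlonglongrightarrow> 0" by (rule summable_LIMSEQ_zero)
    qed
  qed
qed

section \<open>Choice of the parameters\<close>

text \<open>
  \<open>(K + 1) ^ level_exp d\<close> dominates the exponent in \<open>y (Suc d)\<close>, the threshold beyond which almost all integers have a prime
  factor with a chain of \<open>d\<close> links.
\<close>
definition level_exp :: "nat \<Rightarrow> nat" where "level_exp d = 3 ^ Suc d + Suc d"

text \<open>
  The weight \<open>hi ^ 4\<close> absorbs the factor in front of the fourth root in \<open>mean_le_correlations\<close>.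
\<close>
lemma (in shift_map) weighted_energy_has_integral:
  assumes T: "2 \<le> T" and d: "Suc d \<le> N" and lo: "lo = (T\<^sup>2 + 1) ^ level_exp d" and N: "2 ^ (lo + T + hi) \<le> N"
  shows "\<exists>I. has_bochner_integral lborel (\<lambda>\<alpha>. real hi ^ 4 *
           ((\<Sum>i\<in>{lo..<hi}. correlation_energy (\<lambda>n. unit_exp (\<alpha> * real ((F ^^ Suc d) n))) N (2 ^ i)) / (real N)\<^sup>2) *
             indicator {0..1} \<alpha>) I \<and>
         I \<le> real hi ^ 5 * (2 * coincidence_const d * (2 * harm (2 * N + 1)) ^ (2 * d + 5) / 2 ^ T)"
proof -
  interpret shift_map_chain F N T d by unfold_locales (use T d in auto)
  define E where "E = (\<lambda>\<alpha> i. correlation_energy (\<lambda>n. unit_exp (\<alpha> * real ((F ^^ Suc d) n))) N (2 ^ i))"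
  define c where "c = coincidence_const d * H ^ (2 * d + 3) * \<delta>"
  have N0: "real N > 0" using d by simp
  have c0: "c \<ge> 0" using H_ge_2 \<delta>_pos by (simp add: c_def coincidence_const_def)
  have ylo: "y (Suc d) \<le> 2 ^ lo"
  proof -
    have "R (Suc d) * (K + 1) ^ Suc d \<le> (K + 1) ^ (3 ^ Suc d) * (K + 1) ^ Suc d"
      unfolding R_def by (intro mult_right_mono power_mono) auto
    also have "\<dots> = lo" by (simp only: lo level_exp_def power_add K_def)
    finally show ?thesis unfolding y_def by (intro power_increasing) auto
  qed
  have yd: "y d \<le> y (Suc d)"
    unfolding y_Suc using y_gt_1[of d] by (intro self_le_power) auto
  have coin: "real (card (coincidences (2 ^ i))) \<le> (real N)\<^sup>2 * c" if i: "i \<in> {lo..<hi}" for i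
    unfolding c_def
  proof (rule card_coincidences_le)
    have "(2::nat) ^ lo \<le> 2 ^ i" using i by (intro power_increasing) auto
    then show "y d \<le> 2 ^ i" using ylo yd by linarith
    have "2 * 2 ^ i \<le> (2::nat) ^ (lo + T + hi)"
      unfolding power_Suc[symmetric] using i by (intro power_increasing) auto
    then show "2 * 2 ^ i \<le> N" using N by linarith
    have "2 ^ i * y (Suc d) * 2 ^ T \<le> 2 ^ hi * 2 ^ lo * 2 ^ T"
      using i ylo by (intro mult_mono power_increasing) auto
    also have "\<dots> = (2::nat) ^ (lo + T + hi)" by (simp add: power_add mult_ac)
    also note N
    finally have "real (2 ^ i * y (Suc d)) * 2 ^ T \<le> real N"
      by (metis of_nat_le_iff of_nat_mult of_nat_numeral of_nat_power)
    then have "real (2 ^ i * y (Suc d)) \<le> real N * (1 / 2 ^ T)" by (simp add: field_simps)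
    also have "\<dots> \<le> real N * \<delta>" by (intro mult_left_mono inverse_two_power_le) auto
    finally show "real (2 ^ i * y (Suc d)) \<le> real N * \<delta>" .
  qed
  let ?I = "\<Sum>i\<in>{lo..<hi}. (real hi ^ 4 / (real N)\<^sup>2) * real (card (coincidences (2 ^ i)))"
  have "has_bochner_integral lborel (\<lambda>\<alpha>. \<Sum>i\<in>{lo..<hi}. (real hi ^ 4 / (real N)\<^sup>2) * (E \<alpha> i * indicator {0..1} \<alpha>)) ?I"
    unfolding E_def
    by (intro has_bochner_integral_sum has_bochner_integral_mult_right correlation_energy_has_integral)
  also have "(\<lambda>\<alpha>. \<Sum>i\<in>{lo..<hi}. (real hi ^ 4 / (real N)\<^sup>2) * (E \<alpha> i * indicator {0..1} \<alpha>)) =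
      (\<lambda>\<alpha>. real hi ^ 4 * ((\<Sum>i\<in>{lo..<hi}. E \<alpha> i) / (real N)\<^sup>2) * indicator {0..1} \<alpha>)"
    by (rule ext) (simp add: sum_distrib_left sum_distrib_right sum_divide_distrib mult.assoc)
  finally have int: "has_bochner_integral lborel
      (\<lambda>\<alpha>. real hi ^ 4 * ((\<Sum>i\<in>{lo..<hi}. E \<alpha> i) / (real N)\<^sup>2) * indicator {0..1} \<alpha>) ?I" .
  have "?I \<le> (\<Sum>i\<in>{lo..<hi}. (real hi ^ 4 / (real N)\<^sup>2) * ((real N)\<^sup>2 * c))"
    by (intro sum_mono mult_left_mono coin) auto
  also have "\<dots> = real (hi - lo) * (real hi ^ 4 * c)" using N0 by simp
  also have "\<dots> \<le> real hi * (real hi ^ 4 * c)"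
    using c0 by (intro mult_right_mono) auto
  also have "\<dots> = real hi ^ 5 *
      (2 * coincidence_const d * (2 * harm (2 * N + 1)) ^ (2 * d + 5) / 2 ^ T)"
  proof -
    have "c = 2 * coincidence_const d * H ^ (2 * d + 5) / 2 ^ T"
      unfolding c_def \<delta>_def by (simp add: power_add power2_eq_square eval_nat_numeral)
    moreover have "real hi * (real hi ^ 4 * c) = real hi ^ 5 * c" by (simp add: eval_nat_numeral)
    ultimately show ?thesis by (simp add: H_def)
  qed
  finally show ?thesis using int unfolding E_def by blast
qed

text \<open>
  With $u = \log N$, the saving is $2^{-T}$ with $T$ a small power of $u$, and the window consists of the primes between $2^{i_0}$ and
  $2^{i_1}$, where $i_0$ is at most a constant times $u^{1/8}$ and $i_1$ is $u^{1/2}$, rounded down. The exponent in $T$ is chosen so that the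
  chain thresholds stay below the window; the gap between $1/8$ and $1/2$ makes $\sum 1/p$ over the window tend to infinity, even
  with the constant $2$ lost in \<open>sum_inverse_primes_upper\<close>.
\<close>
definition saving_exp :: "nat \<Rightarrow> real \<Rightarrow> nat" where
  "saving_exp d u = nat \<lfloor>u powr (1 / (16 * real (level_exp d)))\<rfloor>"
definition lo_exp :: "nat \<Rightarrow> real \<Rightarrow> nat" where
  "lo_exp d u = ((saving_exp d u)\<^sup>2 + 1) ^ level_exp d"
definition hi_exp :: "real \<Rightarrow> nat" where
  "hi_exp u = nat \<lfloor>sqrt u\<rfloor>"

lemma level_exp_ge: "level_exp d \<ge> 1" by (simp add: level_exp_def)

lemma saving_exp_le: "u \<ge> 1 \<Longrightarrow> real (saving_exp d u) \<le> u powr (1 / (16 * real (level_exp d)))"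
  by (simp add: saving_exp_def)

lemma saving_exp_at_top: "filterlim (saving_exp d) at_top at_top"
proof -
  have "1 / (16 * real (level_exp d)) > 0" using level_exp_ge[of d] by simp
  then have "filterlim (\<lambda>u. u powr (1 / (16 * real (level_exp d)))) at_top at_top" by real_asymp
  then show ?thesis unfolding saving_exp_def
    by (intro filterlim_compose[OF filterlim_nat_sequentially] filterlim_compose[OF filterlim_floor_sequentially])
qed

lemma lo_exp_le:
  assumes "u \<ge> 1"
  shows "real (lo_exp d u) \<le> 2 ^ level_exp d * u powr (1 / 8)"
proof -
  let ?e = "level_exp d"
  let ?v = "u powr (1 / (16 * real ?e))"
  have v: "?v \<ge> 1" using assms by (intro ge_one_powr_ge_zero) auto
  have "real ((saving_exp d u)\<^sup>2 + 1) \<le> ?v\<^sup>2 + 1" using saving_exp_le[OF assms, of d] by (simp add: power_mono)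
  also have "\<dots> \<le> 2 * ?v\<^sup>2" using v by (simp add: one_le_power)
  finally have "real ((saving_exp d u)\<^sup>2 + 1) ^ ?e \<le> (2 * ?v\<^sup>2) ^ ?e" by (intro power_mono) auto
  also have "\<dots> = 2 ^ ?e * ?v ^ (2 * ?e)" by (simp add: power_mult_distrib power_mult)
  also have "?v ^ (2 * ?e) = u powr (1 / 8)"
    using v assms level_exp_ge[of d] by (simp add: powr_realpow[symmetric] powr_powr)
  finally show ?thesis by (simp add: lo_exp_def)
qed

text \<open>
  Ensures $2^{i_0 + T + i_1} \le N$: a block of the window times the threshold for the chains is at most $N$ times the saving.
\<close>
lemma eventually_window_small:
  "\<forall>\<^sub>F u in at_top. real (lo_exp d u + saving_exp d u + hi_exp u) \<le> u"
proof -
  define C where "C = (2::real) ^ level_exp d + 1"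
  have "\<forall>\<^sub>F u in at_top. C * u powr (1 / 8) + sqrt u \<le> u" by real_asymp
  moreover have "\<forall>\<^sub>F u::real in at_top. u \<ge> 1" by (rule eventually_ge_at_top)
  ultimately show ?thesis
  proof eventually_elim
    case (elim u)
    have "real (saving_exp d u) \<le> u powr (1 / (16 * real (level_exp d)))" by (rule saving_exp_le) (use elim in auto)
    also have "\<dots> \<le> u powr (1 / 8)"
      using elim level_exp_ge[of d] by (intro powr_mono) (auto simp: field_simps)
    finally have "real (saving_exp d u) \<le> u powr (1 / 8)" .
    moreover have "real (hi_exp u) \<le> sqrt u" using elim by (simp add: hi_exp_def)
    moreover have "real (lo_exp d u) \<le> 2 ^ level_exp d * u powr (1 / 8)" by (rule lo_exp_le) (use elim in auto)
    ultimately show ?case using elim by (simp add: C_def distrib_right)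
  qed
qed

lemma harm_le_ln: "n \<ge> 1 \<Longrightarrow> harm n \<le> 1 + ln (real n)"
  using decseqD[OF decseq_harm_diff_ln, of 0 "n - 1"] by (simp add: harm_expand)

lemma window_sum_at_top:
  "filterlim (\<lambda>u. \<Sum>p\<in>window (lo_exp d u) (hi_exp u). 1 / real p) at_top at_top"
proof -
  define C where "C = ln (2 ^ level_exp d :: real)"
  have lim: "filterlim (\<lambda>u. ln (sqrt u / 8) - (1 + 2 * (1 + (C + ln u / 8)))) at_top at_top" by real_asymp
  have "\<forall>\<^sub>F u::real in at_top. ln (sqrt u / 8) - (1 + 2 * (1 + (C + ln u / 8))) \<le> (\<Sum>p\<in>window (lo_exp d u) (hi_exp u). 1 / real p)"
    using eventually_ge_at_top[of 16]
  proof eventually_elim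
    case (elim u)
    define lo where "lo = lo_exp d u"
    define hi where "hi = hi_exp u"
    have su: "sqrt u \<ge> 4" using elim by (intro real_le_rsqrt) auto
    have hi: "real hi \<ge> sqrt u - 1" unfolding hi_def hi_exp_def using su by linarith
    have lo1: "lo \<ge> 1" by (simp add: lo_def lo_exp_def)
    have "ln (real lo) \<le> ln (2 ^ level_exp d * u powr (1 / 8))"
      using lo1 lo_exp_le[of u d] elim by (subst ln_le_cancel_iff) (auto simp: lo_def)
    also have "\<dots> = C + ln u / 8" using elim by (simp add: ln_mult C_def ln_powr)
    finally have ln_lo: "ln (real lo) \<le> C + ln u / 8" .
    have "sqrt u / 8 \<le> (real hi * ln 2) / 2" 
    proof -
      have "sqrt u / 2 * (1 / 2) \<le> real hi * ln 2" using hi su ln2_ge_two_thirds by (intro mult_mono) auto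
      then show ?thesis by simp
    qed
    also have "\<dots> = ln (2 ^ hi) / 2" by (simp add: ln_realpow)
    also have "\<dots> \<le> ln (real (2 ^ hi) + 1) / 2"
      by (intro divide_right_mono) (auto simp: add_pos_nonneg)
    also have "\<dots> \<le> exp (\<Sum>p | prime p \<and> p \<le> 2 ^ hi. 1 / real p)"
      using sum_inverse_primes_lower[of "2 ^ hi"] by simp
    finally have "ln (sqrt u / 8) \<le> ln (exp (\<Sum>p | prime p \<and> p \<le> 2 ^ hi. 1 / real p))"
      using su elim by (subst ln_le_cancel_iff) auto
    also have "\<dots> = (\<Sum>p | prime p \<and> p \<le> 2 ^ hi. 1 / real p)" by simp
    also have "\<dots> \<le> (\<Sum>p\<in>{p. prime p \<and> p \<le> 2 ^ Suc lo} \<union> window lo hi. 1 / real p)"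
      by (intro sum_mono2) (auto simp: window_def)
    also have "\<dots> \<le> (\<Sum>p | prime p \<and> p \<le> 2 ^ Suc lo. 1 / real p) + (\<Sum>p\<in>window lo hi. 1 / real p)"
      by (subst sum_Un) (auto intro!: sum_nonneg)
    also have "(\<Sum>p | prime p \<and> p \<le> 2 ^ Suc lo. 1 / real p) \<le> 1 + 2 * harm lo"
      by (rule sum_inverse_primes_upper)
    also have "harm lo \<le> 1 + ln (real lo)" by (rule harm_le_ln[OF lo1])
    finally show ?case using ln_lo by (simp add: lo_def hi_def)
  qed
  then show ?thesis by (rule filterlim_at_top_mono[OF lim])
qed

text \<open>
  $T$ is a power of $u$, so $2^T$ outgrows every polynomial in $u$, that is, every power of $\log N$.
\<close>
lemma eventually_power_le_two_power_saving_exp: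
  "\<forall>\<^sub>F u in at_top. C * u ^ A \<le> 2 ^ saving_exp d u"
proof -
  define m where "m = 16 * level_exp d"
  have m: "m \<ge> 1" using level_exp_ge[of d] by (simp add: m_def)
  have "((\<lambda>x::real. x ^ (m * A) / exp x) \<longlongrightarrow> 0) at_top" by (rule tendsto_power_div_exp_0)
  moreover have lim: "filterlim (\<lambda>u::real. u powr (1 / real m) * ln 2) at_top at_top"
  proof -
    have "1 / real m > 0" using m by simp
    then show ?thesis by real_asymp
  qed
  ultimately have "((\<lambda>u. (u powr (1 / real m) * ln 2) ^ (m * A) / exp (u powr (1 / real m) * ln 2)) \<longlongrightarrow> 0) at_top"
    by (rule filterlim_compose)
  moreover have "0 < ln 2 ^ (m * A) / (2 * (\<bar>C\<bar> + 1))" by simp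
  ultimately have "\<forall>\<^sub>F u in at_top. (u powr (1 / real m) * ln 2) ^ (m * A) / exp (u powr (1 / real m) * ln 2) < ln 2 ^ (m * A) / (2 * (\<bar>C\<bar> + 1))"
    by (rule order_tendstoD(2))
  then show ?thesis using eventually_ge_at_top[of 1]
  proof eventually_elim
    case (elim u)
    define v where "v = u powr (1 / real m)"
    have v: "v \<ge> 1" unfolding v_def using elim by (intro ge_one_powr_ge_zero) auto
    have vm: "v ^ m = u" using elim m by (simp add: v_def powr_realpow[symmetric] powr_powr)
    have e: "exp (v * ln 2) = 2 powr v" by (simp add: powr_def)
    have "(v * ln 2) ^ (m * A) / exp (v * ln 2) = ln 2 ^ (m * A) * (u ^ A / 2 powr v)"
      by (simp add: power_mult_distrib power_mult vm e)
    then have "ln 2 ^ (m * A) * (u ^ A / 2 powr v) < ln 2 ^ (m * A) * (1 / (2 * (\<bar>C\<bar> + 1)))"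
      using elim(1) by (simp add: v_def)
    then have "u ^ A / 2 powr v < 1 / (2 * (\<bar>C\<bar> + 1))"
      by (subst (asm) mult_less_cancel_left_pos) auto
    then have "(\<bar>C\<bar> + 1) * u ^ A < 2 powr v / 2" by (simp add: field_simps)
    moreover have "C * u ^ A \<le> (\<bar>C\<bar> + 1) * u ^ A" using elim by (intro mult_right_mono) auto
    moreover have "2 powr v / 2 = 2 powr (v - 1)" by (simp add: powr_diff)
    moreover have "2 powr (v - 1) \<le> 2 powr real (saving_exp d u)"
    proof (intro powr_mono)
      have "real (saving_exp d u) = real_of_int \<lfloor>v\<rfloor>" using v by (simp add: saving_exp_def v_def m_def)
      then show "v - 1 \<le> real (saving_exp d u)" by linarith
    qed simp
    ultimately show ?case by (simp add: powr_realpow)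
  qed
qed

lemma eventually_bound_le:
  fixes Cst :: real
  assumes "Cst \<ge> 0"
  shows "\<forall>\<^sub>F N in sequentially. real (hi_exp (ln N)) ^ 5 * (Cst * (2 * harm (2 * N + 1)) ^ (2 * d + 5) / 2 ^ saving_exp d (ln N)) \<le> 1 / ln N ^ 4"
proof -
  have lim: "filterlim (\<lambda>N. ln (real N)) at_top sequentially" by real_asymp
  define A where "A = 5 + (2 * d + 5) + 4"
  have "\<forall>\<^sub>F N in sequentially. Cst * 8 ^ (2 * d + 5) * ln (real N) ^ A \<le> 2 ^ saving_exp d (ln (real N))"
    by (rule eventually_compose_filterlim[OF eventually_power_le_two_power_saving_exp lim])
  moreover have "\<forall>\<^sub>F N in sequentially. ln (real N) \<ge> 1"
    using lim by (auto simp: filterlim_at_top)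
  moreover have "\<forall>\<^sub>F N in sequentially. N \<ge> 3" by (rule eventually_ge_at_top)
  ultimately show ?thesis
  proof eventually_elim
    case (elim N)
    define u where "u = ln (real N)"
    have u: "u \<ge> 1" using elim by (simp add: u_def)
    have "real (hi_exp u) \<le> sqrt u" using u by (simp add: hi_exp_def)
    also have "\<dots> \<le> u" using u by (intro real_le_lsqrt) (auto simp: power2_eq_square)
    finally have hi: "real (hi_exp u) \<le> u" .
    have H: "2 * harm (2 * N + 1) \<le> 8 * u"
    proof -
      have "2 * N + 1 \<le> 3 * N" using elim by simp
      also have "3 * N \<le> N * N" using elim by (intro mult_right_mono) auto
      finally have "real (2 * N + 1) \<le> (real N)\<^sup>2" by (metis of_nat_le_iff of_nat_mult power2_eq_square)
      then have "ln (real (2 * N + 1)) \<le> ln ((real N)\<^sup>2)" using elim by (subst ln_le_cancel_iff) auto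
      also have "\<dots> = 2 * u" using elim by (simp add: ln_realpow u_def)
      finally show ?thesis using harm_le_ln[of "2 * N + 1"] u by simp
    qed
    have "real (hi_exp u) ^ 5 * (Cst * (2 * harm (2 * N + 1)) ^ (2 * d + 5)) \<le> u ^ 5 * (Cst * (8 * u) ^ (2 * d + 5))"
    proof (intro mult_mono mult_left_mono)
      show "real (hi_exp u) ^ 5 \<le> u ^ 5" using hi by (intro power_mono) auto
      show "(2 * harm (2 * N + 1)) ^ (2 * d + 5) \<le> (8 * u) ^ (2 * d + 5)"
        using H harm_nonneg[of "2 * N + 1", where 'a = real] by (intro power_mono) auto
    qed (use u assms harm_nonneg[of "2 * N + 1", where 'a = real] in auto)
    also have "\<dots> * u ^ 4 = Cst * 8 ^ (2 * d + 5) * u ^ A"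
      by (simp add: A_def power_add power_mult_distrib)
    also have "\<dots> \<le> 2 ^ saving_exp d u" using elim by (simp add: u_def)
    finally have "real (hi_exp u) ^ 5 * (Cst * (2 * harm (2 * N + 1)) ^ (2 * d + 5)) * u ^ 4 \<le> 2 ^ saving_exp d u"
      using u by (simp add: mult_right_mono)
    then show ?case using u unfolding u_def[symmetric] by (simp add: field_simps)
  qed
qed

section \<open>From a sparse sequence to all real x\<close>

lemma const_1_M1: "(\<lambda>_. 1) \<in> M1"
  by (simp add: M1_def multiplicative_def)

lemma sup_mean_bounds:
  assumes "x > 0" and "\<And>f. f \<in> M1 \<Longrightarrow> norm (\<Sum>n=1..nat \<lfloor>x\<rfloor>. f n * unit_exp (\<alpha> * real (g n))) \<le> x * b"
  shows "0 \<le> sup_mean g \<alpha> x \<and> sup_mean g \<alpha> x \<le> b"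
proof -
  let ?v = "\<lambda>f. 1 / x * norm (\<Sum>n | 0 < n \<and> real n \<le> x. f n * unit_exp (\<alpha> * real (g n)))"
  have eq: "{n. 0 < n \<and> real n \<le> x} = {1..nat \<lfloor>x\<rfloor>}"
    using assms(1) by (auto simp: le_nat_iff le_floor_iff)
  have le: "?v f \<le> b" if "f \<in> M1" for f
    using assms(2)[OF that] assms(1) unfolding eq by (simp add: field_simps)
  have "sup_mean g \<alpha> x \<le> b"
    unfolding sup_mean_def using const_1_M1 le by (intro cSUP_least) auto
  moreover have "?v (\<lambda>_. 1) \<le> sup_mean g \<alpha> x"
    unfolding sup_mean_def using const_1_M1 le by (intro cSUP_upper bdd_aboveI[of _ b]) auto
  moreover have "?v (\<lambda>_. 1) \<ge> 0" using assms(1) by simp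
  ultimately show ?thesis by linarith
qed

text \<open>
  Sparse enough for the integrals to be summable: powers of $\log N_j$ grow like powers of $j$. Dense enough for consecutive terms to have a
  ratio tending to $1$.
\<close>
definition sampling :: "nat \<Rightarrow> nat" where
  "sampling j = nat \<lfloor>exp (sqrt (real j))\<rfloor>"

lemma sampling_at_top: "filterlim sampling at_top sequentially"
proof -
  have "filterlim (\<lambda>j. exp (sqrt (real j))) at_top sequentially" by real_asymp
  then show ?thesis unfolding sampling_def
    by (intro filterlim_compose[OF filterlim_nat_sequentially] filterlim_compose[OF filterlim_floor_sequentially])
qed

lemma sampling_bounds: "exp (sqrt (real j)) - 1 < real (sampling j)" "real (sampling j) \<le> exp (sqrt (real j))"
proof -
  have "real (sampling j) = real_of_int \<lfloor>exp (sqrt (real j))\<rfloor>" by (simp add: sampling_def)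
  then show "exp (sqrt (real j)) - 1 < real (sampling j)" "real (sampling j) \<le> exp (sqrt (real j))" by linarith+
qed

text \<open>
  Between consecutive sampling points at most $x (\sqrt{j+1} - \sqrt j) + 1$ terms of absolute value $1$ are added.
\<close>
lemma sup_mean_tendsto_0_if_sampled:
  assumes lim: "b \<longlonglongrightarrow> 0" and
    ev: "\<forall>\<^sub>F j in sequentially. \<forall>f\<in>M1. norm (\<Sum>n=1..sampling j. f n * unit_exp (\<alpha> * real (g n))) \<le> real (sampling j) * b j"
  shows "(sup_mean g \<alpha> \<longlongrightarrow> 0) at_top"
proof -
  \<comment> \<open>The index of the last sampling point up to \<open>x\<close>: \<open>sqrt j \<le> ln x < sqrt (j + 1)\<close>.\<close>
  define j where "j = (\<lambda>x::real. nat \<lfloor>(ln x)\<^sup>2\<rfloor>)"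
  define c where "c = (\<lambda>x. \<bar>b (j x)\<bar> + (sqrt (real (Suc (j x))) - sqrt (real (j x))) + 1 / x)"
  have j_top: "filterlim j at_top at_top"
  proof -
    have "filterlim (\<lambda>x::real. (ln x)\<^sup>2) at_top at_top" by real_asymp
    then show ?thesis unfolding j_def
      by (intro filterlim_compose[OF filterlim_nat_sequentially] filterlim_compose[OF filterlim_floor_sequentially])
  qed
  have "(\<lambda>j. \<bar>b j\<bar> + (sqrt (real (Suc j)) - sqrt (real j))) \<longlonglongrightarrow> 0 + 0"
  proof (rule tendsto_add)
    show "(\<lambda>j. \<bar>b j\<bar>) \<longlonglongrightarrow> 0" using lim by (rule tendsto_rabs_zero)
    show "(\<lambda>j. sqrt (real (Suc j)) - sqrt (real j)) \<longlonglongrightarrow> 0" by real_asymp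
  qed
  from filterlim_compose[OF this j_top]
  have "((\<lambda>x. \<bar>b (j x)\<bar> + (sqrt (real (Suc (j x))) - sqrt (real (j x)))) \<longlongrightarrow> 0) at_top" by simp
  moreover have "((\<lambda>x::real. 1 / x) \<longlongrightarrow> 0) at_top" by real_asymp
  ultimately have c: "(c \<longlongrightarrow> 0) at_top" unfolding c_def using tendsto_add by fastforce
  have "\<forall>\<^sub>F x in at_top. \<forall>f\<in>M1. norm (\<Sum>n=1..sampling (j x). f n * unit_exp (\<alpha> * real (g n))) \<le> real (sampling (j x)) * b (j x)"
    by (rule eventually_compose_filterlim[OF ev j_top])
  then have "\<forall>\<^sub>F x in at_top. 0 \<le> sup_mean g \<alpha> x \<and> sup_mean g \<alpha> x \<le> c x"
    using eventually_ge_at_top[of 1]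
  proof eventually_elim
    case (elim x)
    have x: "x \<ge> 1" "ln x \<ge> 0" using elim by auto
    let ?s = "sqrt (real (j x))" and ?N = "sampling (j x)" and ?m = "nat \<lfloor>x\<rfloor>"
    have "real (j x) \<le> (ln x)\<^sup>2" "(ln x)\<^sup>2 < real (Suc (j x))"
      unfolding j_def by (simp_all, linarith)
    then have s: "?s \<le> ln x" "ln x \<le> sqrt (real (Suc (j x)))"
      using x by (auto intro: real_le_lsqrt real_le_rsqrt)
    then have ex: "exp ?s \<le> x" using x by (metis exp_le_cancel_iff exp_ln less_le_trans zero_less_one)
    have Nx: "real ?N \<le> x" using sampling_bounds(2)[of "j x"] ex by linarith
    then have Nm: "?N \<le> ?m" using x by (simp add: le_nat_iff le_floor_iff)
    have m: "real ?m \<le> x" using x by simp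
    show ?case
    proof (rule sup_mean_bounds)
      show "x > 0" using x by simp
      fix f assume f: "f \<in> M1"
      let ?t = "\<lambda>n. f n * unit_exp (\<alpha> * real (g n))"
      have "{1..?m} = {1..?N} \<union> {?N<..?m}" using Nm by auto
      then have "(\<Sum>n=1..?m. ?t n) = (\<Sum>n=1..?N. ?t n) + (\<Sum>n\<in>{?N<..?m}. ?t n)"
        by (simp only:) (intro sum.union_disjoint, auto)
      then have "norm (\<Sum>n=1..?m. ?t n) \<le> norm (\<Sum>n=1..?N. ?t n) + norm (\<Sum>n\<in>{?N<..?m}. ?t n)"
        by (simp only: norm_triangle_ineq)
      also have "norm (\<Sum>n\<in>{?N<..?m}. ?t n) \<le> (\<Sum>n\<in>{?N<..?m}. 1)"
        by (rule order.trans[OF norm_sum], rule sum_mono) (auto simp: norm_mult norm_M1[OF f])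
      also have "\<dots> = real ?m - real ?N" using Nm by simp
      also have "\<dots> \<le> x * (ln x - ?s) + 1"
      proof -
        have "1 + (?s - ln x) \<le> exp (?s - ln x)" by (rule exp_ge_add_one_self)
        also have "\<dots> = exp ?s / x" using x by (simp add: exp_diff)
        finally have "x * (1 + (?s - ln x)) \<le> exp ?s" using x by (simp add: field_simps)
        then show ?thesis using m sampling_bounds(1)[of "j x"] by (simp add: algebra_simps)
      qed
      also have "\<dots> \<le> x * (sqrt (real (Suc (j x))) - ?s) + 1"
        using s x by (intro add_right_mono mult_left_mono) auto
      also have "norm (\<Sum>n=1..?N. ?t n) \<le> x * \<bar>b (j x)\<bar>"
      proof -
        have "norm (\<Sum>n=1..?N. ?t n) \<le> real ?N * b (j x)" using elim(1) f by blast
        also have "\<dots> \<le> real ?N * \<bar>b (j x)\<bar>" by (intro mult_left_mono) auto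
        also have "\<dots> \<le> x * \<bar>b (j x)\<bar>" using Nx by (intro mult_right_mono) auto
        finally show ?thesis .
      qed
      finally show "norm (\<Sum>n=1..?m. ?t n) \<le> x * c x"
        using x by (simp add: c_def distrib_left)
    qed
  qed
  then have "\<forall>\<^sub>F x in at_top. 0 \<le> sup_mean g \<alpha> x" "\<forall>\<^sub>F x in at_top. sup_mean g \<alpha> x \<le> c x"
    by (auto elim: eventually_mono)
  then show ?thesis by (rule tendsto_sandwich[OF _ _ tendsto_const c])
qed

text \<open>
  The weighted energies along the sampling points have summable integrals, so for almost every $\alpha$ they tend to $0$. In the bound of
  \<open>mean_le_correlations\<close>, divided by $L$, everything then tends to $0$, uniformly in $f$.
\<close>
theorem (in shift_map) AE_sup_mean_tendsto_0:
  "AE \<alpha> in lborel. \<alpha> \<in> {0..1} \<longrightarrow> (sup_mean (F ^^ Suc d) \<alpha> \<longlongrightarrow> 0) at_top"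
proof -
  define u where "u = (\<lambda>j. ln (real (sampling j)))"
  define N where "N = sampling"
  define T where "T = (\<lambda>j. saving_exp d (u j))"
  define lo where "lo = (\<lambda>j. lo_exp d (u j))"
  define hi where "hi = (\<lambda>j. hi_exp (u j))"
  define L where "L = (\<lambda>j. \<Sum>p\<in>window (lo j) (hi j). 1 / real p)"
  define G where "G = (\<lambda>j \<alpha>. (\<Sum>i\<in>{lo j..<hi j}. correlation_energy (\<lambda>n. unit_exp (\<alpha> * real ((F ^^ Suc d) n))) (N j) (2 ^ i)) / (real (N j))\<^sup>2)"
  define h where "h = (\<lambda>j \<alpha>. real (hi j) ^ 4 * G j \<alpha>)"
  have u_top: "filterlim u at_top sequentially"
    unfolding u_def by (rule filterlim_compose[OF ln_at_top filterlim_compose[OF filterlim_real_sequentially sampling_at_top]])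
  have L_top: "filterlim L at_top sequentially"
    unfolding L_def lo_def hi_def by (rule filterlim_compose[OF window_sum_at_top u_top])
  have G_nonneg: "G j \<alpha> \<ge> 0" for j \<alpha>
    unfolding G_def by (intro divide_nonneg_nonneg sum_nonneg correlation_energy_nonneg) auto
  define Cst where "Cst = 2 * coincidence_const d"
  have "\<forall>\<^sub>F j in sequentially. 2 \<le> T j"
    unfolding T_def using filterlim_compose[OF saving_exp_at_top u_top, of d] by (auto simp: filterlim_at_top)
  moreover have "\<forall>\<^sub>F j in sequentially. Suc d \<le> N j"
    unfolding N_def using sampling_at_top by (auto simp: filterlim_at_top)
  moreover have "\<forall>\<^sub>F j in sequentially. real (lo j + T j + hi j) \<le> u j"
    unfolding lo_def T_def hi_def by (rule eventually_compose_filterlim[OF eventually_window_small u_top])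
  moreover have "\<forall>\<^sub>F j in sequentially. real (hi j) ^ 5 * (Cst * (2 * harm (2 * N j + 1)) ^ (2 * d + 5) / 2 ^ T j) \<le> 1 / u j ^ 4"
    unfolding hi_def T_def u_def N_def
    by (rule eventually_compose_filterlim[OF eventually_bound_le sampling_at_top]) (simp add: Cst_def coincidence_const_def)
  moreover have "\<forall>\<^sub>F j in sequentially. u j \<ge> sqrt (real j) / 2"
  proof -
    have "\<forall>\<^sub>F j in sequentially. exp (sqrt (real j)) - 1 \<ge> exp (sqrt (real j) / 2)" by real_asymp
    then show ?thesis
    proof eventually_elim
      case (elim j)
      then have "exp (sqrt (real j) / 2) \<le> real (sampling j)" using sampling_bounds(1)[of j] by linarith
      then have "ln (exp (sqrt (real j) / 2)) \<le> u j"
        unfolding u_def by (metis exp_gt_zero ln_le_cancel_iff order.strict_trans2)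
      then show ?case by simp
    qed
  qed
  moreover have "\<forall>\<^sub>F j in sequentially. j \<ge> 1" by (rule eventually_ge_at_top)
  ultimately have "\<forall>\<^sub>F j in sequentially. 2 ^ hi j \<le> N j \<and>
      (\<exists>I. has_bochner_integral lborel (\<lambda>\<alpha>. h j \<alpha> * indicator {0..1} \<alpha>) I \<and> I \<le> 16 / (real j)\<^sup>2)"
  proof eventually_elim
    case (elim j)
    have "real (2 ^ (lo j + T j + hi j)) = exp (real (lo j + T j + hi j) * ln 2)"
      by (simp only: exp_of_nat_mult) simp
    also have "\<dots> \<le> exp (u j)"
    proof -
      have "real (lo j + T j + hi j) * ln 2 \<le> real (lo j + T j + hi j) * 1"
        using ln_2_less_1 by (intro mult_left_mono) auto
      also have "\<dots> \<le> u j" using elim(3) by simp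
      finally show ?thesis by simp
    qed
    also have "\<dots> = real (N j)" using elim by (simp add: u_def N_def)
    finally have N: "2 ^ (lo j + T j + hi j) \<le> N j" by (simp only: of_nat_le_iff)
    have "2 ^ hi j \<le> (2::nat) ^ (lo j + T j + hi j)" by (intro power_increasing) auto
    then have 1: "2 ^ hi j \<le> N j" using N by linarith
    obtain I where I: "has_bochner_integral lborel (\<lambda>\<alpha>. h j \<alpha> * indicator {0..1} \<alpha>) I"
      "I \<le> real (hi j) ^ 5 * (Cst * (2 * harm (2 * N j + 1)) ^ (2 * d + 5) / 2 ^ T j)"
      using weighted_energy_has_integral[OF elim(1,2) _ N] unfolding h_def G_def Cst_def lo_def lo_exp_def T_def[symmetric]
      by (auto simp: T_def)
    \<comment> \<open>As \<open>u j \<ge> sqrt j / 2\<close>, the fourth power makes this summable over \<open>j\<close>.\<close>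
    have "I \<le> 1 / u j ^ 4" using I elim by linarith
    also have "\<dots> \<le> 1 / (sqrt (real j) / 2) ^ 4"
      using elim by (intro divide_left_mono power_mono mult_pos_pos) auto
    also have "\<dots> = 16 / (real j)\<^sup>2"
      by (simp add: power_divide power4_eq_xxxx power2_eq_square)
    finally show ?case using 1 I(1) by blast
  qed
  then obtain j0 where j0: "\<And>j. j \<ge> j0 \<Longrightarrow> 2 ^ hi j \<le> N j \<and>
      (\<exists>I. has_bochner_integral lborel (\<lambda>\<alpha>. h j \<alpha> * indicator {0..1} \<alpha>) I \<and> I \<le> 16 / (real j)\<^sup>2)"
    by (auto simp: eventually_at_top_linorder)
  have "\<exists>I. has_bochner_integral lborel (\<lambda>\<alpha>. h (j + j0) \<alpha> * indicator {0..1} \<alpha>) I \<and> I \<le> 16 / (real (j + j0))\<^sup>2" for j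
    by (rule j0[THEN conjunct2, OF le_add2])
  then obtain I where I: "\<And>j. has_bochner_integral lborel (\<lambda>\<alpha>. h (j + j0) \<alpha> * indicator {0..1} \<alpha>) (I j)"
    "\<And>j. I j \<le> 16 / (real (j + j0))\<^sup>2" by metis
  have h_nonneg: "h j \<alpha> \<ge> 0" for j \<alpha> unfolding h_def using G_nonneg by simp
  have I_nonneg: "I j \<ge> 0" for j
    using has_bochner_integral_integral_eq[OF I(1)[of j]] h_nonneg
      Bochner_Integration.integral_nonneg[of lborel "\<lambda>\<alpha>. h (j + j0) \<alpha> * indicator {0..1} \<alpha>"] by simp
  have "summable (\<lambda>j. 16 / (real j)\<^sup>2)"
    using summable_mult[OF inverse_power_summable[of 2, where 'a = real], of 16] by (simp add: divide_inverse)
  then have "summable (\<lambda>j. 16 / (real (j + j0))\<^sup>2)" by (rule summable_ignore_initial_segment)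
  then have "summable I" by (rule summable_comparison_test'[where N = 0]) (use I(2) I_nonneg in auto)
  then have "AE \<alpha> in lborel. \<alpha> \<in> {0..1} \<longrightarrow> (\<lambda>j. h (j + j0) \<alpha>) \<longlonglongrightarrow> 0"
    using I(1) h_nonneg by (intro AE_tendsto_0_if_summable_integrals) auto
  then show ?thesis
  proof eventually_elim
    case (elim \<alpha>)
    show ?case
    proof
      assume "\<alpha> \<in> {0..1}"
      with elim have "(\<lambda>j. h (j + j0) \<alpha>) \<longlonglongrightarrow> 0" by simp
      then have lim: "(\<lambda>j. h j \<alpha>) \<longlonglongrightarrow> 0" by (rule LIMSEQ_offset)
      define b where "b = (\<lambda>j. (sqrt (3 * L j) + 6 + sqrt (sqrt (h j \<alpha>))) / L j)"
      have "b \<longlonglongrightarrow> 0"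
      proof -
        have s: "(\<lambda>j. 6 + sqrt (sqrt (h j \<alpha>))) \<longlonglongrightarrow> 6 + sqrt (sqrt 0)"
          by (intro tendsto_intros lim)
        have "((\<lambda>x::real. sqrt (3 * x) / x) \<longlongrightarrow> 0) at_top" by real_asymp
        from filterlim_compose[OF this L_top] have "(\<lambda>j. sqrt (3 * L j) / L j) \<longlonglongrightarrow> 0" .
        moreover have "(\<lambda>j. (6 + sqrt (sqrt (h j \<alpha>))) / L j) \<longlonglongrightarrow> 0"
          using s filterlim_at_top_imp_at_infinity[OF L_top] by (rule tendsto_divide_0)
        ultimately have "(\<lambda>j. sqrt (3 * L j) / L j + (6 + sqrt (sqrt (h j \<alpha>))) / L j) \<longlonglongrightarrow> 0 + 0"
          by (rule tendsto_add)
        then show ?thesis by (simp add: b_def add_divide_distrib add.assoc)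
      qed
      moreover have "\<forall>\<^sub>F j in sequentially. L j > 0" using L_top by (auto simp: filterlim_at_top_dense)
      then have "\<forall>\<^sub>F j in sequentially. \<forall>f\<in>M1. norm (\<Sum>n=1..sampling j. f n * unit_exp (\<alpha> * real ((F ^^ Suc d) n))) \<le> real (sampling j) * b j"
        using eventually_ge_at_top[of j0]
      proof eventually_elim
        case (elim j)
        show ?case
        proof
          fix f assume f: "f \<in> M1"
          have "real (hi j) ^ 4 = ((real (hi j))\<^sup>2)\<^sup>2" by (simp flip: power_mult)
          then have "h j \<alpha> = ((real (hi j))\<^sup>2)\<^sup>2 * G j \<alpha>" by (simp only: h_def)
          then have "real (hi j) * sqrt (sqrt (G j \<alpha>)) = sqrt (sqrt (h j \<alpha>))"
            by (simp only: real_sqrt_mult real_sqrt_abs abs_of_nonneg zero_le_power2 of_nat_0_le_iff)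
          then have "L j * norm (\<Sum>n=1..N j. f n * unit_exp (\<alpha> * real ((F ^^ Suc d) n))) \<le>
              real (N j) * (sqrt (3 * L j) + 6 + sqrt (sqrt (h j \<alpha>)))"
            using mean_le_correlations[OF f, of "\<lambda>n. unit_exp (\<alpha> * real ((F ^^ Suc d) n))" "hi j" "N j" "lo j"] j0[OF elim(2)]
            by (simp add: L_def G_def)
          then show "norm (\<Sum>n=1..sampling j. f n * unit_exp (\<alpha> * real ((F ^^ Suc d) n))) \<le> real (sampling j) * b j"
            using elim(1) by (simp add: b_def N_def field_simps)
        qed
      qed
      ultimately show "(sup_mean (F ^^ Suc d) \<alpha> \<longlongrightarrow> 0) at_top" by (rule sup_mean_tendsto_0_if_sampled)
    qed
  qed
qed

section \<open>Euler's totient and the sum of divisors\<close>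

interpretation totient_map: shift_map totient
proof
  show "totient n \<le> n\<^sup>2" if "n > 0" for n :: nat
    using totient_le[of n] that by (simp add: power2_eq_square order.trans)
qed (auto simp: totient_mult_coprime totient_prime)

lemma divisor_sum_mult_coprime:
  assumes "m > 0" "n > 0" "coprime m (n::nat)"
  shows "divisor_sum (m * n) = divisor_sum m * divisor_sum n"
proof -
  let ?D = "{d. d dvd m} \<times> {d. d dvd n}"
  let ?f = "\<lambda>(a, b). a * b :: nat"
  have "inj_on ?f ?D"
  proof (rule inj_on_inverseI[where g = "\<lambda>d. (gcd d m, gcd d n)"])
    fix t assume "t \<in> ?D"
    then obtain a b where ab: "t = (a, b)" "a dvd m" "b dvd n" by blast
    have "coprime m b" by (rule coprime_divisors[OF dvd_refl ab(3) assms(3)])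
    moreover have "coprime n a" using coprime_divisors[OF ab(2) dvd_refl assms(3)] by (simp only: coprime_commute)
    ultimately show "(gcd (?f t) m, gcd (?f t) n) = t"
      using ab by (simp add: gcd_mult_left_right_cancel gcd_mult_left_left_cancel gcd_nat.absorb1)
  qed
  moreover have "?f ` ?D = {d. d dvd m * n}"
  proof
    show "?f ` ?D \<subseteq> {d. d dvd m * n}" by (auto intro: mult_dvd_mono)
    show "{d. d dvd m * n} \<subseteq> ?f ` ?D"
    proof
      fix d assume "d \<in> {d. d dvd m * n}"
      then obtain a b where "d = a * b" "a dvd m" "b dvd n" using division_decomp[of d m n] by blast
      then show "d \<in> ?f ` ?D" by (intro image_eqI[of _ _ "(a, b)"]) auto
    qed
  qed
  ultimately have "divisor_sum (m * n) = (\<Sum>t\<in>?D. ?f t)"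
    unfolding divisor_sum_def by (metis (no_types, lifting) sum.reindex_cong)
  then show ?thesis by (simp add: divisor_sum_def sum_product sum.cartesian_product)
qed

interpretation divisor_sum_map: shift_map divisor_sum
proof
  fix n :: nat assume n: "n > 0"
  then show "divisor_sum n > 0"
    unfolding divisor_sum_def by (intro sum_pos) (auto dest: dvd_pos_nat)
  have "divisor_sum n \<le> (\<Sum>d\<in>{1..n}. n)"
    unfolding divisor_sum_def
  proof (rule sum_le_included[where i = id])
    show "\<forall>x\<in>{d. d dvd n}. \<exists>t\<in>{1..n}. id t = x \<and> x \<le> n"
      using n by (auto dest: dvd_imp_le dvd_pos_nat simp: Suc_le_eq)
  qed (use n in auto)
  then show "divisor_sum n \<le> n\<^sup>2" by (simp add: power2_eq_square)
next
  have "divisor_sum p = p + 1" if "prime p" for p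
  proof -
    have "{d. d dvd p} = {1, p}" using that by (auto simp: prime_nat_iff)
    then show ?thesis using prime_gt_1_nat[OF that] by (simp add: divisor_sum_def)
  qed
  then show "(\<forall>p. prime p \<longrightarrow> divisor_sum p = p + 1) \<or> (\<forall>p. prime p \<longrightarrow> divisor_sum p = p - 1)" by blast
qed (rule divisor_sum_mult_coprime)

theorem theoremB:
  fixes k :: nat
  assumes "k \<ge> 1"
  shows "AE \<alpha> in lebesgue. \<alpha> \<in> {0<..<1} \<longrightarrow>
           (sup_mean (totient ^^ k) \<alpha> \<longlongrightarrow> 0) at_top \<and>
           (sup_mean (divisor_sum ^^ k) \<alpha> \<longlongrightarrow> 0) at_top"
proof -
  obtain d where k: "k = Suc d" using assms by (cases k) auto
  have "AE \<alpha> in lborel. \<alpha> \<in> {0<..<1} \<longrightarrow>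
           (sup_mean (totient ^^ k) \<alpha> \<longlongrightarrow> 0) at_top \<and>
           (sup_mean (divisor_sum ^^ k) \<alpha> \<longlongrightarrow> 0) at_top"
    using totient_map.AE_sup_mean_tendsto_0[of d] divisor_sum_map.AE_sup_mean_tendsto_0[of d]
    by eventually_elim (auto simp: k simp del: funpow.simps)
  then show ?thesis by (rule AE_completion)
qed

end
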